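(* Let $\psi:\mathbb{R}_+\to\mathbb{R}_+$ be monotone increasing, let $f$ be a piecewise smooth function with rational discontinuities (defined in the context), and let $q\in\mathbb{Q}$. (a) If $\sum_{k=1}^\infty \frac{1}{\psi(k)}=\infty$, then for Lebesgue-almost every $\alpha\in[0,1)$ both sets $$\{N\in\mathbb{N}: S_N(f,\alpha,q)\ge \psi(\log N)\},\qquad \{N\in\mathbb{N}: S_N(f,\alpha,q)\le -\psi(\log N)\}$$ have positive upper density. (b) If $\sum_{k=1}^\infty \frac{1}{\psi(k)}<\infty$, then there exists a constant $c>0$ such that for almost every $\alpha\in[0,1)$ the set $$\{N\in\mathbb{N}: |S_N(f,\alpha,q)|\ge \psi(\log N)+c\log N\log\log N\}$$ is finite.
   Context: For a $1$-periodic $f:\mathbb{R}\to\mathbb{R}$ integrable on $[0,1)$, $\alpha,q\in\mathbb{R}$ and $N\in\mathbb{N}$, set $S_N(f,\alpha,q):=\sum_{n=1}^N f(n\alpha+q)-N\int_0^1 f(x)\,dx$. A $1$-periodic function $f:\mathbb{R}\to\mathbb{R}$ is a piecewise smooth function with rational discontinuities if there exist $\nu\ge1$ and rationals $0\le x_1<\dots<x_\nu<1$ such that: $f$ is differentiable on $[0,1)\setminus\{x_1,\dots,x_\nu\}$; the restriction of $f'$ to $[0,1)$ extends to a function of bounded variation on $[0,1)$; and there is some $i$ with $\lim_{\delta\to0}[f(x_i-\delta)-f(x_i+\delta)]\neq0$. The upper density of $A\subseteq\mathbb{N}$ is $\limsup_{M\to\infty}|\{N\le M:N\in A\}|/M$.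 *)

theory Defs
  imports "HOL-Analysis.Analysis"
begin

definition bounded_variation_on :: "(real \<Rightarrow> real) \<Rightarrow> real set \<Rightarrow> bool" where
  "bounded_variation_on g S \<longleftrightarrow>
     (\<exists>B. \<forall>(n::nat) (t::nat \<Rightarrow> real).
        (\<forall>i\<le>n. t i \<in> S) \<and> (\<forall>i<n. t i \<le> t (Suc i)) \<longrightarrow>
        (\<Sum>i<n. \<bar>g (t (Suc i)) - g (t i)\<bar>) \<le> B)"

definition pw_smooth_rat_disc :: "(real \<Rightarrow> real) \<Rightarrow> bool" where
  "pw_smooth_rat_disc f \<longleftrightarrow>
     (\<forall>x. f (x + 1) = f x) \<and>
     (\<exists>xs :: real list.
        xs \<noteq> [] \<and> sorted_wrt (<) xs \<and> set xs \<subseteq> \<rat> \<inter> {0..<1} \<and>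
        (\<exists>g. bounded_variation_on g {0..<1} \<and>
             (\<forall>x \<in> {0..<1} - set xs. (f has_real_derivative g x) (at x within {0..<1}))) \<and>
        (\<exists>x \<in> set xs. \<exists>L. L \<noteq> 0 \<and>
             ((\<lambda>\<delta>. f (x - \<delta>) - f (x + \<delta>)) \<longlongrightarrow> L) (at_right 0)))"

definition birkhoff_S :: "(real \<Rightarrow> real) \<Rightarrow> real \<Rightarrow> real \<Rightarrow> nat \<Rightarrow> real" where
  "birkhoff_S f \<alpha> q N = (\<Sum>n = 1..N. f (real n * \<alpha> + q)) - real N * integral {0..1} f"

definition upper_density :: "nat set \<Rightarrow> ereal" where
  "upper_density A = limsup (\<lambda>M. ereal (real (card {N \<in> A. 1 \<le> N \<and> N \<le> M}) / real M))"

end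

theory Submission
  imports Defs "HOL-Real_Asymp.Real_Asymp"
begin

text \<open>Subtracting sawtooth functions at the jumps of \<open>f\<close> leaves a Lipschitz function whose Riemann
  sums over \<open>q\<close> equally spaced points have error \<open>O(1 / q)\<close>. Writing \<open>N = b\<^sub>0 q\<^sub>0 + b\<^sub>1 q\<^sub>1 + \<dots>\<close> in terms
  of the convergent denominators of \<open>\<alpha>\<close>, one finds that \<open>S\<^sub>N\<close> is a sum of terms
  \<open>\<plusminus> a\<^sub>i G(\<plusminus> b\<^sub>i / a\<^sub>i)\<close> up to a small error, where \<open>a\<^sub>i\<close> are the digits of \<open>\<alpha>\<close> and the Lipschitz function
  \<open>G\<close> depends on \<open>q\<^sub>i\<close> only modulo a common denominator \<open>d\<close> of the distances from \<open>q\<close> to the jumps.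

  Hence \<open>|S\<^sub>N|\<close> is at most a constant times the digit sum. Almost surely the sum of the first \<open>n\<close> digits
  without the largest one is \<open>O(n log n)\<close>, and by Borel--Cantelli the largest one is eventually small
  compared with \<open>\<psi>\<close> if \<open>\<Sum>1 / \<psi>\<close> converges.

  If the series diverges, a digit of size about \<open>\<psi>\<close> at a position where the last two denominators are
  \<open>(1, 0)\<close> modulo \<open>d\<close> makes its own term dominate \<open>\<psi>\<close> for a positive proportion of the \<open>b\<^sub>i\<close>. The earlier terms
  cannot spoil this for more than half of the \<open>N\<close>: replacing each \<open>b\<^sub>i\<close> by \<open>a\<^sub>i - b\<^sub>i\<close> on a block whose parity
  has been shifted reverses the sign of their sum, so the favourable parity can be prescribed for each
  block. Such digits occur infinitely often with probability bounded below in every cylinder, by the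
  Kochen--Stone lemma, hence almost surely.\<close>

section \<open>Continued fractions and cylinders\<close>

text \<open>In the divergent case the obstacle is size: the earlier terms are only bounded by a
  multiple of the digit sum, typically of order \<open>n log n\<close>, whereas \<open>psi\<close>
  may be linear. Hence no bound on their magnitude is used, only a sign that holds for at least half
  of the digit vectors.

  What is left is an error of bounded size per level. It is paid for by asking the large digit to
  exceed a multiple of \<open>psi\<close> plus a linear function of the position; for monotone
  \<open>psi\<close> the linear summand does not destroy the divergence of the reciprocal series.
  Denominators grow at most exponentially almost surely, so \<open>log N\<close> and the position
  are comparable.

  The terms depend on the denominators modulo \<open>d\<close>. After a prefix whose last two
  denominators are \<open>(1, 0)\<close> modulo \<open>d\<close>, the residues restart as for the
  empty prefix, so the sign behaviour of the next block depends on the block alone. The prefix can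
  then be adapted to the block: there are finitely many residue pairs, so words of bounded length
  with bounded digits reach \<open>(1, 0)\<close> with either parity, and inserting them changes
  measures and denominators by bounded factors only.\<close>

definition irr :: "real set" where "irr = {0<..<1} - \<rat>"

definition gauss :: "real \<Rightarrow> real" where "gauss x = frac (1 / x)"

definition dig :: "real \<Rightarrow> nat \<Rightarrow> nat" where "dig x n = nat \<lfloor>1 / (gauss ^^ n) x\<rfloor>"

definition pre :: "real \<Rightarrow> nat \<Rightarrow> nat list" where "pre x n = map (dig x) [0..<n]"

fun step :: "nat \<times> nat \<Rightarrow> nat \<Rightarrow> nat \<times> nat" where "step (q, q') a = (a * q + q', q)"

text \<open>\<open>num w / den w\<close> is the convergent with digits \<open>w\<close>; the primed quantities belong to the convergent
  before it, and \<open>mob w\<close> maps the tail of a number with first digits \<open>w\<close> back to that number.\<close>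
definition den :: "nat list \<Rightarrow> nat" where "den w = fst (foldl step (1, 0) w)"
definition den' :: "nat list \<Rightarrow> nat" where "den' w = snd (foldl step (1, 0) w)"
definition num :: "nat list \<Rightarrow> nat" where "num w = fst (foldl step (0, 1) w)"
definition num' :: "nat list \<Rightarrow> nat" where "num' w = snd (foldl step (0, 1) w)"

abbreviation positive :: "nat list \<Rightarrow> bool" where "positive w \<equiv> 0 \<notin> set w"

definition mob :: "nat list \<Rightarrow> real \<Rightarrow> real" where
  "mob w t = (real (num w) + t * real (num' w)) / (real (den w) + t * real (den' w))"

definition cyl :: "nat list \<Rightarrow> real set" where "cyl w = {x \<in> irr. pre x (length w) = w}"

lemma den_Nil [simp]: "den [] = 1" "den' [] = 0" "num [] = 0" "num' [] = 1"
  by (simp_all add: den_def den'_def num_def num'_def)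

lemma fst_step: "fst (step p a) = a * fst p + snd p" "snd (step p a) = fst p"
  by (cases p; simp)+

lemma den_snoc [simp]: "den (w @ [a]) = a * den w + den' w" "den' (w @ [a]) = den w"
    "num (w @ [a]) = a * num w + num' w" "num' (w @ [a]) = num w"
  by (simp_all add: den_def den'_def num_def num'_def fst_step)

text \<open>A step is linear in the pair, so the fold from any start is the same combination of the
  folds from \<open>(1, 0)\<close> and \<open>(0, 1)\<close>. Concatenation of words thus becomes a
  product of 2 by 2 matrices.\<close>

lemma foldl_step:
  "foldl step (x, y) w = (x * den w + y * num w, x * den' w + y * num' w)"
  by (induction w rule: rev_induct) (simp_all add: algebra_simps)

lemma den_append:
  "den (v @ u) = den v * den u + den' v * num u" "den' (v @ u) = den v * den' u + den' v * num' u"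
  using foldl_step[of "den v" "den' v" u] by (simp_all add: den_def den'_def)

lemma den_Cons:
  "den (a # w) = a * den w + num w" "den' (a # w) = a * den' w + num' w"
  "num (a # w) = den w" "num' (a # w) = den' w"
  using foldl_step[of a 1 w] foldl_step[of 1 0 w]
  by (simp_all add: den_def den'_def num_def num'_def)

lemma den_pos: "positive w \<Longrightarrow> den w \<ge> 1"
  by (induction w rule: rev_induct) (auto simp: Suc_le_eq)

lemma den'_le: "positive w \<Longrightarrow> den' w \<le> den w"
  by (induction w rule: rev_induct) (auto intro: trans_le_add1)

text \<open>The first inequality is not inductive by itself, since \<open>num'\<close> exceeds
  \<open>den'\<close> for the empty word. Splitting one copy off the digit,
  \<open>a = b + 1\<close>, leaves \<open>b\<close> times the first inequality plus the
  second.\<close>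

lemma num_le: "positive w \<Longrightarrow> num w \<le> den w \<and> num w + num' w \<le> den w + den' w"
proof (induction w rule: rev_induct)
  case (snoc a w)
  then obtain b where a: "a = Suc b" by (cases a) auto
  have 1: "num w \<le> den w" "num w + num' w \<le> den w + den' w" using snoc by auto
  then have "b * num w \<le> b * den w" by simp
  with 1 have "num w + b * num w + num' w \<le> den w + b * den w + den' w"
    "num w + b * num w + num' w + num w \<le> den w + b * den w + den' w + den w" by linarith+
  then show ?case by (simp add: a)
qed simp

lemma den_fib: "2 * den v \<le> den (v @ [a, b])" if "a \<ge> 1" "b \<ge> 1" "positive v"
proof -
  have "den (v @ [a, b]) = b * (a * den v + den' v) + den v"
    using den_snoc[of "v @ [a]" b] by simp
  moreover have "1 * (1 * den v) \<le> b * (a * den v + den' v)"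
    using that by (intro mult_le_mono) (auto intro: trans_le_add1)
  ultimately show ?thesis by simp
qed

lemma det: "real (num' w) * real (den w) - real (num w) * real (den' w) = (-1) ^ length w"
  by (induction w rule: rev_induct) (auto simp: algebra_simps)

lemma mob_Cons:
  assumes "positive w" "t \<ge> 0"
  shows "mob (a # w) t = 1 / (real a + mob w t)"
proof -
  have "real (den w) + t * real (den' w) > 0"
    using den_pos[OF assms(1)] assms(2) by (intro add_pos_nonneg) auto
  then show ?thesis
    by (simp add: mob_def den_Cons divide_simps) (simp add: algebra_simps)
qed

section \<open>The Gauss map on irrational numbers\<close>

lemma irrD: "x \<in> irr \<Longrightarrow> 0 < x" "x \<in> irr \<Longrightarrow> x < 1" "x \<in> irr \<Longrightarrow> x \<notin> \<rat>"
  by (auto simp: irr_def)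

lemma inverse_not_Rats: "x \<notin> \<rat> \<Longrightarrow> 1 / x \<notin> \<rat>" for x :: real
  by (metis Rats_1 Rats_divide div_by_1 divide_divide_eq_right mult_1)

lemma gauss_irr: assumes "x \<in> irr" shows "gauss x \<in> irr"
proof -
  have "1 / x \<notin> \<rat>" using assms irrD inverse_not_Rats by blast
  then have "frac (1/x) \<notin> \<rat>"
    by (metis Rats_add Rats_of_int add.commute diff_add_cancel frac_def)
  then show ?thesis
    using frac_lt_1[of "1/x"] frac_ge_0[of "1/x"]
    by (metis DiffI Rats_0 gauss_def greaterThanLessThan_iff irr_def less_le)
qed

lemma gauss_pow_irr: "x \<in> irr \<Longrightarrow> (gauss ^^ n) x \<in> irr"
  by (induction n) (auto intro: gauss_irr)

lemma dig_floor: assumes "x \<in> irr" shows "real (dig x n) = \<lfloor>1 / (gauss ^^ n) x\<rfloor>"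
  using irrD(1)[OF gauss_pow_irr[OF assms, of n]] by (simp add: dig_def)

lemma dig_pos: assumes "x \<in> irr" shows "dig x n \<ge> 1"
proof -
  let ?t = "(gauss ^^ n) x"
  have "?t \<in> irr" using gauss_pow_irr assms by blast
  then have "1 / ?t \<ge> 1" using irrD by (simp add: less_imp_le)
  then have "\<lfloor>1 / ?t\<rfloor> \<ge> 1" by (simp only: le_floor_iff of_int_1)
  then show ?thesis unfolding dig_def by linarith
qed

lemma inverse_gauss_pow:
  assumes "x \<in> irr" shows "1 / (gauss ^^ n) x = real (dig x n) + (gauss ^^ Suc n) x"
  using dig_floor[OF assms, of n] by (simp add: gauss_def frac_def)

lemma length_pre [simp]: "length (pre x n) = n"
  by (simp add: pre_def)

lemma pre_Suc: "pre x (Suc n) = pre x n @ [dig x n]"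
  by (simp add: pre_def)

lemma pre_0 [simp]: "pre x 0 = []"
  by (simp add: pre_def)

lemma nth_pre: "i < n \<Longrightarrow> pre x n ! i = dig x i"
  by (simp add: pre_def)

lemma take_pre: "i \<le> n \<Longrightarrow> take i (pre x n) = pre x i"
  by (simp add: pre_def take_map)

lemma pre_positive: "x \<in> irr \<Longrightarrow> positive (pre x n)"
  using dig_pos[of x] unfolding pre_def by (metis ex_map_conv not_one_le_zero)

lemma dig_Suc: "dig x (Suc n) = dig (gauss x) n"
  by (simp add: dig_def funpow_swap1)

lemma pre_Suc': "pre x (Suc n) = dig x 0 # pre (gauss x) n"
  by (simp add: pre_def upt_conv_Cons map_Suc_upt[symmetric] dig_Suc del: upt_Suc)

lemma mob_pre: "x \<in> irr \<Longrightarrow> x = mob (pre x n) ((gauss ^^ n) x)"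
proof (induction n arbitrary: x)
  case 0 then show ?case by (simp add: mob_def)
next
  case (Suc n)
  have g: "gauss x \<in> irr" using Suc gauss_irr by blast
  have "mob (pre x (Suc n)) ((gauss ^^ Suc n) x) = 1 / (real (dig x 0) + mob (pre (gauss x) n) ((gauss ^^ n) (gauss x)))"
    using irrD(1)[OF gauss_pow_irr[OF g, of n]] pre_positive[OF g, of n]
    by (simp only: pre_Suc' funpow_Suc_right o_apply) (rule mob_Cons; simp)
  also have "\<dots> = 1 / (real (dig x 0) + gauss x)" using Suc.IH[OF g] by simp
  also have "\<dots> = x" unfolding inverse_gauss_pow[OF Suc.prems, of 0, simplified, symmetric] by simp
  finally show ?case by simp
qed

lemma gauss_inverse:
  assumes "y \<in> irr" "a \<ge> 1"
  shows "gauss (1 / (real a + y)) = y" "dig (1 / (real a + y)) 0 = a" "1 / (real a + y) \<in> irr"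
proof -
  have f: "\<lfloor>real a + y\<rfloor> = int a"
    using irrD[OF assms(1)] by (simp add: floor_eq_iff)
  then show "gauss (1 / (real a + y)) = y" "dig (1 / (real a + y)) 0 = a"
    by (simp_all add: gauss_def frac_def dig_def)
  have "real a + y \<notin> \<rat>"
    using irrD[OF assms(1)] by (metis Rats_diff Rats_of_nat add_diff_cancel_left')
  then show "1 / (real a + y) \<in> irr"
    using inverse_not_Rats irrD[OF assms(1)] assms(2) by (auto simp: irr_def)
qed

lemma mob_irr:
  assumes "positive w" "t \<in> irr"
  shows "mob w t \<in> irr \<and> pre (mob w t) (length w) = w \<and> (gauss ^^ length w) (mob w t) = t"
  using assms
proof (induction w)
  case Nil then show ?case by (simp add: mob_def)
next
  case (Cons a w)
  then have IH: "mob w t \<in> irr" "pre (mob w t) (length w) = w" "(gauss ^^ length w) (mob w t) = t"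
    and a: "a \<ge> 1" by auto
  have m: "mob (a # w) t = 1 / (real a + mob w t)"
    using Cons irrD by (intro mob_Cons) (auto intro: less_imp_le)
  show ?case using gauss_inverse[OF IH(1) a] IH(2,3)
    by (simp add: m pre_Suc' funpow_swap1)
qed

lemma cyl_mob: "positive w \<Longrightarrow> cyl w = mob w ` irr"
proof (intro equalityI subsetI)
  fix x assume "x \<in> cyl w"
  then have "x \<in> irr" "pre x (length w) = w" by (auto simp: cyl_def)
  then show "x \<in> mob w ` irr" using mob_pre[of x "length w"] gauss_pow_irr by (metis imageI)
next
  fix x assume "positive w" "x \<in> mob w ` irr"
  then show "x \<in> cyl w" using mob_irr by (auto simp: cyl_def)
qed

lemma den_mob_pos: "positive w \<Longrightarrow> t \<ge> 0 \<Longrightarrow> real (den w) + t * real (den' w) > 0"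
  using den_pos[of w] by (intro add_pos_nonneg) auto

text \<open>The difference of two values is \<open>t - s\<close> times the determinant of the
  convergents over the product of the denominators. It gives the orientation of the map and the
  lengths of image intervals.\<close>

lemma mob_diff:
  assumes "positive w" "s \<ge> 0" "t \<ge> 0"
  shows "mob w t - mob w s = (-1) ^ length w * (t - s) /
     ((real (den w) + t * real (den' w)) * (real (den w) + s * real (den' w)))"
proof -
  note p = den_mob_pos[OF assms(1,2)] den_mob_pos[OF assms(1,3)]
  show ?thesis
    using p by (simp add: mob_def diff_frac_eq det[symmetric]) (simp add: divide_simps algebra_simps)
qed

lemma mob_Rats: "t \<in> \<rat> \<Longrightarrow> mob w t \<in> \<rat>"
  by (simp add: mob_def)

text \<open>The map preserves rationality and irrationality, so with rational endpoints the image is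
  exactly an open interval without its rationals. Minimum and maximum are needed because the
  orientation alternates with the length of \<open>w\<close>.\<close>

lemma mob_image_interval:
  assumes w: "positive w" and "0 \<le> u" "u < v" and uv: "u \<in> \<rat>" "v \<in> \<rat>" "v \<le> 1"
  shows "mob w ` (irr \<inter> {u<..<v}) = {min (mob w u) (mob w v)<..<max (mob w u) (mob w v)} - \<rat>"
proof (intro equalityI subsetI)
  fix x assume "x \<in> mob w ` (irr \<inter> {u<..<v})"
  then obtain t where t: "t \<in> irr" "u < t" "t < v" "x = mob w t" by auto
  have P: "real (den w) + s * real (den' w) > 0" if "s \<ge> 0" for s using den_mob_pos w that by blast
  have "x \<in> irr" using mob_irr[OF w t(1)] t(4) by simp
  then have xr: "x \<notin> \<rat>" using irrD by blast
  have d1: "x - mob w u = (-1) ^ length w * ((t - u) /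
     ((real (den w) + t * real (den' w)) * (real (den w) + u * real (den' w))))"
    using mob_diff[OF w, of u t] assms t by simp
  have d2: "mob w v - x = (-1) ^ length w * ((v - t) /
     ((real (den w) + v * real (den' w)) * (real (den w) + t * real (den' w))))"
    using mob_diff[OF w, of t v] assms t by simp
  have p1: "(t - u) / ((real (den w) + t * real (den' w)) * (real (den w) + u * real (den' w))) > 0"
    using assms t P by (intro divide_pos_pos mult_pos_pos) auto
  have p2: "(v - t) / ((real (den w) + v * real (den' w)) * (real (den w) + t * real (den' w))) > 0"
    using assms t P by (intro divide_pos_pos mult_pos_pos) auto
  show "x \<in> {min (mob w u) (mob w v)<..<max (mob w u) (mob w v)} - \<rat>"
    using d1 d2 p1 p2 xr
    by (cases "even (length w)") (simp_all add: minus_one_power_iff min_less_iff_disj less_max_iff_disj del: times_divide_eq_right minus_divide_left zero_less_divide_iff)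
next
  fix x assume x: "x \<in> {min (mob w u) (mob w v)<..<max (mob w u) (mob w v)} - \<rat>"
  have "continuous_on {u..v} (mob w)"
    unfolding mob_def using den_mob_pos[OF w] assms(2)
    by (intro continuous_intros) (metis atLeastAtMost_iff order_less_irrefl order_trans)
  then have "\<exists>t\<ge>u. t \<le> v \<and> mob w t = x"
    using x assms(3) IVT'[of "mob w" u x v] IVT2'[of "mob w" v x u] by (auto simp: min_def max_def split: if_splits)
  then obtain t where t: "u \<le> t" "t \<le> v" "mob w t = x" by auto
  have "t \<notin> \<rat>" using x t mob_Rats by auto
  then have "t \<in> irr \<inter> {u<..<v}" using t assms by (auto simp: irr_def less_le)
  then show "x \<in> mob w ` (irr \<inter> {u<..<v})" using t(3) by blast
qed

section \<open>Lebesgue measure of cylinders\<close>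

lemma Rats_null: "\<rat> \<in> null_sets lborel"
  by (simp add: countable_imp_null_set_lborel countable_rat)

lemma measure_Ioo_diff_Rats: "a \<le> b \<Longrightarrow> measure lborel ({a<..<b} - \<rat>) = b - a"
proof -
  assume "a \<le> b"
  have "emeasure lborel ({a<..<b} - \<rat>) = emeasure lborel {a<..<b}"
    by (rule emeasure_Diff_null_set[OF Rats_null]) simp
  then show ?thesis using \<open>a \<le> b\<close> by (simp add: measure_def)
qed

lemma measure_mob_image:
  assumes w: "positive w" and "0 \<le> u" "u < v" and uv: "u \<in> \<rat>" "v \<in> \<rat>" "v \<le> 1"
  shows "mob w ` (irr \<inter> {u<..<v}) \<in> sets lborel"
    "measure lborel (mob w ` (irr \<inter> {u<..<v})) =
      (v - u) / ((real (den w) + v * real (den' w)) * (real (den w) + u * real (den' w)))"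
proof -
  have R: "\<rat> \<in> sets lborel" using Rats_null by blast
  show "mob w ` (irr \<inter> {u<..<v}) \<in> sets lborel"
    unfolding mob_image_interval[OF assms] using R by auto
  have "measure lborel (mob w ` (irr \<inter> {u<..<v})) = \<bar>mob w v - mob w u\<bar>"
    unfolding mob_image_interval[OF assms] by (subst measure_Ioo_diff_Rats) (auto simp: min_def max_def)
  also have "\<dots> = (v - u) / ((real (den w) + v * real (den' w)) * (real (den w) + u * real (den' w)))"
    using mob_diff[OF w, of u v] assms den_mob_pos[OF w, of u] den_mob_pos[OF w, of v]
    by (simp add: abs_mult)
  finally show "measure lborel (mob w ` (irr \<inter> {u<..<v})) =
      (v - u) / ((real (den w) + v * real (den' w)) * (real (den w) + u * real (den' w)))" .
qed

lemma irr_Int: "irr \<inter> {0<..<1} = irr" by (auto simp: irr_def)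

lemma cyl_sets [measurable]: "cyl w \<in> sets lborel"
proof (cases "positive w")
  case True
  show ?thesis using measure_mob_image(1)[OF True, of 0 1] by (simp add: cyl_mob[OF True] irr_Int)
next
  case False
  have "x \<notin> cyl w" for x using False pre_positive[of x "length w"] by (auto simp: cyl_def)
  then have "cyl w = {}" by blast
  then show ?thesis by simp
qed

lemma cyl_measure:
  "positive w \<Longrightarrow> measure lborel (cyl w) = 1 / (real (den w) * (real (den w) + real (den' w)))"
  using measure_mob_image(2)[of w 0 1] by (simp add: cyl_mob irr_Int mult.commute)

lemma dig_ge_iff:
  assumes "x \<in> irr" "A \<ge> 1" shows "dig x n \<ge> A \<longleftrightarrow> (gauss ^^ n) x < 1 / real A"
proof -
  let ?t = "(gauss ^^ n) x"
  have t: "?t \<in> irr" using gauss_pow_irr assms by blast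
  have "dig x n \<ge> A \<longleftrightarrow> real_of_int \<lfloor>1 / ?t\<rfloor> \<ge> real A"
    using dig_floor[OF assms(1), of n] by (metis of_nat_le_iff)
  also have "\<dots> \<longleftrightarrow> 1 / ?t \<ge> real A" by (metis le_floor_iff of_int_le_iff of_int_of_nat_eq)
  also have "\<dots> \<longleftrightarrow> ?t \<le> 1 / real A" using irrD[OF t] assms(2) by (simp add: field_simps)
  also have "\<dots> \<longleftrightarrow> ?t < 1 / real A" using irrD(3)[OF t] by (metis Rats_1 Rats_divide Rats_of_nat less_le)
  finally show ?thesis .
qed

lemma cyl_dig_ge:
  assumes w: "positive w" and A: "A \<ge> 1"
  shows "{x \<in> cyl w. dig x (length w) \<ge> A} = mob w ` (irr \<inter> {0<..<1 / real A})"
proof (intro equalityI subsetI)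
  fix x assume "x \<in> {x \<in> cyl w. dig x (length w) \<ge> A}"
  then have x: "x \<in> irr" "pre x (length w) = w" "dig x (length w) \<ge> A" by (auto simp: cyl_def)
  then show "x \<in> mob w ` (irr \<inter> {0<..<1 / real A})"
    using mob_pre[OF x(1), of "length w"] dig_ge_iff[OF x(1) A] gauss_pow_irr[OF x(1), of "length w"]
    by (intro image_eqI[of _ _ "(gauss ^^ length w) x"]) (auto simp: irrD)
next
  fix x assume "x \<in> mob w ` (irr \<inter> {0<..<1 / real A})"
  then obtain t where t: "t \<in> irr" "t < 1 / real A" "x = mob w t" by auto
  then show "x \<in> {x \<in> cyl w. dig x (length w) \<ge> A}"
    using mob_irr[OF w t(1)] dig_ge_iff[of x A "length w"] A by (auto simp: cyl_def)
qed

lemma cyl_dig_ge_measure: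
  assumes w: "positive w" and A: "A \<ge> 1"
  shows "{x \<in> cyl w. dig x (length w) \<ge> A} \<in> sets lborel"
    "measure lborel {x \<in> cyl w. dig x (length w) \<ge> A} =
       1 / (real (den w) * (real A * real (den w) + real (den' w)))"
proof -
  have *: "0 < 1 / real A" "1 / real A \<in> \<rat>" "1 / real A \<le> 1" using A by auto
  show "{x \<in> cyl w. dig x (length w) \<ge> A} \<in> sets lborel"
    unfolding cyl_dig_ge[OF assms] by (rule measure_mob_image) (use w * in auto)
  show "measure lborel {x \<in> cyl w. dig x (length w) \<ge> A} =
       1 / (real (den w) * (real A * real (den w) + real (den' w)))"
    unfolding cyl_dig_ge[OF assms] using A den_pos[OF w]
    by (subst measure_mob_image) (use w * in \<open>auto simp: field_simps\<close>)
qed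

lemma irr_sets [measurable]: "irr \<in> sets lborel"
  using cyl_sets[of "[]"] by (simp add: cyl_def)

lemma irr_measure: "measure lborel irr = 1" "emeasure lborel irr = 1"
proof -
  have "measure lborel (cyl []) = 1" by (subst cyl_measure) auto
  then show m: "measure lborel irr = 1" by (simp add: cyl_def)
  show "emeasure lborel irr = 1"
  proof -
    have "emeasure lborel irr \<noteq> top" using m by (auto simp: measure_def)
    then show ?thesis using m by (simp add: emeasure_eq_ennreal_measure)
  qed
qed

lemma emeasure_eq_measure_irr: "S \<subseteq> irr \<Longrightarrow> S \<in> sets lborel \<Longrightarrow> emeasure lborel S = ennreal (measure lborel S)"
proof -
  assume "S \<subseteq> irr" "S \<in> sets lborel"
  then have "emeasure lborel S \<le> 1" using emeasure_mono[of S irr lborel] irr_measure irr_sets by simp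
  then have "emeasure lborel S \<noteq> top" by (auto simp: top_unique)
  then show ?thesis by (simp add: emeasure_eq_ennreal_measure)
qed

lemma fmeasurable_irr: "S \<subseteq> irr \<Longrightarrow> S \<in> sets lborel \<Longrightarrow> S \<in> fmeasurable lborel"
  using emeasure_eq_measure_irr by (simp add: fmeasurable_def)

lemma cyl_subset: "cyl w \<subseteq> irr" by (auto simp: cyl_def)

text \<open>Countable additivity carries an inequality between pieces to their unions. Everything
  lies in \<open>irr\<close>, which has measure one, so \<open>measure\<close> and
  \<open>emeasure\<close> can be exchanged.\<close>

lemma compare_union:
  assumes "countable I" "disjoint_family_on S I" "disjoint_family_on R I"
    and "\<And>i. i \<in> I \<Longrightarrow> S i \<in> sets lborel" "\<And>i. i \<in> I \<Longrightarrow> R i \<in> sets lborel"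
    and "\<And>i. i \<in> I \<Longrightarrow> S i \<subseteq> irr" "\<And>i. i \<in> I \<Longrightarrow> R i \<subseteq> irr"
    and "\<And>i. i \<in> I \<Longrightarrow> measure lborel (S i) \<le> c * measure lborel (R i)" "c \<ge> 0"
  shows "measure lborel (\<Union>i\<in>I. S i) \<le> c * measure lborel (\<Union>i\<in>I. R i)"
proof -
  have sS: "(\<Union>i\<in>I. S i) \<in> sets lborel" using assms(1,4) by (intro sets.countable_UN') auto
  have sR: "(\<Union>i\<in>I. R i) \<in> sets lborel" using assms(1,5) by (intro sets.countable_UN') auto
  have "emeasure lborel (\<Union>i\<in>I. S i) = (\<integral>\<^sup>+i. emeasure lborel (S i) \<partial>count_space I)"
    using assms by (intro emeasure_UN_countable) auto
  also have "\<dots> \<le> (\<integral>\<^sup>+i. ennreal c * emeasure lborel (R i) \<partial>count_space I)"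
  proof (intro nn_integral_mono)
    fix i assume "i \<in> space (count_space I)"
    then have i: "i \<in> I" by simp
    show "emeasure lborel (S i) \<le> ennreal c * emeasure lborel (R i)"
      using assms i by (simp add: emeasure_eq_measure_irr ennreal_mult''[symmetric] ennreal_leI)
  qed
  also have "\<dots> = ennreal c * (\<integral>\<^sup>+i. emeasure lborel (R i) \<partial>count_space I)"
    by (rule nn_integral_cmult) simp
  also have "(\<integral>\<^sup>+i. emeasure lborel (R i) \<partial>count_space I) = emeasure lborel (\<Union>i\<in>I. R i)"
    using assms by (intro emeasure_UN_countable[symmetric]) auto
  finally have *: "emeasure lborel (\<Union>i\<in>I. S i) \<le> ennreal c * emeasure lborel (\<Union>i\<in>I. R i)" .
  have "emeasure lborel (\<Union>i\<in>I. S i) = ennreal (measure lborel (\<Union>i\<in>I. S i))"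
    using assms(6) sS by (intro emeasure_eq_measure_irr) auto
  moreover have "emeasure lborel (\<Union>i\<in>I. R i) = ennreal (measure lborel (\<Union>i\<in>I. R i))"
    using assms(7) sR by (intro emeasure_eq_measure_irr) auto
  ultimately show ?thesis
    using * assms(9) by (simp add: ennreal_mult''[symmetric])
qed

text \<open>Says that \<open>Z\<close> is an event determined by the first \<open>n\<close> digits.
  Such a set is a countable disjoint union of cylinders, so conditional estimates on cylinders
  extend to it.\<close>

definition depth :: "nat \<Rightarrow> real set \<Rightarrow> bool" where
  "depth n Z \<longleftrightarrow> Z \<subseteq> irr \<and> (\<forall>x\<in>irr. \<forall>y\<in>irr. pre x n = pre y n \<longrightarrow> (x \<in> Z \<longleftrightarrow> y \<in> Z))"

lemma pre_eq_mono: "pre x m = pre y m \<Longrightarrow> n \<le> m \<Longrightarrow> pre x n = pre y n"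
  by (metis take_pre)

lemma pre_eq_dig: "pre x n = pre y n \<Longrightarrow> i < n \<Longrightarrow> dig x i = dig y i"
  by (metis nth_pre)

lemma depth_mono: "depth n Z \<Longrightarrow> n \<le> m \<Longrightarrow> depth m Z"
  unfolding depth_def by (meson pre_eq_mono)

lemma depth_Int_dig: "depth n Z \<Longrightarrow> i < n \<Longrightarrow> depth n (Z \<inter> {x. P (dig x i)})"
  unfolding depth_def using pre_eq_dig[of _ n _ i] by (metis Int_iff le_infI1 mem_Collect_eq)

lemma depth_cyl: "depth (length w) (cyl w)"
  by (auto simp: depth_def cyl_def)

lemma disjoint_cyl: "disjoint_family_on cyl {w. length w = n}"
  by (auto simp: disjoint_family_on_def cyl_def)

lemma depth_UN: assumes "depth n Z" shows "Z = (\<Union>w\<in>(\<lambda>x. pre x n) ` Z. cyl w)"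
  using assms by (auto simp: depth_def cyl_def)

lemma depth_sets: "depth n Z \<Longrightarrow> Z \<in> sets lborel"
proof -
  assume Z: "depth n Z"
  have "(\<Union>w\<in>(\<lambda>x. pre x n) ` Z. cyl w) \<in> sets lborel"
    using cyl_sets by (intro sets.countable_UN') (auto intro: countableI_type)
  then show ?thesis by (subst depth_UN[OF Z])
qed

text \<open>The conditional probability is \<open>(q + q') / (A q + q')\<close>, and
  \<open>q' <= q\<close> bounds it by \<open>2 / A\<close> uniformly in the prefix. This uniformity
  takes the place of independence of the digits.\<close>

lemma cyl_dig_ge_upper:
  assumes w: "positive w" and A: "A \<ge> 1"
  shows "measure lborel {x \<in> cyl w. dig x (length w) \<ge> A} \<le> 2 / real A * measure lborel (cyl w)"
proof -
  define q q' where "q = real (den w)" "q' = real (den' w)"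
  have q: "q \<ge> 1" "q' \<le> q" "q' \<ge> 0" using den_pos[OF w] den'_le[OF w] by (auto simp: q_q'_def)
  have A': "real A \<ge> 1" using A by simp
  have "real A * (q + q') \<le> 2 * (real A * q + q')"
  proof -
    have "real A * q' \<le> real A * q" using q by (intro mult_left_mono) auto
    then show ?thesis using q by (simp add: algebra_simps)
  qed
  moreover have "real A * q + q' > 0" using q A' by (intro add_pos_nonneg mult_pos_pos) auto
  moreover have "real A * (q + q') > 0" using q A' by (intro mult_pos_pos) auto
  ultimately have "1 / (real A * q + q') \<le> 2 / (real A * (q + q'))"
    by (simp add: divide_le_eq le_divide_eq mult.commute)
  then have "(1/q) * (1 / (real A * q + q')) \<le> (1/q) * (2 / (real A * (q + q')))"
    using q by (intro mult_left_mono) auto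
  then show ?thesis
    using q A' by (simp add: cyl_dig_ge_measure[OF assms] cyl_measure[OF w] q_q'_def[symmetric] mult_ac)
qed

lemma depth_dig_ge:
  assumes Z: "depth n Z" and A: "A \<ge> 1"
  shows "measure lborel (Z \<inter> {x. dig x n \<ge> A}) \<le> 2 / real A * measure lborel Z"
proof -
  let ?I = "(\<lambda>x. pre x n) ` Z"
  let ?S = "\<lambda>w. {x \<in> cyl w. dig x (length w) \<ge> A}"
  have I: "length w = n" "positive w" if "w \<in> ?I" for w
    using that Z pre_positive by (auto simp: depth_def)
  have "Z \<inter> {x. dig x n \<ge> A} = (\<Union>w\<in>?I. ?S w)"
    using Z by (auto simp: depth_def cyl_def)
  moreover have "measure lborel (\<Union>w\<in>?I. ?S w) \<le> 2 / real A * measure lborel (\<Union>w\<in>?I. cyl w)"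
  proof (rule compare_union)
    show "disjoint_family_on ?S ?I" "disjoint_family_on cyl ?I"
      using I by (auto simp: disjoint_family_on_def cyl_def)
    show "?S w \<in> sets lborel" if "w \<in> ?I" for w using cyl_dig_ge_measure(1) I(2) that A by blast
    show "measure lborel (?S w) \<le> 2 / real A * measure lborel (cyl w)" if "w \<in> ?I" for w
      using cyl_dig_ge_upper I(2) that A by blast
  qed (use cyl_subset in \<open>auto intro: countableI_type simp del: sets_lborel\<close>)
  ultimately show ?thesis by (simp only: depth_UN[OF Z, symmetric])
qed

lemma depth_dig_ge_later:
  assumes Z: "depth n Z" and A: "A \<ge> 1" and "n \<le> i"
  shows "measure lborel (Z \<inter> {x. dig x i \<ge> A}) \<le> 2 / real A * measure lborel Z"
  using depth_dig_ge[OF depth_mono[OF Z \<open>n \<le> i\<close>] A] .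

text \<open>The condition on digit \<open>i\<close> is itself an event decided before digit
  \<open>j\<close>, so the uniform conditional bound is applied twice.\<close>

lemma depth_dig_ge_pair:
  assumes Z: "depth n Z" and A: "A \<ge> 1" "B \<ge> 1" and "n \<le> i" "i < j"
  shows "measure lborel (Z \<inter> {x. dig x i \<ge> A} \<inter> {x. dig x j \<ge> B}) \<le> 4 / (real A * real B) * measure lborel Z"
proof -
  have "depth j (Z \<inter> {x. dig x i \<ge> A})"
    using depth_Int_dig[OF depth_mono[OF Z, of j], of i "\<lambda>a. a \<ge> A"] assms by simp
  then have "measure lborel (Z \<inter> {x. dig x i \<ge> A} \<inter> {x. dig x j \<ge> B}) \<le> 2 / real B * measure lborel (Z \<inter> {x. dig x i \<ge> A})"
    using depth_dig_ge A by blast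
  also have "\<dots> \<le> 2 / real B * (2 / real A * measure lborel Z)"
    using depth_dig_ge_later[OF Z A(1) \<open>n \<le> i\<close>] by (intro mult_left_mono) auto
  finally show ?thesis by (simp add: mult_ac)
qed

section \<open>Almost sure size of the digits\<close>

definition expect :: "nat \<Rightarrow> (nat list \<Rightarrow> ennreal) \<Rightarrow> ennreal" where
  "expect n F = (\<integral>\<^sup>+x. F (pre x n) * indicator irr x \<partial>lborel)"

lemma expect_count_space:
  fixes F :: "nat list \<Rightarrow> ennreal"
  shows "(\<lambda>x. F (pre x n) * indicator irr x) \<in> borel_measurable lborel"
    "expect n F = (\<integral>\<^sup>+w. F w * emeasure lborel (cyl w) \<partial>count_space {w. length w = n})"
proof -
  \<comment> \<open>An irrational point lies in exactly one cylinder of length \<open>n\<close>, so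
    the integral over words has a single nonzero term; Tonelli then exchanges the two
    integrals.\<close>
  have eq: "F (pre x n) * indicator irr x = (\<integral>\<^sup>+w. F w * indicator (cyl w) x \<partial>count_space {w. length w = n})" for x
  proof -
    have "(\<integral>\<^sup>+w. F w * indicator (cyl w) x \<partial>count_space {w. length w = n}) =
       (\<integral>\<^sup>+w. (F (pre x n) * indicator irr x) * indicator {pre x n} w \<partial>count_space {w. length w = n})"
      by (intro nn_integral_cong) (auto simp: cyl_def indicator_def)
    also have "\<dots> = F (pre x n) * indicator irr x"
      by (subst nn_integral_cmult_indicator) (auto simp: )
    finally show ?thesis by simp
  qed
  have m: "(\<lambda>x. F w * indicator (cyl w) x) \<in> borel_measurable lborel" for w
    using cyl_sets by measurable
  show "(\<lambda>x. F (pre x n) * indicator irr x) \<in> borel_measurable lborel"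
  proof (rule measurable_piecewise_restrict[of "insert (- irr) (cyl ` {w. length w = n})"])
    fix W assume "W \<in> insert (- irr) (cyl ` {w. length w = n})"
    then obtain c where "\<And>x. x \<in> W \<Longrightarrow> F (pre x n) * indicator irr x = c"
      by (auto simp: cyl_def)
    then show "(\<lambda>x. F (pre x n) * indicator irr x) \<in> borel_measurable (restrict_space lborel W)"
      by (subst measurable_cong[where g = "\<lambda>_. c"]) (auto simp: space_restrict_space)
    show "W \<inter> space lborel \<in> sets lborel"
      using \<open>W \<in> _\<close> irr_sets cyl_sets by (auto simp: Compl_in_sets_lebesgue)
  qed (auto simp: cyl_def)
  show "expect n F = (\<integral>\<^sup>+w. F w * emeasure lborel (cyl w) \<partial>count_space {w. length w = n})"
    unfolding expect_def eq using m
    by (subst nn_integral_count_space_nn_integral)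
      (auto simp del: sets_lborel simp: nn_integral_cmult_indicator[OF cyl_sets])
qed

lemma expect_Markov:
  assumes "R > 0"
  shows "ennreal R * emeasure lborel {x \<in> irr. F (pre x n) \<ge> ennreal R} \<le> expect n F"
proof -
  let ?g = "\<lambda>x. F (pre x n) * indicator irr x"
  have "{x \<in> irr. F (pre x n) \<ge> ennreal R} = {x \<in> space lborel. ?g x \<ge> ennreal R}"
    using assms by (auto simp: indicator_def)
  then have m: "{x \<in> irr. F (pre x n) \<ge> ennreal R} \<in> sets lborel"
    using expect_count_space(1)[of F n] by simp
  have "ennreal R * emeasure lborel {x \<in> irr. F (pre x n) \<ge> ennreal R} =
     (\<integral>\<^sup>+x. ennreal R * indicator {x \<in> irr. F (pre x n) \<ge> ennreal R} x \<partial>lborel)"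
    using m by (simp add: nn_integral_cmult_indicator)
  also have "\<dots> \<le> expect n F"
    unfolding expect_def by (intro nn_integral_mono) (auto simp: indicator_def)
  finally show ?thesis .
qed

text \<open>Given the first \<open>n\<close> digits, a large next digit has conditional probability
  at most \<open>2 / A\<close>, whatever weight \<open>F\<close> the prefix carries.\<close>

lemma expect_dig_ge:
  assumes "A \<ge> 1"
  shows "expect (Suc n) (\<lambda>w. F (butlast w) * (if last w \<ge> A then 1 else 0)) \<le> ennreal (2 / real A) * expect n F"
proof -
  have "expect (Suc n) (\<lambda>w. F (butlast w) * (if last w \<ge> A then 1 else 0)) =
     (\<integral>\<^sup>+x. (\<integral>\<^sup>+w. F w * indicator {x \<in> cyl w. dig x n \<ge> A} x \<partial>count_space {w. length w = n}) \<partial>lborel)"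
    unfolding expect_def
  proof (intro nn_integral_cong)
    fix x
    have "(\<integral>\<^sup>+w. F w * indicator {x \<in> cyl w. dig x n \<ge> A} x \<partial>count_space {w. length w = n}) =
       (\<integral>\<^sup>+w. (F (pre x n) * indicator {x \<in> irr. dig x n \<ge> A} x) * indicator {pre x n} w \<partial>count_space {w. length w = n})"
      by (intro nn_integral_cong) (auto simp: cyl_def indicator_def)
    also have "\<dots> = F (pre x n) * indicator {x \<in> irr. dig x n \<ge> A} x"
      by (subst nn_integral_cmult_indicator) auto
    finally show "F (butlast (pre x (Suc n))) * (if A \<le> last (pre x (Suc n)) then 1 else 0) * indicator irr x =
      (\<integral>\<^sup>+w. F w * indicator {x \<in> cyl w. dig x n \<ge> A} x \<partial>count_space {w. length w = n})"
      by (simp add: pre_Suc indicator_def)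
  qed
  also have "\<dots> = (\<integral>\<^sup>+w. F w * emeasure lborel {x \<in> cyl w. dig x n \<ge> A} \<partial>count_space {w. length w = n})"
  proof -
    have s: "{x \<in> cyl w. dig x n \<ge> A} \<in> sets lborel" if "length w = n" for w :: "nat list"
      using depth_Int_dig[OF depth_mono[OF depth_cyl[of w], of "Suc n"], of n "\<lambda>a. a \<ge> A"] depth_sets that
      by (auto simp: Int_def)
    then show ?thesis
      by (subst nn_integral_count_space_nn_integral)
        (auto simp del: sets_lborel simp: nn_integral_cmult_indicator intro!: nn_integral_cong borel_measurable_times borel_measurable_indicator)
  qed
  also have "\<dots> \<le> (\<integral>\<^sup>+w. ennreal (2 / real A) * (F w * emeasure lborel (cyl w)) \<partial>count_space {w. length w = n})"
  proof (intro nn_integral_mono)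
    fix w :: "nat list" assume "w \<in> space (count_space {w. length w = n})"
    then have w: "length w = n" by simp
    have "depth n (cyl w)" using depth_cyl w by blast
    then have "measure lborel (cyl w \<inter> {x. dig x n \<ge> A}) \<le> 2 / real A * measure lborel (cyl w)"
      "cyl w \<inter> {x. dig x n \<ge> A} \<in> sets lborel" "cyl w \<in> sets lborel"
      using depth_dig_ge[of n "cyl w" A] assms
        depth_sets[OF depth_Int_dig[OF depth_mono[of n "cyl w" "Suc n"], of n "\<lambda>a. a \<ge> A"]] depth_sets by auto
    then have "emeasure lborel (cyl w \<inter> {x. dig x n \<ge> A}) \<le> ennreal (2 / real A) * emeasure lborel (cyl w)"
      using cyl_subset[of w] by (subst (1 2) emeasure_eq_measure_irr) (auto simp: ennreal_mult''[symmetric] intro!: ennreal_leI)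
    then have "F w * emeasure lborel (cyl w \<inter> {x. dig x n \<ge> A}) \<le> F w * (ennreal (2 / real A) * emeasure lborel (cyl w))"
      by (intro mult_left_mono) auto
    then show "F w * emeasure lborel {x \<in> cyl w. dig x n \<ge> A} \<le> ennreal (2 / real A) * (F w * emeasure lborel (cyl w))"
      by (simp add: Int_def mult_ac)
  qed
  also have "\<dots> = ennreal (2 / real A) * expect n F"
    by (subst nn_integral_cmult) (auto simp: expect_count_space(2))
  finally show ?thesis .
qed

lemma expect_cong_mono: "(\<And>w. positive w \<Longrightarrow> length w = n \<Longrightarrow> F w \<le> G w) \<Longrightarrow> expect n F \<le> expect n G"
  unfolding expect_def by (intro nn_integral_mono) (auto simp: indicator_def pre_positive)

lemma expect_add: "expect n (\<lambda>w. F w + G w) = expect n F + expect n G"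
  unfolding expect_def using expect_count_space(1)
  by (subst nn_integral_add[symmetric]) (auto simp: distrib_right)

lemma expect_cmult: "expect n (\<lambda>w. c * F w) = c * expect n F"
  unfolding expect_def using expect_count_space(1)
  by (subst nn_integral_cmult[symmetric]) (auto simp: mult.assoc)

lemma expect_suminf: "expect n (\<lambda>w. \<Sum>l. F l w) = (\<Sum>l. expect n (F l))"
  unfolding expect_def using expect_count_space(1)
  by (subst nn_integral_suminf[symmetric]) auto

lemma expect_butlast: "expect (Suc n) (\<lambda>w. F (butlast w)) = expect n F"
  unfolding expect_def by (simp add: pre_Suc)

text \<open>A layer-cake bound for a function of the last digit: a jump of height \<open>g l\<close>
  at the threshold \<open>A l\<close> costs at most \<open>g l\<close> times the conditional
  probability \<open>2 / A l\<close>, and this factor does not depend on the earlier digits.\<close>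

lemma expect_step:
  fixes c :: ennreal and g :: "nat \<Rightarrow> real" and A :: "nat \<Rightarrow> nat"
  assumes u: "\<And>a. u a \<le> c + (\<Sum>l. ennreal (g l) * (if a \<ge> A l then 1 else 0))"
    and A: "\<And>l. A l \<ge> 1" and g: "\<And>l. g l \<ge> 0"
  shows "expect (Suc n) (\<lambda>w. F (butlast w) * u (last w)) \<le> (c + (\<Sum>l. ennreal (g l * (2 / real (A l))))) * expect n F"
proof -
  have "expect (Suc n) (\<lambda>w. F (butlast w) * u (last w)) \<le>
     expect (Suc n) (\<lambda>w. c * F (butlast w) + (\<Sum>l. ennreal (g l) * (F (butlast w) * (if last w \<ge> A l then 1 else 0))))"
  proof (rule expect_cong_mono)
    fix w :: "nat list"
    have "F (butlast w) * u (last w) \<le> F (butlast w) * (c + (\<Sum>l. ennreal (g l) * (if last w \<ge> A l then 1 else 0)))"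
      by (intro mult_left_mono u) auto
    also have "\<dots> = c * F (butlast w) + (\<Sum>l. F (butlast w) * (ennreal (g l) * (if last w \<ge> A l then 1 else 0)))"
      by (simp add: distrib_left mult.commute)
    finally show "F (butlast w) * u (last w) \<le> c * F (butlast w) + (\<Sum>l. ennreal (g l) * (F (butlast w) * (if last w \<ge> A l then 1 else 0)))"
      by (simp add: mult_ac)
  qed
  also have "\<dots> = c * expect n F + (\<Sum>l. ennreal (g l) * expect (Suc n) (\<lambda>w. F (butlast w) * (if last w \<ge> A l then 1 else 0)))"
    by (simp only: expect_add expect_cmult expect_suminf expect_butlast)
  also have "\<dots> \<le> c * expect n F + (\<Sum>l. ennreal (g l) * (ennreal (2 / real (A l)) * expect n F))"
    by (intro add_left_mono suminf_le mult_left_mono expect_dig_ge A) auto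
  also have "\<dots> = (c + (\<Sum>l. ennreal (g l * (2 / real (A l))))) * expect n F"
  proof -
    have e: "ennreal (g l * (2 / real (A l))) = ennreal (g l) * ennreal (2 / real (A l))" for l
      using g by (intro ennreal_mult) auto
    show ?thesis by (simp only: e distrib_right mult.assoc[symmetric] ennreal_suminf_multc)
  qed
  finally show ?thesis .
qed

text \<open>The substitute for multiplicativity of expectations of independent variables: each digit
  contributes one factor \<open>k\<close>.\<close>

lemma expect_prod_list:
  fixes c :: ennreal and g :: "nat \<Rightarrow> real" and A :: "nat \<Rightarrow> nat"
  assumes u: "\<And>a. u a \<le> c + (\<Sum>l. ennreal (g l) * (if a \<ge> A l then 1 else 0))"
    and A: "\<And>l. A l \<ge> 1" and g: "\<And>l. g l \<ge> 0"
    and k: "c + (\<Sum>l. ennreal (g l * (2 / real (A l)))) \<le> k"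
  shows "expect n (\<lambda>w. prod_list (map u w)) \<le> k ^ n"
proof (induction n)
  case 0
  show ?case using irr_sets by (simp add: expect_def irr_measure)
next
  case (Suc n)
  have "expect (Suc n) (\<lambda>w. prod_list (map u w)) = expect (Suc n) (\<lambda>w. prod_list (map u (butlast w)) * u (last w))"
    unfolding expect_def by (simp add: pre_Suc)
  also have "\<dots> \<le> (c + (\<Sum>l. ennreal (g l * (2 / real (A l))))) * expect n (\<lambda>w. prod_list (map u w))"
    by (rule expect_step[OF u A g])
  also have "\<dots> \<le> k * k ^ n" using Suc k by (intro mult_mono) auto
  finally show ?case by simp
qed

lemma AE_borel_cantelli:
  assumes Z: "\<And>n::nat. Z n \<in> sets lborel" "\<And>n. Z n \<subseteq> irr"
    and le: "\<And>n. n \<ge> m \<Longrightarrow> measure lborel (Z n) \<le> b n" and b: "summable b"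
  shows "AE x in lborel. eventually (\<lambda>n. x \<notin> Z n) sequentially"
proof -
  have "summable (\<lambda>n. measure lborel (Z n))"
    by (rule summable_comparison_test'[OF b, of m]) (use le in auto)
  then have "AE x in lborel. eventually (\<lambda>n. x \<in> space lborel - Z n) sequentially"
    using Z emeasure_eq_measure_irr by (intro borel_cantelli_AE1) (auto simp: less_top[symmetric])
  then show ?thesis by (rule AE_mp) (intro AE_I2 impI, auto elim: eventually_mono)
qed

lemma pre_sets: "{x \<in> irr. P (pre x n)} \<in> sets lborel"
  by (rule depth_sets[of n]) (auto simp: depth_def)

lemma depth_irr: "depth n irr"
  by (auto simp: depth_def)

lemma dig_sets: "{x \<in> irr. P (dig x n)} \<in> sets lborel"
  using pre_sets[of "\<lambda>w. P (last w)" "Suc n"] by (simp add: pre_Suc)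

lemma AE_dig_le:
  fixes \<phi> :: "nat \<Rightarrow> real"
  assumes pos: "\<And>i. \<phi> i > 0" and s: "summable (\<lambda>i. 1 / \<phi> i)"
  shows "AE x in lborel. x \<in> irr \<longrightarrow> eventually (\<lambda>i. real (dig x i) \<le> \<phi> i) sequentially"
proof -
  let ?Z = "\<lambda>i. {x \<in> irr. real (dig x i) > \<phi> i}"
  have "AE x in lborel. eventually (\<lambda>n. x \<notin> ?Z n) sequentially"
  proof (rule AE_borel_cantelli[where m = 0])
    show "?Z n \<in> sets lborel" for n by (rule dig_sets)
    show "?Z n \<subseteq> irr" for n by auto
    show "summable (\<lambda>i. 2 * (1 / \<phi> i))" using s by (rule summable_mult)
    fix n
    define A where "A = nat \<lceil>\<phi> n\<rceil>"
    have A: "A \<ge> 1" "real A \<ge> \<phi> n" using pos[of n] unfolding A_def by linarith+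
    have "measure lborel (?Z n) \<le> measure lborel (irr \<inter> {x. dig x n \<ge> A})"
    proof (rule measure_mono_fmeasurable)
      show "?Z n \<subseteq> irr \<inter> {x. dig x n \<ge> A}" unfolding A_def by (auto simp: nat_le_iff ceiling_le_iff)
      show "irr \<inter> {x. dig x n \<ge> A} \<in> fmeasurable lborel"
        using dig_sets[of "\<lambda>a. a \<ge> A" n] by (intro fmeasurable_irr) (auto simp: Int_def)
    qed (rule dig_sets)
    also have "\<dots> \<le> 2 / real A * measure lborel irr"
      by (rule depth_dig_ge_later[OF depth_irr[of 0] A(1)]) auto
    also have "\<dots> \<le> 2 * (1 / \<phi> n)" using A pos[of n] by (simp add: irr_measure frac_le)
    finally show "measure lborel (?Z n) \<le> 2 * (1 / \<phi> n)" .
  qed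
  then show ?thesis
    by (rule AE_mp) (intro AE_I2 impI, auto elim: eventually_mono simp: not_less)
qed

section \<open>Exponential growth of the denominators\<close>

lemma den_le_prod: "positive w \<Longrightarrow> den w \<le> prod_list (map Suc w)"
proof (induction w rule: rev_induct)
  case (snoc a w)
  then have "den (w @ [a]) \<le> a * den w + den w" using den'_le[of w] by simp
  also have "\<dots> = den w * Suc a" by simp
  also have "\<dots> \<le> prod_list (map Suc w) * Suc a" using snoc by (intro mult_right_mono) auto
  finally show ?case by simp
qed simp

text \<open>For \<open>2^L <= a < 2^(L+1)\<close> the dyadic layer \<open>L\<close> alone is already
  large enough. The square root is taken because the digits have infinite mean, whereas the layer
  costs of the root form a geometric series.\<close>

lemma sqrt_layers:
  "ennreal (sqrt (real (Suc a))) \<le> 1 + (\<Sum>l. ennreal (2 * sqrt 2 ^ l) * (if a \<ge> 2 ^ l then 1 else 0))"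
proof (cases "a = 0")
  case False
  then obtain L where L: "2 ^ L \<le> a" "a < 2 ^ (L + 1)"
    using ex_power_ivl1[of 2 a] by auto
  have "real (Suc a) \<le> real (2 ^ (L + 1))" using L(2) by (simp only: of_nat_le_iff)
  also have "\<dots> \<le> (2 * sqrt 2 ^ L)\<^sup>2"
    by (simp add: power_mult_distrib power_mult[symmetric] mult.commute[of L 2]) (simp add: power_mult)
  finally have "sqrt (real (Suc a)) \<le> 2 * sqrt 2 ^ L" by (intro real_le_lsqrt) auto
  then have "ennreal (sqrt (real (Suc a))) \<le> ennreal (2 * sqrt 2 ^ L)" by (rule ennreal_leI)
  also have "\<dots> = (\<Sum>l\<in>{L}. ennreal (2 * sqrt 2 ^ l) * (if a \<ge> 2 ^ l then 1 else 0))" using L by simp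
  also have "\<dots> \<le> (\<Sum>l. ennreal (2 * sqrt 2 ^ l) * (if a \<ge> 2 ^ l then 1 else 0))"
    by (rule sum_le_suminf) auto
  also have "\<dots> \<le> 1 + \<dots>" by simp
  finally show ?thesis .
qed simp

lemma prod_list_ennreal: "(\<And>a. a \<in> set w \<Longrightarrow> f a \<ge> 0) \<Longrightarrow>
   prod_list (map (\<lambda>a. ennreal (f a)) w) = ennreal (prod_list (map f w))" for f :: "nat \<Rightarrow> real"
proof (induction w)
  case (Cons a w)
  then have "prod_list (map f w) \<ge> 0" by (intro prod_list_nonneg) auto
  then show ?case using Cons by (simp add: ennreal_mult)
qed simp

lemma prod_list_sqrt: "prod_list (map (\<lambda>a. sqrt (real (Suc a))) w) = sqrt (real (prod_list (map Suc w)))"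
  by (induction w) (simp_all only: list.map prod_list.Nil prod_list.Cons of_nat_mult real_sqrt_mult of_nat_1 real_sqrt_one)

text \<open>The denominator is at most the product of the \<open>a + 1\<close>. Markov's inequality
  for the product of their square roots gives a geometrically small exceptional probability, and
  Borel--Cantelli applies.\<close>

lemma AE_den_le_exp:
  "\<exists>C>0. AE x in lborel. x \<in> irr \<longrightarrow> eventually (\<lambda>n. real (den (pre x n)) \<le> exp (C * real n)) sequentially"
proof -
  let ?h = "\<lambda>l::nat. (2 * sqrt 2 ^ l) * (2 / real (2 ^ l))"
  have h: "?h = (\<lambda>l. 4 * (sqrt 2 / 2) ^ l)" by (auto simp: power_divide)
  have sq: "sqrt 2 / 2 < (1::real)" using sqrt2_less_2 by simp
  have s: "summable ?h" unfolding h using sq by (intro summable_mult summable_geometric) auto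
  define K where "K = 1 + suminf ?h"
  have K: "K \<ge> 1" unfolding K_def using s by (simp add: suminf_nonneg)
  have Kle: "1 + (\<Sum>l. ennreal ((2 * sqrt 2 ^ l) * (2 / real (2 ^ l)))) \<le> ennreal K"
    unfolding K_def using s suminf_nonneg[OF s]
    by (subst suminf_ennreal2) (auto simp: ennreal_plus ennreal_1[symmetric] simp del: ennreal_1)
  have E: "expect n (\<lambda>w. prod_list (map (\<lambda>a. ennreal (sqrt (real (Suc a)))) w)) \<le> ennreal K ^ n" for n
    by (rule expect_prod_list[OF sqrt_layers _ _ Kle]) auto
  \<comment> \<open>With this \<open>C\<close> the threshold \<open>exp (C n / 2)\<close> equals
    \<open>(2 K)^n\<close>, so that Markov's inequality leaves \<open>K^n / (2 K)^n\<close>.\<close>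
  define C where "C = 2 * ln (2 * K)"
  have C: "C > 0" unfolding C_def using K by simp
  let ?Z = "\<lambda>n. {x \<in> irr. real (den (pre x n)) > exp (C * real n)}"
  have "AE x in lborel. eventually (\<lambda>n. x \<notin> ?Z n) sequentially"
  proof (rule AE_borel_cantelli[where m = 0])
    show "?Z n \<in> sets lborel" for n by (rule pre_sets)
    show "?Z n \<subseteq> irr" for n by auto
    show "summable (\<lambda>n. (1/2::real) ^ n)" by (intro summable_geometric) auto
    fix n
    let ?F = "\<lambda>w. prod_list (map (\<lambda>a. ennreal (sqrt (real (Suc a)))) w)"
    define R where "R = exp (C * real n / 2)"
    let ?Y = "{x \<in> irr. ?F (pre x n) \<ge> ennreal R}"
    have "?Z n \<subseteq> ?Y"
    proof
      fix x assume x: "x \<in> ?Z n"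
      have "R\<^sup>2 = exp (C * real n)" by (simp add: R_def power2_eq_square exp_add[symmetric])
      also have "\<dots> \<le> real (prod_list (map Suc (pre x n)))"
        using x den_le_prod[OF pre_positive[of x n]] by (simp add: order.trans[OF less_imp_le])
      finally have "R \<le> sqrt (real (prod_list (map Suc (pre x n))))" by (rule real_le_rsqrt)
      also have "\<dots> = prod_list (map (\<lambda>a. sqrt (real (Suc a))) (pre x n))" by (rule prod_list_sqrt[symmetric])
      finally show "x \<in> ?Y" using x by (subst prod_list_ennreal) (auto intro: ennreal_leI)
    qed
    then have "measure lborel (?Z n) \<le> measure lborel ?Y"
      by (intro measure_mono_fmeasurable fmeasurable_irr pre_sets) auto
    also have "\<dots> \<le> K ^ n / R"
    proof -
      have "ennreal R * emeasure lborel ?Y \<le> ennreal K ^ n"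
        using expect_Markov[of R ?F n] E[of n] by (simp add: R_def order_trans)
      moreover have "emeasure lborel ?Y = ennreal (measure lborel ?Y)"
        by (intro emeasure_eq_measure_irr pre_sets) auto
      ultimately have "ennreal (R * measure lborel ?Y) \<le> ennreal (K ^ n)"
        using K by (simp add: ennreal_mult'' ennreal_power)
      then have "R * measure lborel ?Y \<le> K ^ n" using K by (subst (asm) ennreal_le_iff) auto
      then show ?thesis by (simp add: R_def field_simps)
    qed
    also have "R = (2 * K) ^ n"
    proof -
      have "R = exp (real n * ln (2 * K))" by (simp add: R_def C_def mult.commute)
      also have "\<dots> = exp (ln (2 * K)) ^ n" by (rule exp_of_nat_mult)
      also have "exp (ln (2 * K)) = 2 * K" using K by simp
      finally show ?thesis .
    qed
    also have "K ^ n / (2 * K) ^ n = (1/2) ^ n" using K by (simp add: power_mult_distrib power_divide)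
    finally show "measure lborel (?Z n) \<le> (1/2) ^ n" .
  qed
  then have "AE x in lborel. x \<in> irr \<longrightarrow> eventually (\<lambda>n. real (den (pre x n)) \<le> exp (C * real n)) sequentially"
    by (rule AE_mp) (intro AE_I2 impI, auto elim: eventually_mono simp: not_less)
  then show ?thesis using C by blast
qed

section \<open>The digit sum without its largest term\<close>

lemma harmonic_le: "T \<ge> 1 \<Longrightarrow> (\<Sum>l<T. 1 / real (l + 1)) \<le> 1 + ln (real T)"
proof (induction T rule: dec_induct)
  case (step n)
  have "ln (real n / real (Suc n)) \<le> real n / real (Suc n) - 1" using step by (intro ln_le_minus_one) auto
  also have "\<dots> = - (1 / real (Suc n))" by (simp add: field_simps)
  finally have "1 / real (Suc n) \<le> ln (real (Suc n)) - ln (real n)" using step by (simp add: ln_div)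
  then show ?case using step by (simp add: add.commute)
qed simp

text \<open>On the unit interval \<open>exp z <= 1 + 2 z\<close>, and \<open>min a T\<close> counts
  the thresholds \<open>1, ..., T\<close> reached by \<open>a\<close>. Each of the \<open>T\<close>
  layers therefore has height \<open>2 / T\<close>.\<close>

lemma exp_min_layers:
  assumes T: "T \<ge> 1"
  shows "ennreal (exp (real (min a T) / real T)) \<le> 1 + (\<Sum>l. ennreal (if l < T then 2 / real T else 0) * (if a \<ge> l + 1 then 1 else 0))"
proof -
  have "(\<Sum>l<T. (if l < a then 1 else 0)) = real (card ({..<T} \<inter> {l. l < a}))"
    by (simp add: sum.If_cases)
  also have "{..<T} \<inter> {l. l < a} = {..<min a T}" by auto
  finally have c: "(\<Sum>l<T. (if l < a then 1 else (0::real))) = real (min a T)" by simp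
  define z where "z = real (min a T) / real T"
  have z: "0 \<le> z" "z \<le> 1" using T by (auto simp: z_def)
  have "exp z \<le> 1 + z + z\<^sup>2" using exp_bound[OF z] .
  also have "z\<^sup>2 \<le> z" using z by (simp add: power2_eq_square mult_left_le)
  finally have "exp z \<le> 1 + 2 * z" by simp
  also have "2 * z = (\<Sum>l<T. (2 / real T) * (if l < a then 1 else 0))"
    by (simp only: z_def sum_distrib_left[symmetric] c) simp
  finally have "ennreal (exp z) \<le> 1 + ennreal (\<Sum>l<T. (2 / real T) * (if l < a then 1 else 0))"
    by (subst ennreal_1[symmetric], subst ennreal_plus[symmetric]) (auto intro: ennreal_leI sum_nonneg)
  also have "ennreal (\<Sum>l<T. (2 / real T) * (if l < a then 1 else 0)) = (\<Sum>l<T. ennreal ((2 / real T) * (if l < a then 1 else 0)))"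
    by (subst sum_ennreal) auto
  also have "\<dots> = (\<Sum>l<T. ennreal (if l < T then 2 / real T else 0) * (if a \<ge> l + 1 then 1 else 0))"
    by (intro sum.cong) auto
  also have "\<dots> \<le> (\<Sum>l. ennreal (if l < T then 2 / real T else 0) * (if a \<ge> l + 1 then 1 else 0))"
    by (rule sum_le_suminf) auto
  finally show ?thesis by (simp add: z_def add_left_mono)
qed

lemma expect_exp_min:
  assumes T: "T \<ge> 1"
  shows "expect n (\<lambda>w. prod_list (map (\<lambda>a. ennreal (exp (real (min a T) / real T))) w))
     \<le> ennreal (exp (real n * (4 / real T * (1 + ln (real T)))))"
proof -
  let ?g = "\<lambda>l. if l < T then 2 / real T else 0"
  have "(\<Sum>l. ennreal (?g l * (2 / real (l + 1)))) = (\<Sum>l<T. ennreal (?g l * (2 / real (l + 1))))"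
    by (rule suminf_finite) auto
  also have "\<dots> = ennreal (\<Sum>l<T. ?g l * (2 / real (l + 1)))"
    by (rule sum_ennreal) auto
  also have "(\<Sum>l<T. ?g l * (2 / real (l + 1))) = 4 / real T * (\<Sum>l<T. 1 / real (l + 1))"
    unfolding sum_distrib_left by (intro sum.cong) auto
  also have "ennreal \<dots> \<le> ennreal (4 / real T * (1 + ln (real T)))"
    using harmonic_le[OF T] by (intro ennreal_leI mult_left_mono) auto
  finally have "1 + (\<Sum>l. ennreal (?g l * (2 / real (l + 1)))) \<le> 1 + ennreal (4 / real T * (1 + ln (real T)))"
    by (rule add_left_mono)
  also have "\<dots> = ennreal (1 + 4 / real T * (1 + ln (real T)))"
    using T by (subst ennreal_plus) auto
  also have "\<dots> \<le> ennreal (exp (4 / real T * (1 + ln (real T))))"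
    by (intro ennreal_leI exp_ge_add_one_self)
  finally have k: "1 + (\<Sum>l. ennreal (?g l * (2 / real (l + 1)))) \<le> ennreal (exp (4 / real T * (1 + ln (real T))))" .
  have "expect n (\<lambda>w. prod_list (map (\<lambda>a. ennreal (exp (real (min a T) / real T))) w))
     \<le> ennreal (exp (4 / real T * (1 + ln (real T)))) ^ n"
    by (rule expect_prod_list[OF exp_min_layers[OF T] _ _ k]) auto
  also have "\<dots> = ennreal (exp (4 / real T * (1 + ln (real T))) ^ n)" by (rule ennreal_power) simp
  also have "exp (4 / real T * (1 + ln (real T))) ^ n = exp (real n * (4 / real T * (1 + ln (real T))))"
    by (rule exp_of_nat_mult[symmetric])
  finally show ?thesis .
qed

lemma measure_two_large:
  assumes T: "T \<ge> 1"
  shows "measure lborel {x \<in> irr. \<exists>i<N. \<exists>j<N. i < j \<and> dig x i \<ge> T \<and> dig x j \<ge> T} \<le> real N ^ 2 * (4 / real T ^ 2)"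
proof -
  let ?I = "{(i, j). i < N \<and> j < N \<and> i < j}"
  let ?S = "\<lambda>(i, j). irr \<inter> {x. dig x i \<ge> T} \<inter> {x. dig x j \<ge> T}"
  have I: "?I \<subseteq> {..<N} \<times> {..<N}" by auto
  then have fin: "finite ?I" by (rule finite_subset) auto
  have "card ?I \<le> card ({..<N} \<times> {..<N})" using I by (intro card_mono) auto
  then have card: "real (card ?I) \<le> real N ^ 2" by (simp add: card_cartesian_product power2_eq_square flip: of_nat_mult)
  have S: "?S p \<in> sets lborel" for p
  proof -
    have "irr \<inter> {x. dig x i \<ge> T} \<in> sets lborel" for i using dig_sets[of "\<lambda>a. a \<ge> T" i] by (simp add: Int_def)
    from sets.Int[OF this[of "fst p"] this[of "snd p"]] show ?thesis
      by (simp add: split_def Int_ac)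
  qed
  have "{x \<in> irr. \<exists>i<N. \<exists>j<N. i < j \<and> dig x i \<ge> T \<and> dig x j \<ge> T} = (\<Union>p\<in>?I. ?S p)"
    by auto
  also have "measure lborel \<dots> \<le> (\<Sum>p\<in>?I. measure lborel (?S p))"
    using fin S by (rule measure_UNION_le)
  also have "\<dots> \<le> (\<Sum>p\<in>?I. 4 / real T ^ 2)"
  proof (rule sum_mono)
    fix p assume "p \<in> ?I"
    then obtain i j where p: "p = (i, j)" "i < j" by auto
    show "measure lborel (?S p) \<le> 4 / real T ^ 2"
      using depth_dig_ge_pair[OF depth_irr[of 0] T T _ p(2)] by (simp add: p irr_measure power2_eq_square)
  qed
  also have "\<dots> = real (card ?I) * (4 / real T ^ 2)" by simp
  also have "\<dots> \<le> real N ^ 2 * (4 / real T ^ 2)" using card by (intro mult_right_mono) auto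
  finally show ?thesis .
qed

lemma prod_list_exp_pre: "prod_list (map (\<lambda>a. exp (real (f a) / c)) (pre x n)) = exp (real (\<Sum>i<n. f (dig x i)) / c)"
  by (induction n) (auto simp: pre_Suc exp_add[symmetric] add_divide_distrib)

text \<open>Chernoff's bound with exponent \<open>1 / T\<close>, the scale at which a digit
  truncated at \<open>T\<close> has a bounded exponential.\<close>

lemma measure_truncated_sum:
  assumes T: "T \<ge> 1"
  shows "measure lborel {x \<in> irr. real (\<Sum>i<n. min (dig x i) T) > R} \<le>
    exp (real n * (4 / real T * (1 + ln (real T))) - R / real T)"
proof -
  let ?F = "\<lambda>w. prod_list (map (\<lambda>a. ennreal (exp (real (min a T) / real T))) w)"
  let ?E = "real n * (4 / real T * (1 + ln (real T)))"
  let ?Z = "{x \<in> irr. real (\<Sum>i<n. min (dig x i) T) > R}"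
  let ?Y = "{x \<in> irr. ?F (pre x n) \<ge> ennreal (exp (R / real T))}"
  have Zs: "?Z \<in> sets lborel"
  proof -
    have "?Z = {x \<in> irr. real (sum_list (map (\<lambda>a. min a T) (pre x n))) > R}"
      by (simp add: pre_def o_def interv_sum_list_conv_sum_set_nat atLeast0LessThan)
    then show ?thesis
      by (rule ssubst) (rule pre_sets[of "\<lambda>w. real (sum_list (map (\<lambda>a. min a T) w)) > R" n])
  qed
  have "?Z \<subseteq> ?Y"
  proof
    fix x assume x: "x \<in> ?Z"
    have "?F (pre x n) = ennreal (exp (real (\<Sum>i<n. min (dig x i) T) / real T))"
      by (subst prod_list_ennreal) (simp_all only: prod_list_exp_pre exp_ge_zero)
    moreover have "R / real T \<le> real (\<Sum>i<n. min (dig x i) T) / real T"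
      using x T by (intro divide_right_mono) auto
    ultimately show "x \<in> ?Y" using x by (auto intro: ennreal_leI)
  qed
  then have "measure lborel ?Z \<le> measure lborel ?Y"
    by (intro measure_mono_fmeasurable fmeasurable_irr Zs pre_sets) auto
  also have "\<dots> \<le> exp (?E - R / real T)"
  proof -
    have "ennreal (exp (R / real T)) * emeasure lborel ?Y \<le> ennreal (exp ?E)"
      using expect_Markov[of "exp (R / real T)" ?F n] expect_exp_min[OF T, of n] by (simp add: order_trans)
    moreover have "emeasure lborel ?Y = ennreal (measure lborel ?Y)"
      by (intro emeasure_eq_measure_irr pre_sets) auto
    ultimately have "ennreal (exp (R / real T) * measure lborel ?Y) \<le> ennreal (exp ?E)"
      by (simp add: ennreal_mult'')
    then have "exp (R / real T) * measure lborel ?Y \<le> exp ?E" by (subst (asm) ennreal_le_iff) auto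
    then show ?thesis by (simp add: exp_diff field_simps)
  qed
  finally show ?thesis .
qed

text \<open>For \<open>n\<close> up to \<open>2^j\<close> the truncation level is
  \<open>2^j s j\<close> with \<open>s j\<close> about \<open>j^(2/3)\<close>. Two digits above it
  occur with probability at most \<open>4 / (s j)^2\<close>, and the truncated sum is too large with
  probability at most \<open>exp (- j / s j)\<close>. Both are summable in \<open>j\<close>, because
  the exponent \<open>2/3\<close> lies strictly between \<open>1/2\<close> and \<open>1\<close>. So
  eventually at most one digit is large, and it is the one removed.\<close>

lemma AE_trimmed_sum:
  "AE x in lborel. x \<in> irr \<longrightarrow> eventually (\<lambda>n. \<exists>k<n. real (\<Sum>i\<in>{..<n} - {k}. dig x i) \<le> 78 * (real n * ln (real n))) sequentially"
proof -
  define s where "s = (\<lambda>j::nat. nat \<lceil>real j powr (2/3)\<rceil>)"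
  define T where "T = (\<lambda>j::nat. 2 ^ j * s j)"
  have s: "s j \<ge> 1" "real (s j) \<ge> real j powr (2/3)" "real (s j) \<le> 2 * real j powr (2/3)" "s j \<le> j" if "j \<ge> 1" for j
  proof -
    have 1: "real j powr (2/3) \<ge> 1" using that by (simp add: ge_one_powr_ge_zero)
    then show "s j \<ge> 1" unfolding s_def by linarith
    show "real (s j) \<ge> real j powr (2/3)" unfolding s_def by linarith
    show "real (s j) \<le> 2 * real j powr (2/3)" using 1 unfolding s_def by linarith
    have "real j powr (2/3) \<le> real j powr 1" using that by (intro powr_mono) auto
    then have "real j powr (2/3) \<le> real j" using that by simp
    then show "s j \<le> j" unfolding s_def by (simp add: nat_le_iff ceiling_le_iff)
  qed
  have T: "T j \<ge> 1" if "j \<ge> 1" for j using s(1)[OF that] by (simp add: T_def)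
  let ?Z1 = "\<lambda>j. {x \<in> irr. \<exists>i<2 ^ j. \<exists>i'<2 ^ j. i < i' \<and> dig x i \<ge> T j \<and> dig x i' \<ge> T j}"
  \<comment> \<open>The exponential moment uses up \<open>12 j / s j\<close>, since
    \<open>1 + ln (T j) <= 3 j\<close>; the thirteenth unit is what remains as
    \<open>exp (- j / s j)\<close>.\<close>
  let ?Z2 = "\<lambda>j. {x \<in> irr. real (\<Sum>i<2 ^ j. min (dig x i) (T j)) > 13 * 2 ^ j * real j}"
  have 1: "AE x in lborel. eventually (\<lambda>j. x \<notin> ?Z1 j) sequentially"
  proof (rule AE_borel_cantelli[where m = 1])
    show "?Z1 j \<in> sets lborel" for j
    proof -
      have "?Z1 j = {x \<in> irr. \<exists>i<2 ^ j. \<exists>i'<2 ^ j. i < i' \<and> pre x (2 ^ j) ! i \<ge> T j \<and> pre x (2 ^ j) ! i' \<ge> T j}"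
        by (intro Collect_cong conj_cong refl ex_cong) (simp_all add: nth_pre)
      then show ?thesis
        by (rule ssubst) (rule pre_sets[of "\<lambda>w. \<exists>i<2 ^ j. \<exists>i'<2 ^ j. i < i' \<and> w ! i \<ge> T j \<and> w ! i' \<ge> T j" "2 ^ j"])
    qed
    show "summable (\<lambda>j. 4 * (real j powr (-4/3)))"
      using summable_real_powr_iff[of "-4/3"] by (intro summable_mult) auto
    fix j :: nat assume j: "1 \<le> j"
    have "measure lborel (?Z1 j) \<le> real (2 ^ j) ^ 2 * (4 / real (T j) ^ 2)"
      by (rule measure_two_large[OF T[OF j]])
    also have "\<dots> = 4 / real (s j) ^ 2" by (simp add: T_def power_mult_distrib)
    also have "\<dots> \<le> 4 / (real j powr (2/3)) ^ 2"
      by (intro divide_left_mono power_mono mult_pos_pos zero_less_power s(2)[OF j]) (use s(1)[OF j] j in simp_all)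
    also have "\<dots> = 4 * (real j powr (-4/3))" using j by (simp add: powr_minus_divide powr_power)
    finally show "measure lborel (?Z1 j) \<le> 4 * (real j powr (-4/3))" .
  qed auto
  have 2: "AE x in lborel. eventually (\<lambda>j. x \<notin> ?Z2 j) sequentially"
  proof (rule AE_borel_cantelli[where m = 1])
    show "?Z2 j \<in> sets lborel" for j
    proof -
      have "?Z2 j = {x \<in> irr. real (\<Sum>i<2 ^ j. min (pre x (2 ^ j) ! i) (T j)) > 13 * 2 ^ j * real j}"
        by (intro Collect_cong conj_cong refl arg_cong2[of _ _ _ _ "(<)"] arg_cong[of _ _ real] sum.cong) (simp_all add: nth_pre)
      then show ?thesis
        by (rule ssubst) (rule pre_sets[of "\<lambda>w. real (\<Sum>i<2 ^ j. min (w ! i) (T j)) > 13 * 2 ^ j * real j" "2 ^ j"])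
    qed
    have "(\<lambda>j. exp (- (real j powr (1/3) / 2))) \<in> O(\<lambda>j. real j powr (-2))" by real_asymp
    moreover have "summable (\<lambda>j. norm (real j powr (-2)))"
      using summable_real_powr_iff[of "-2"] by simp
    ultimately show "summable (\<lambda>j. exp (- (real j powr (1/3) / 2)))"
      by (rule summable_comparison_test_bigo[rotated])
    fix j :: nat assume j: "1 \<le> j"
    have "measure lborel (?Z2 j) \<le> exp (real (2 ^ j) * (4 / real (T j) * (1 + ln (real (T j)))) - 13 * 2 ^ j * real j / real (T j))"
      by (rule measure_truncated_sum[OF T[OF j]])
    also have "\<dots> \<le> exp (- (real j powr (1/3) / 2))"
    proof -
      have "T j \<le> 2 ^ j * 2 ^ j"
        unfolding T_def using s(4)[OF j] less_exp[of j] by (intro mult_left_mono) linarith+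
      also have "(2::nat) ^ j * 2 ^ j = 4 ^ j" by (simp flip: power_mult_distrib)
      finally have "real (T j) \<le> real (4 ^ j)" by (simp only: of_nat_le_iff)
      then have "ln (real (T j)) \<le> ln (real (4 ^ j))" using T[OF j] by (subst ln_le_cancel_iff) auto
      also have "\<dots> = real j * ln (2 * 2)" by (simp add: ln_realpow)
      also have "ln (2 * 2 :: real) = 2 * ln 2" by (subst ln_mult) auto
      also have "real j * (2 * ln 2) \<le> real j * 2" using ln_2_less_1 by (intro mult_left_mono) auto
      finally have "1 + ln (real (T j)) \<le> 3 * real j" using j by simp
      then have "4 / real (s j) * (1 + ln (real (T j))) \<le> 4 / real (s j) * (3 * real j)"
        by (intro mult_left_mono) auto
      moreover have "real (2 ^ j) * (4 / real (T j) * L) = 4 / real (s j) * L" for L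
        by (simp add: T_def)
      moreover have "13 * 2 ^ j * real j / real (T j) = 13 * (real j / real (s j))"
        by (simp add: T_def)
      moreover have "4 / real (s j) * (3 * real j) = 12 * (real j / real (s j))" by simp
      ultimately have "real (2 ^ j) * (4 / real (T j) * (1 + ln (real (T j)))) - 13 * 2 ^ j * real j / real (T j) \<le> - (real j / real (s j))"
        by (simp only:)
      also have "\<dots> \<le> - (real j / (2 * real j powr (2/3)))"
        using s(1,3)[OF j] j by (simp add: divide_left_mono)
      also have "real j / (2 * real j powr (2/3)) = real j powr (1/3) / 2"
        using j powr_diff[of "real j" 1 "2/3"] by simp
      finally show ?thesis by simp
    qed
    finally show "measure lborel (?Z2 j) \<le> exp (- (real j powr (1/3) / 2))" .
  qed auto
  show ?thesis
    using 1 2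
  proof eventually_elim
    case (elim x)
    show ?case
    proof
      assume x: "x \<in> irr"
      from elim obtain j0 where j0: "\<And>j. j \<ge> j0 \<Longrightarrow> x \<notin> ?Z1 j \<and> x \<notin> ?Z2 j"
        using eventually_conj[OF elim] by (auto simp: eventually_sequentially)
      show "eventually (\<lambda>n. \<exists>k<n. real (\<Sum>i\<in>{..<n} - {k}. dig x i) \<le> 78 * (real n * ln (real n))) sequentially"
        unfolding eventually_sequentially
      proof (rule exI[of _ "2 ^ (j0 + 1)"], intro allI impI)
        fix n :: nat assume n: "2 ^ (j0 + 1) \<le> n"
        have "n \<ge> 1" using n by (metis le_trans one_le_numeral one_le_power)
        then obtain m where m: "2 ^ m \<le> n" "n < 2 ^ (m + 1)" using ex_power_ivl1[of 2 n] by auto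
        define j where "j = m + 1"
        have "(2::nat) ^ (j0 + 1) < 2 ^ (m + 1)" using n m(2) by (rule le_less_trans)
        then have "j0 + 1 < m + 1" by (rule power_less_imp_less_exp[rotated]) simp
        then have jj: "j \<ge> j0" "m \<ge> 1" by (auto simp: j_def)
        have nz: "x \<notin> ?Z1 j" "x \<notin> ?Z2 j" using j0[OF jj(1)] by auto
        have nj: "n \<le> 2 ^ j" using m by (simp add: j_def)
        \<comment> \<open>If no digit reaches the truncation level, any index may be removed, and
          index \<open>0\<close> is taken.\<close>
        obtain k where k: "k < n" "\<And>i. i < n \<Longrightarrow> i \<noteq> k \<Longrightarrow> dig x i < T j"
        proof (cases "\<exists>k<n. dig x k \<ge> T j")
          case True
          then obtain k where k: "k < n" "dig x k \<ge> T j" by auto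
          have "dig x i < T j" if "i < n" "i \<noteq> k" for i
          proof (rule ccontr)
            assume "\<not> dig x i < T j"
            then have "min i k < 2 ^ j \<and> max i k < 2 ^ j \<and> min i k < max i k \<and> dig x (min i k) \<ge> T j \<and> dig x (max i k) \<ge> T j"
              using that k nj by (auto simp: min_def max_def)
            then show False using nz(1) x by blast
          qed
          then show ?thesis using that k by blast
        next
          case False
          then show ?thesis using that[of 0] \<open>n \<ge> 1\<close> by (auto simp: not_le)
        qed
        have "(\<Sum>i\<in>{..<n} - {k}. dig x i) = (\<Sum>i\<in>{..<n} - {k}. min (dig x i) (T j))"
          using k by (intro sum.cong) (auto simp: min_def dest: less_imp_le)
        also have "\<dots> \<le> (\<Sum>i<2 ^ j. min (dig x i) (T j))"
          using nj by (intro sum_mono2) auto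
        finally have "real (\<Sum>i\<in>{..<n} - {k}. dig x i) \<le> real (\<Sum>i<2 ^ j. min (dig x i) (T j))"
          by (simp only: of_nat_le_iff)
        also have "\<dots> \<le> 13 * 2 ^ j * real j" using nz(2) x by (simp add: not_less)
        also have "\<dots> = 26 * (2 ^ m * real (m + 1))" by (simp add: j_def)
        \<comment> \<open>\<open>j = m + 1\<close> with \<open>2^m <= n\<close> turns
          \<open>13 * 2^j\<close> into at most \<open>26 n\<close>, and
          \<open>m + 1 <= 3 ln n\<close> supplies the remaining factor of \<open>78\<close>.\<close>
        also have "\<dots> \<le> 26 * (real n * (3 * ln (real n)))"
        proof -
          have "real (2 ^ m) \<le> real n" using m(1) by (simp only: of_nat_le_iff)
          then have 1: "2 ^ m \<le> real n" by simp
          have "real m * (2/3) \<le> real m * ln 2" using ln2_ge_two_thirds by (intro mult_left_mono) auto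
          also have "\<dots> = ln (2 ^ m)" by (simp add: ln_realpow)
          also have "\<dots> \<le> ln (real n)" using 1 \<open>n \<ge> 1\<close> by (subst ln_le_cancel_iff) auto
          finally have "real m * (2/3) \<le> ln (real n)" .
          then have "real (m + 1) \<le> 3 * ln (real n)" using jj(2) by simp
          then show ?thesis using 1 by (intro mult_left_mono mult_mono) auto
        qed
        finally show "\<exists>k<n. real (\<Sum>i\<in>{..<n} - {k}. dig x i) \<le> 78 * (real n * ln (real n))"
          using k(1) by auto
      qed
    qed
  qed
qed

section \<open>Sawtooth sums and Riemann sums\<close>

text \<open>The first Bernoulli function with reversed sign: it has mean zero and jumps upwards by
  one at every integer.\<close>

definition saw :: "real \<Rightarrow> real" where "saw z = 1/2 - frac z"

text \<open>The periodic continuous antiderivative of \<open>saw\<close>, which is the second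
  Bernoulli function up to an affine change.\<close>

definition bern :: "real \<Rightarrow> real" where "bern z = frac z * (1 - frac z) / 2"

text \<open>The integral of the floor function from \<open>0\<close> to \<open>z\<close>, a convex
  function.\<close>

definition floor_int :: "real \<Rightarrow> real" where
  "floor_int z = real_of_int \<lfloor>z\<rfloor> * z - real_of_int \<lfloor>z\<rfloor> * (real_of_int \<lfloor>z\<rfloor> + 1) / 2"

lemma saw_floor: "saw z = 1/2 - z + \<lfloor>z\<rfloor>"
  by (simp add: saw_def frac_def)

lemma frac_add_int: "frac (z + of_int k) = frac z" for z :: real
  by (simp add: frac_def)

lemma saw_periodic [simp]: "saw (z + of_int k) = saw z" "saw (z + 1) = saw z"
  using frac_add_int[of z k] frac_add_int[of z 1] by (simp_all add: saw_def)

lemma bern_periodic [simp]: "bern (z + of_int k) = bern z" "bern (z + 1) = bern z"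
  using frac_add_int[of z k] frac_add_int[of z 1] by (simp_all add: bern_def)

lemma bern_floor_int: "bern z = z / 2 - z\<^sup>2 / 2 + floor_int z"
  by (simp add: bern_def floor_int_def frac_def power2_eq_square field_simps)

text \<open>Convexity: with \<open>m\<close>, \<open>n\<close> the floors of \<open>z\<close>,
  \<open>z'\<close>, the excess is \<open>(n - m) (z' - (n + m + 1) / 2)\<close>, and
  \<open>n <= z' < n + 1\<close> makes both factors have the same sign.\<close>

lemma floor_int_subgradient: "floor_int z' - floor_int z \<ge> real_of_int \<lfloor>z\<rfloor> * (z' - z)"
proof -
  define m n where "m = \<lfloor>z\<rfloor>" "n = \<lfloor>z'\<rfloor>"
  have z': "of_int n \<le> z'" "z' < of_int n + 1" by (auto simp: m_n_def)
  have "(real_of_int n - of_int m) * (z' - (of_int n + of_int m + 1) / 2) \<ge> 0"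
  proof (cases n m rule: linorder_cases)
    case less
    then have "real_of_int n + 1 \<le> of_int m" by linarith
    then show ?thesis using z' by (intro mult_nonpos_nonpos) auto
  next
    case greater
    then have "real_of_int m + 1 \<le> of_int n" by linarith
    then show ?thesis using z' by (intro mult_nonneg_nonneg) auto
  qed simp
  then show ?thesis
    by (simp add: floor_int_def m_n_def[symmetric]) (simp add: field_simps)
qed

text \<open>The error of one step of a left Riemann sum for \<open>saw\<close>:
  \<open>h\<^sup>2 / 2\<close> comes from the slope, and each jump crossed costs at most
  \<open>\<bar>h\<bar>\<close>. The jump part is squeezed between two subgradient
  inequalities.\<close>

lemma bern_diff:
  "\<bar>bern (z + h) - bern z - h * saw z\<bar> \<le> h\<^sup>2 / 2 + \<bar>h\<bar> * \<bar>real_of_int \<lfloor>z + h\<rfloor> - \<lfloor>z\<rfloor>\<bar>"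
proof -
  define D where "D = floor_int (z + h) - floor_int z - h * real_of_int \<lfloor>z\<rfloor>"
  have D: "0 \<le> D" "D \<le> h * (real_of_int \<lfloor>z + h\<rfloor> - real_of_int \<lfloor>z\<rfloor>)"
    using floor_int_subgradient[of z "z + h"] floor_int_subgradient[of "z + h" z]
    by (simp_all add: D_def algebra_simps)
  have "\<bar>D\<bar> \<le> \<bar>h\<bar> * \<bar>real_of_int \<lfloor>z + h\<rfloor> - \<lfloor>z\<rfloor>\<bar>" using D by (simp add: abs_mult[symmetric])
  moreover have "bern (z + h) - bern z - h * saw z = - h\<^sup>2 / 2 + D"
    by (simp add: bern_floor_int saw_floor D_def power2_eq_square field_simps)
  ultimately show ?thesis
    using abs_triangle_ineq[of "- h\<^sup>2 / 2" D] by simp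
qed

lemma bern_bounds: "0 \<le> bern z" "bern z \<le> 1/2"
proof -
  have f: "0 \<le> frac z" "frac z < 1" by (auto simp: frac_lt_1)
  then show "0 \<le> bern z" by (simp add: bern_def)
  have "frac z * (1 - frac z) \<le> 1 * 1" using f by (intro mult_mono) auto
  then show "bern z \<le> 1/2" by (simp add: bern_def)
qed

text \<open>At distance at least one the range \<open>[0, 1/2]\<close> settles the matter; at
  smaller distances the subgradient inequalities at both endpoints bound the slope by one in
  absolute value.\<close>

lemma bern_Lipschitz: "\<bar>bern x - bern y\<bar> \<le> \<bar>x - y\<bar>"
proof -
  have *: "\<bar>bern x - bern y\<bar> \<le> x - y" if "y \<le> x" for x y
  proof (cases "x - y \<ge> 1")
    case True
    then show ?thesis using bern_bounds[of x] bern_bounds[of y] by linarith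
  next
    case False
    define d where "d = x - y"
    have d: "0 \<le> d" "d \<le> 1" using that False by (auto simp: d_def)
    have "floor_int x - floor_int y \<le> real_of_int \<lfloor>x\<rfloor> * d" "floor_int x - floor_int y \<ge> real_of_int \<lfloor>y\<rfloor> * d"
      using floor_int_subgradient[of x y] floor_int_subgradient[of y x] by (simp_all add: d_def algebra_simps)
    moreover have "bern x - bern y = d * (1/2 - (x + y) / 2) + (floor_int x - floor_int y)"
      by (simp add: bern_floor_int d_def power2_eq_square field_simps)
    ultimately have **: "bern x - bern y \<le> d * (1/2 - (x + y) / 2 + \<lfloor>x\<rfloor>)" "bern x - bern y \<ge> d * (1/2 - (x + y) / 2 + \<lfloor>y\<rfloor>)"
      by (simp_all add: algebra_simps)
    have *: "1/2 - (x + y) / 2 + m \<le> 1" if "m \<le> x" for m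
      using d that unfolding d_def by argo
    have "1/2 - (x + y) / 2 + \<lfloor>x\<rfloor> \<le> 1" by (rule *) simp
    have *: "1/2 - (x + y) / 2 + m \<ge> -1" if "y < m + 1" for m
      using d that unfolding d_def by argo
    have "1/2 - (x + y) / 2 + \<lfloor>y\<rfloor> \<ge> -1" by (rule *) simp
    with \<open>1/2 - (x + y) / 2 + \<lfloor>x\<rfloor> \<le> 1\<close> have "d * (1/2 - (x + y) / 2 + \<lfloor>x\<rfloor>) \<le> d * 1" "d * (1/2 - (x + y) / 2 + \<lfloor>y\<rfloor>) \<ge> d * (-1)"
      using d by (intro mult_left_mono; simp)+
    with ** show ?thesis by (simp add: d_def)
  qed
  show ?thesis using *[of x y] *[of y x] by (cases "y \<le> x") auto
qed

text \<open>Raising \<open>n\<close> by one replaces the term \<open>n div q\<close> by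
  \<open>(n + q) div q\<close>, which is larger by one. The induction runs in both directions
  because \<open>n\<close> is an integer.\<close>

lemma sum_div_shift: "q \<ge> 1 \<Longrightarrow> (\<Sum>j<q. (n + int j) div int q) = n"
proof (induction n rule: int_induct[of _ 0])
  case base then show ?case by (simp add: sum.neutral)
next
  case (step1 i)
  have "(\<Sum>j<q. (i + 1 + int j) div int q) = (\<Sum>j<Suc q. (i + int j) div int q) - i div int q"
    by (subst sum.lessThan_Suc_shift) (simp add: add_ac)
  then show ?case using step1 by simp
next
  case (step2 i)
  have "(\<Sum>j<Suc q. (i - 1 + int j) div int q) = (i - 1) div int q + (\<Sum>j<q. (i + int j) div int q)"
    by (subst sum.lessThan_Suc_shift) (simp add: add_ac)
  then have "(\<Sum>j<q. (i - 1 + int j) div int q) = (i - 1) div int q + i - (i - 1 + int q) div int q"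
    using step2 by simp
  then show ?case using step2 by simp
qed

lemma Hermite_floor: assumes "q \<ge> 1" shows "(\<Sum>j<q. \<lfloor>y + real j / real q\<rfloor>) = \<lfloor>real q * y\<rfloor>"
proof -
  have "\<lfloor>y + real j / real q\<rfloor> = (\<lfloor>real q * y\<rfloor> + int j) div int q" for j
  proof -
    have "y + real j / real q = (real q * y + real j) / real q" using assms by (simp add: field_simps)
    also have "\<lfloor>\<dots>\<rfloor> = \<lfloor>real q * y + real j\<rfloor> div int q"
      using floor_divide_real_eq_div[of "int q" "real q * y + real j"] by simp
    also have "\<lfloor>real q * y + real j\<rfloor> = \<lfloor>real q * y\<rfloor> + int j" using floor_add_int[of "real q * y" "int j"] by simp
    finally show ?thesis .
  qed
  then show ?thesis using sum_div_shift[OF assms] by simp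
qed

text \<open>The distribution relation of the first Bernoulli function. It collapses a full block of
  \<open>q\<close> equally spaced points to a single value.\<close>

lemma sum_saw: assumes "q \<ge> 1" shows "(\<Sum>j<q. saw (y + real j / real q)) = saw (real q * y)"
proof -
  have "(\<Sum>j<q. real j) = real q * (real q - 1) / 2" by (induction q) (auto simp: field_simps)
  then have s: "(\<Sum>j<q. real j / real q) = (real q - 1) / 2"
    using assms by (simp add: sum_divide_distrib[symmetric])
  have "(\<Sum>j<q. saw (y + real j / real q)) = (\<Sum>j<q. (1/2 - y) - real j / real q + of_int \<lfloor>y + real j / real q\<rfloor>)"
    by (intro sum.cong) (auto simp: saw_floor)
  also have "\<dots> = real q * (1/2 - y) - (real q - 1) / 2 + of_int (\<Sum>j<q. \<lfloor>y + real j / real q\<rfloor>)"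
    by (simp add: sum.distrib sum_subtractf s)
  also have "\<dots> = saw (real q * y)" unfolding Hermite_floor[OF assms] saw_floor by (simp add: field_simps)
  finally show ?thesis .
qed

lemma periodic_int:
  fixes g :: "real \<Rightarrow> real"
  assumes "\<And>x. g (x + 1) = g x" shows "g (x + of_int k) = g x"
proof (induction k rule: int_induct[of _ 0])
  case (step1 i) then show ?case using assms[of "x + of_int i"] by (simp add: add.assoc)
next
  case (step2 i) then show ?case using assms[of "x + of_int (i - 1)"] by (simp add: algebra_simps)
qed simp

text \<open>Multiplication by \<open>p\<close> permutes the residues modulo \<open>q\<close>, so a
  full block of the rational rotation visits equally spaced points.\<close>

lemma sum_periodic_coprime:
  fixes g :: "real \<Rightarrow> real"
  assumes g: "\<And>x. g (x + 1) = g x" and pq: "coprime p q" "q \<ge> 1"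
  shows "(\<Sum>n=1..q. g (x + real n * (real p / real q))) = (\<Sum>j<q. g (x + real j / real q))"
proof -
  have inj: "inj_on (\<lambda>n. n * p mod q) {1..q}"
  proof (rule linorder_inj_onI)
    fix m n assume mn: "m < n" "m \<in> {1..q}" "n \<in> {1..q}"
    show "m * p mod q \<noteq> n * p mod q"
    proof
      assume "m * p mod q = n * p mod q"
      then have "q dvd n * p - m * p" using mn by (metis mod_eq_dvd_iff_nat mult_le_mono1 less_imp_le)
      then have "q dvd (n - m) * p" by (simp add: diff_mult_distrib)
      then have "q dvd n - m" using pq by (simp add: coprime_commute coprime_dvd_mult_left_iff)
      then show False using mn by (auto dest: dvd_imp_le)
    qed
  qed auto
  moreover have "(\<lambda>n. n * p mod q) ` {1..q} = {..<q}"
  proof (rule card_subset_eq)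
    show "card ((\<lambda>n. n * p mod q) ` {1..q}) = card {..<q}" using card_image[OF inj] by simp
  qed (use pq in auto)
  ultimately have bij: "bij_betw (\<lambda>n. n * p mod q) {1..q} {..<q}" by (simp add: bij_betw_def)
  have "(\<Sum>j<q. g (x + real j / real q)) = (\<Sum>n=1..q. g (x + real (n * p mod q) / real q))"
    by (rule sum.reindex_bij_betw[OF bij, symmetric])
  also have "\<dots> = (\<Sum>n=1..q. g (x + real n * (real p / real q)))"
  proof (rule sum.cong)
    fix n
    have "real (n * p) = real (n * p mod q) + real q * real (n * p div q)"
      by (metis mod_mult_div_eq of_nat_add of_nat_mult)
    then have "x + real n * (real p / real q) = (x + real (n * p mod q) / real q) + of_int (int (n * p div q))"
      using pq by (simp add: field_simps)
    then show "g (x + real (n * p mod q) / real q) = g (x + real n * (real p / real q))"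
      using periodic_int[of g, OF g] by metis
  qed auto
  finally show ?thesis by simp
qed

section \<open>Sums over blocks whose length is a convergent denominator\<close>

lemma block_sum: "(\<Sum>n=1..b * q. f n) = (\<Sum>c<b. \<Sum>n=1..q. f (c * q + n))" for f :: "nat \<Rightarrow> real"
proof (induction b)
  case (Suc b)
  have "(\<Sum>n=1..b * q + q. f n) = (\<Sum>n=1..b * q. f n) + (\<Sum>n=b * q + 1..b * q + q. f n)"
    by (rule sum.ub_add_nat) simp
  also have "(\<Sum>n=b * q + 1..b * q + q. f n) = (\<Sum>n=1..q. f (b * q + n))"
    using sum.shift_bounds_cl_nat_ivl[of f 1 "b * q" q] by (simp add: add.commute)
  finally show ?case using Suc by (simp add: add.commute)
qed simp

text \<open>Along an arithmetic progression the floors are monotone, so their total variation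
  telescopes.\<close>

lemma floor_variation:
  "(\<Sum>c<b. \<bar>real_of_int \<lfloor>Y + real (Suc c) * \<theta>\<rfloor> - \<lfloor>Y + real c * \<theta>\<rfloor>\<bar>) \<le> \<bar>real b * \<theta>\<bar> + 1"
proof -
  let ?h = "\<lambda>c. real_of_int \<lfloor>Y + real c * \<theta>\<rfloor>"
  define s :: real where "s = (if \<theta> \<ge> 0 then 1 else -1)"
  have "\<bar>?h (Suc c) - ?h c\<bar> = s * (?h (Suc c) - ?h c)" for c
  proof (cases "\<theta> \<ge> 0")
    case True
    then have "\<lfloor>Y + real c * \<theta>\<rfloor> \<le> \<lfloor>Y + real (Suc c) * \<theta>\<rfloor>" by (intro floor_mono) (simp add: algebra_simps)
    then show ?thesis using True by (simp add: s_def)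
  next
    case False
    then have "\<lfloor>Y + real (Suc c) * \<theta>\<rfloor> \<le> \<lfloor>Y + real c * \<theta>\<rfloor>" by (intro floor_mono) (simp add: algebra_simps)
    then show ?thesis using False by (simp add: s_def)
  qed
  then have "(\<Sum>c<b. \<bar>?h (Suc c) - ?h c\<bar>) = s * (?h b - ?h 0)"
    using sum_lessThan_telescope[of ?h b] by (simp only: sum_distrib_left[symmetric])
  also have "\<dots> \<le> \<bar>?h b - ?h 0\<bar>" by (auto simp: s_def)
  also have "\<dots> \<le> \<bar>real b * \<theta>\<bar> + 1" by (simp, linarith)
  finally show ?thesis .
qed

text \<open>Multiplied by \<theta>, the sum is a Riemann sum for the integral of \<open>saw\<close>
  over an interval of length at most one. The errors add up to at most \<open>1/2\<close> from the
  slopes and \<open>2\<close> from the jumps crossed.\<close>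

lemma saw_sum_bern:
  assumes \<theta>: "\<theta> \<noteq> 0" "real b * \<bar>\<theta>\<bar> \<le> 1"
  shows "\<bar>(\<Sum>c<b. saw (Y + real c * \<theta>)) - (bern (Y + real b * \<theta>) - bern Y) / \<theta>\<bar> \<le> 3"
proof -
  let ?z = "\<lambda>c. Y + real c * \<theta>"
  have "bern (?z b) - bern Y = (\<Sum>c<b. bern (?z (Suc c)) - bern (?z c))"
    using sum_lessThan_telescope[of "\<lambda>c. bern (?z c)" b] by simp
  then have eq: "(\<Sum>c<b. saw (?z c)) - (bern (?z b) - bern Y) / \<theta> = - (\<Sum>c<b. (bern (?z c + \<theta>) - bern (?z c) - \<theta> * saw (?z c)) / \<theta>)"
  proof -
    assume *: "bern (?z b) - bern Y = (\<Sum>c<b. bern (?z (Suc c)) - bern (?z c))"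
    have s: "?z (Suc c) = ?z c + \<theta>" for c by (simp add: algebra_simps)
    show ?thesis
      unfolding * sum_divide_distrib sum_subtractf[symmetric] sum_negf[symmetric] s
    proof (rule sum.cong[OF refl])
      fix c
      have "w - v / \<theta> = - ((v - \<theta> * w) / \<theta>)" for w v using \<theta>(1) by (simp add: field_simps)
      then show "saw (?z c) - (bern (?z c + \<theta>) - bern (?z c)) / \<theta> = - ((bern (?z c + \<theta>) - bern (?z c) - \<theta> * saw (?z c)) / \<theta>)" .
    qed
  qed
  have "\<bar>(\<Sum>c<b. saw (?z c)) - (bern (?z b) - bern Y) / \<theta>\<bar> \<le> (\<Sum>c<b. \<bar>\<theta>\<bar> / 2 + \<bar>real_of_int \<lfloor>?z (Suc c)\<rfloor> - \<lfloor>?z c\<rfloor>\<bar>)"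
    unfolding eq abs_minus_cancel
  proof (rule order_trans[OF sum_abs sum_mono])
    fix c
    have "\<bar>(bern (?z c + \<theta>) - bern (?z c) - \<theta> * saw (?z c)) / \<theta>\<bar> \<le> (\<theta>\<^sup>2 / 2 + \<bar>\<theta>\<bar> * \<bar>real_of_int \<lfloor>?z c + \<theta>\<rfloor> - \<lfloor>?z c\<rfloor>\<bar>) / \<bar>\<theta>\<bar>"
      unfolding abs_divide using bern_diff[of "?z c" \<theta>] by (rule divide_right_mono) simp
    also have "\<dots> = \<bar>\<theta>\<bar> / 2 + \<bar>real_of_int \<lfloor>?z c + \<theta>\<rfloor> - \<lfloor>?z c\<rfloor>\<bar>"
    proof -
      have "(t\<^sup>2 / 2 + t * X) / t = t / 2 + X" if "t > 0" for t X :: real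
        using that by (simp add: field_simps power2_eq_square)
      from this[of "\<bar>\<theta>\<bar>"] \<theta> show ?thesis by (simp only: power2_abs zero_less_abs_iff not_False_eq_True)
    qed
    finally have b: "\<bar>(bern (?z c + \<theta>) - bern (?z c) - \<theta> * saw (?z c)) / \<theta>\<bar> \<le> \<bar>\<theta>\<bar> / 2 + \<bar>real_of_int \<lfloor>?z c + \<theta>\<rfloor> - \<lfloor>?z c\<rfloor>\<bar>" .
    have e: "?z (Suc c) = ?z c + \<theta>" by (simp add: algebra_simps)
    show "\<bar>(bern (?z c + \<theta>) - bern (?z c) - \<theta> * saw (?z c)) / \<theta>\<bar> \<le> \<bar>\<theta>\<bar> / 2 + \<bar>real_of_int \<lfloor>?z (Suc c)\<rfloor> - \<lfloor>?z c\<rfloor>\<bar>"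
      unfolding e by (rule b)
  qed
  also have "\<dots> = real b * \<bar>\<theta>\<bar> / 2 + (\<Sum>c<b. \<bar>real_of_int \<lfloor>?z (Suc c)\<rfloor> - \<lfloor>?z c\<rfloor>\<bar>)"
    by (simp only: sum.distrib sum_constant card_lessThan times_divide_eq_right)
  also have "\<dots> \<le> 1/2 + (1 + 1)"
    using floor_variation[of Y \<theta> b] \<theta>(2) by (simp only: abs_mult abs_of_nat)
  finally show ?thesis by simp
qed

text \<open>Each block of \<open>q\<close> steps is compared with the rational rotation by
  \<open>p / q\<close>, whose sum is a single value of \<open>saw\<close> at scale \<open>q\<close>.
  From one block to the next the start moves by \<open>q \<delta>\<close>, so at scale
  \<open>q\<close> the argument moves by \<open>\<theta>\<close>, and \<open>saw_sum_bern\<close>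
  adds up the blocks. The passage to the rational rotation costs \<open>3\<close> and
  \<open>saw_sum_bern\<close> another \<open>3\<close>.\<close>

lemma saw_block:
  fixes p q b :: nat
  assumes pq: "coprime p q" "q \<ge> 1" and \<alpha>: "\<alpha> = real p / real q + \<delta>"
    and \<theta>: "\<theta> = (real q)\<^sup>2 * \<delta>" "\<theta> \<noteq> 0" "real b * \<bar>\<theta>\<bar> \<le> 1"
  shows "\<bar>(\<Sum>n=1..b * q. saw (y + real n * \<alpha>)) - (bern (real q * y + real b * \<theta>) - bern (real q * y)) / \<theta>\<bar> \<le> 6"
proof -
  define z where "z = (\<lambda>c. y + real c * (real q * \<delta>))"
  define u where "u = (\<lambda>c n. z c + real n * (real p / real q))"
  define R where "R = (\<lambda>c. \<Sum>n=1..q. real_of_int \<lfloor>u c n\<rfloor>)"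
  define F where "F = (\<lambda>c. \<Sum>n=1..q. real_of_int \<lfloor>u c n + real n * \<delta>\<rfloor>)"
  have qz: "real q * z c = real q * y + real c * \<theta>" for c
    by (simp add: z_def \<theta> power2_eq_square algebra_simps)
  have saw_u: "(\<Sum>n=1..q. saw (u c n)) = saw (real q * z c)" for c
    unfolding u_def using sum_periodic_coprime[of saw, OF saw_periodic(2) pq] sum_saw[OF pq(2)] by simp
  \<comment> \<open>Written through the collapsed \<open>saw\<close> sum, \<open>R c\<close> is a
    single floor plus terms independent of \<open>c\<close>; its increments therefore telescope
    along a progression with step \<theta>.\<close>
  have Rdiff: "R (Suc c) - R c = real_of_int \<lfloor>real q * z (Suc c)\<rfloor> - \<lfloor>real q * z c\<rfloor>" for c
  proof -
    have "R c = saw (real q * z c) + real q * z c + (\<Sum>n=1..q. real n * (real p / real q) - 1/2)" for c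
      unfolding R_def saw_u[symmetric] by (simp add: saw_floor u_def sum.distrib sum_subtractf)
    then show ?thesis by (simp add: saw_floor)
  qed
  \<comment> \<open>The drift \<open>n \<delta>\<close> with \<open>n <= q\<close> does not exceed
    the shift \<open>q \<delta>\<close> to the next block, so monotonicity of the floor puts
    \<open>F c\<close> between \<open>R c\<close> and \<open>R (Suc c)\<close>.\<close>
  have FR: "\<bar>F c - R c\<bar> \<le> \<bar>R (Suc c) - R c\<bar>" for c
  proof (cases "\<delta> \<ge> 0")
    case True
    have "u c n \<le> u c n + real n * \<delta>" "u c n + real n * \<delta> \<le> u (Suc c) n" if "n \<in> {1..q}" for n
      using that True mult_right_mono[of "real n" "real q" \<delta>] by (auto simp: u_def z_def algebra_simps)
    then have "R c \<le> F c" "F c \<le> R (Suc c)"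
      unfolding R_def F_def by (intro sum_mono, simp only: of_int_le_iff, intro floor_mono, blast)+
    then show ?thesis by simp
  next
    case False
    have "u c n \<ge> u c n + real n * \<delta>" "u c n + real n * \<delta> \<ge> u (Suc c) n" if "n \<in> {1..q}" for n
      using that False mult_right_mono_neg[of "real n" "real q" \<delta>] mult_nonneg_nonpos[of "real n" \<delta>] by (auto simp: u_def z_def algebra_simps)
    then have "R c \<ge> F c" "F c \<ge> R (Suc c)"
      unfolding R_def F_def by (intro sum_mono, simp only: of_int_le_iff, intro floor_mono, blast)+
    then show ?thesis by simp
  qed
  have "(\<Sum>n=1..b * q. saw (y + real n * \<alpha>)) = (\<Sum>c<b. \<Sum>n=1..q. saw (u c n + real n * \<delta>))"
    unfolding block_sum
  proof (intro sum.cong refl)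
    fix c n
    have "y + real (c * q + n) * \<alpha> = (u c n + real n * \<delta>) + of_int (int (c * p))"
      using pq by (simp add: \<alpha> u_def z_def field_simps)
    then show "saw (y + real (c * q + n) * \<alpha>) = saw (u c n + real n * \<delta>)" by (metis saw_periodic(1))
  qed
  also have "\<dots> = (\<Sum>c<b. saw (real q * z c)) + (\<Sum>c<b. (F c - R c) - (\<Sum>n=1..q. real n * \<delta>))"
    unfolding sum.distrib[symmetric]
  proof (intro sum.cong refl)
    fix c
    show "(\<Sum>n=1..q. saw (u c n + real n * \<delta>)) = saw (real q * z c) + (F c - R c - (\<Sum>n=1..q. real n * \<delta>))"
      unfolding saw_u[symmetric] F_def R_def
      by (simp add: sum.distrib[symmetric] sum_subtractf[symmetric] saw_floor algebra_simps)
  qed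
  finally have eq: "(\<Sum>n=1..b * q. saw (y + real n * \<alpha>)) - (\<Sum>c<b. saw (real q * z c)) = (\<Sum>c<b. (F c - R c) - (\<Sum>n=1..q. real n * \<delta>))"
    by simp
  have "\<bar>\<Sum>c<b. (F c - R c) - (\<Sum>n=1..q. real n * \<delta>)\<bar> \<le> (\<Sum>c<b. \<bar>R (Suc c) - R c\<bar> + real q * (real q * \<bar>\<delta>\<bar>))"
  proof (rule order_trans[OF sum_abs sum_mono])
    fix c
    have "\<bar>\<Sum>n=1..q. real n * \<delta>\<bar> \<le> (\<Sum>n=1..q. real q * \<bar>\<delta>\<bar>)"
      by (rule order_trans[OF sum_abs sum_mono]) (auto simp: abs_mult intro: mult_right_mono)
    then show "\<bar>(F c - R c) - (\<Sum>n=1..q. real n * \<delta>)\<bar> \<le> \<bar>R (Suc c) - R c\<bar> + real q * (real q * \<bar>\<delta>\<bar>)"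
      using FR[of c] by simp
  qed
  also have "\<dots> = (\<Sum>c<b. \<bar>R (Suc c) - R c\<bar>) + real b * \<bar>\<theta>\<bar>"
    by (simp add: sum.distrib \<theta> abs_mult power2_eq_square)
  also have "\<dots> \<le> (1 + 1) + 1"
    using floor_variation[of "real q * y" \<theta> b] \<theta>(3)
    by (intro add_mono) (auto simp: Rdiff qz abs_mult)
  finally have "\<bar>(\<Sum>n=1..b * q. saw (y + real n * \<alpha>)) - (\<Sum>c<b. saw (real q * y + real c * \<theta>))\<bar> \<le> 3"
    using eq by (simp add: qz)
  moreover note saw_sum_bern[OF \<theta>(2,3), of "real q * y"]
  ultimately show ?thesis by linarith
qed

text \<open>The drift away from the rational rotation costs at most
  \<open>L \<bar>\<theta>\<bar>\<close> per block, hence \<open>L\<close> altogether; what is left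
  of each block is a complete equally spaced sum with error \<open>V / q\<close>.\<close>

lemma Lipschitz_block:
  fixes p q b :: nat and f0 :: "real \<Rightarrow> real"
  assumes pq: "coprime p q" "q \<ge> 1" and \<alpha>: "\<alpha> = real p / real q + \<delta>"
    and \<theta>: "\<theta> = (real q)\<^sup>2 * \<delta>" "real b * \<bar>\<theta>\<bar> \<le> 1"
    and per: "\<And>x. f0 (x + 1) = f0 x" and lip: "\<And>x y. \<bar>f0 x - f0 y\<bar> \<le> L * \<bar>x - y\<bar>"
    and V: "\<And>x. \<bar>(\<Sum>j<q. f0 (x + real j / real q)) - real q * c0\<bar> \<le> V / real q"
  shows "\<bar>(\<Sum>n=1..b * q. f0 (y + real n * \<alpha>)) - real (b * q) * c0\<bar> \<le> L + real b * V / real q"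
proof -
  have L: "L \<ge> 0" using lip[of 0 1] by (metis abs_ge_zero abs_minus_commute abs_one diff_zero dual_order.trans mult.right_neutral)
  define z where "z = (\<lambda>c. y + real c * (real q * \<delta>))"
  define u where "u = (\<lambda>c n. z c + real n * (real p / real q))"
  have su: "(\<Sum>n=1..q. f0 (u c n)) = (\<Sum>j<q. f0 (z c + real j / real q))" for c
    unfolding u_def by (rule sum_periodic_coprime[of f0, OF per pq])
  have "(\<Sum>n=1..b * q. f0 (y + real n * \<alpha>)) = (\<Sum>c<b. \<Sum>n=1..q. f0 (u c n + real n * \<delta>))"
    unfolding block_sum
  proof (intro sum.cong refl)
    fix c n
    have "y + real (c * q + n) * \<alpha> = (u c n + real n * \<delta>) + of_int (int (c * p))"
      using pq by (simp add: \<alpha> u_def z_def field_simps)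
    then show "f0 (y + real (c * q + n) * \<alpha>) = f0 (u c n + real n * \<delta>)" using periodic_int[of f0, OF per] by metis
  qed
  then have eq: "(\<Sum>n=1..b * q. f0 (y + real n * \<alpha>)) - real (b * q) * c0 =
     (\<Sum>c<b. (\<Sum>n=1..q. f0 (u c n + real n * \<delta>) - f0 (u c n)) + ((\<Sum>j<q. f0 (z c + real j / real q)) - real q * c0))"
    by (simp add: su[symmetric] sum_subtractf sum.distrib)
  have "\<bar>(\<Sum>n=1..b * q. f0 (y + real n * \<alpha>)) - real (b * q) * c0\<bar> \<le> (\<Sum>c<b. L * (real q * (real q * \<bar>\<delta>\<bar>)) + V / real q)"
    unfolding eq
  proof (rule order_trans[OF sum_abs sum_mono])
    fix c
    have "\<bar>\<Sum>n=1..q. f0 (u c n + real n * \<delta>) - f0 (u c n)\<bar> \<le> (\<Sum>n=1..q. L * (real q * \<bar>\<delta>\<bar>))"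
    proof (rule order_trans[OF sum_abs sum_mono])
      fix n assume "n \<in> {1..q}"
      then have "L * \<bar>u c n + real n * \<delta> - u c n\<bar> \<le> L * (real q * \<bar>\<delta>\<bar>)"
        using L by (intro mult_left_mono) (auto simp: abs_mult intro: mult_right_mono)
      then show "\<bar>f0 (u c n + real n * \<delta>) - f0 (u c n)\<bar> \<le> L * (real q * \<bar>\<delta>\<bar>)"
        using lip order_trans by blast
    qed
    then show "\<bar>(\<Sum>n=1..q. f0 (u c n + real n * \<delta>) - f0 (u c n)) + ((\<Sum>j<q. f0 (z c + real j / real q)) - real q * c0)\<bar>
       \<le> L * (real q * (real q * \<bar>\<delta>\<bar>)) + V / real q"
      using V[of "z c"] abs_triangle_ineq[of "\<Sum>n=1..q. f0 (u c n + real n * \<delta>) - f0 (u c n)" "(\<Sum>j<q. f0 (z c + real j / real q)) - real q * c0"]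
      by (simp add: mult_ac)
  qed
  also have "\<dots> = L * (real b * \<bar>\<theta>\<bar>) + real b * V / real q"
    by (simp add: \<theta> abs_mult power2_eq_square algebra_simps)
  also have "\<dots> \<le> L * 1 + real b * V / real q"
    using L \<theta> by (intro add_mono mult_left_mono) auto
  finally show ?thesis by simp
qed

text \<open>Splitting at an exceptional point leaves fewer of them inside either half. Without any,
  the mean value theorem applies, and by continuity the estimates on the halves add up.\<close>

lemma Lipschitz_finite_exceptions:
  fixes f :: "real \<Rightarrow> real"
  assumes "finite S" "a \<le> b" "continuous_on {a..b} f"
    and "\<And>x. x \<in> {a<..<b} - S \<Longrightarrow> \<exists>D. (f has_real_derivative D) (at x) \<and> \<bar>D\<bar> \<le> K"
  shows "\<bar>f b - f a\<bar> \<le> K * (b - a)"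
  using assms
proof (induction "card (S \<inter> {a<..<b})" arbitrary: a b rule: less_induct)
  case less
  show ?case
  proof (cases "S \<inter> {a<..<b} = {}")
    case True
    show ?thesis
    proof (cases "a = b")
      case False
      then have ab: "a < b" using less by simp
      have d: "\<exists>D. (f has_real_derivative D) (at x) \<and> \<bar>D\<bar> \<le> K" if "a < x" "x < b" for x
      proof -
        have "x \<in> {a<..<b} - S" using True that by auto
        then show ?thesis by (rule less.prems(4))
      qed
      then obtain f' where f': "\<And>x. a < x \<Longrightarrow> x < b \<Longrightarrow> (f has_real_derivative f' x) (at x) \<and> \<bar>f' x\<bar> \<le> K" by metis
      obtain z where z: "a < z" "z < b" "f b - f a = (b - a) * f' z"
        using mvt[OF ab less.prems(3), of "\<lambda>x h. f' x * h"] f'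
        by (metis has_field_derivative_imp_has_derivative mult.commute)
      then have "\<bar>f b - f a\<bar> = (b - a) * \<bar>f' z\<bar>" using ab by (simp add: abs_mult)
      also have "\<dots> \<le> (b - a) * K" using f' z ab by (intro mult_left_mono) auto
      finally show ?thesis by (simp add: mult.commute)
    qed simp
  next
    case False
    then obtain s where s: "s \<in> S" "a < s" "s < b" by auto
    have "card (S \<inter> {a<..<s}) < card (S \<inter> {a<..<b})" "card (S \<inter> {s<..<b}) < card (S \<inter> {a<..<b})"
      using less.prems(1) s by (intro psubset_card_mono; force)+
    note IH = less.hyps[OF this(1)] less.hyps[OF this(2)]
    have "\<bar>f s - f a\<bar> \<le> K * (s - a)"
      using less.prems s by (intro IH) (auto intro: continuous_on_subset)
    moreover have "\<bar>f b - f s\<bar> \<le> K * (b - s)"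
      using less.prems s by (intro IH) (auto intro: continuous_on_subset)
    ultimately have "\<bar>f b - f a\<bar> \<le> K * (s - a) + K * (b - s)" by linarith
    then show ?thesis by (simp add: algebra_simps)
  qed
qed

text \<open>A bounded derivative makes \<open>f\<close> Lipschitz on the open interval, hence
  uniformly continuous and extendable to the endpoints.\<close>

lemma one_sided_limits:
  fixes f :: "real \<Rightarrow> real"
  assumes ab: "a < b" and d: "\<And>x. x \<in> {a<..<b} \<Longrightarrow> \<exists>D. (f has_real_derivative D) (at x) \<and> \<bar>D\<bar> \<le> K"
  shows "\<exists>l. (f \<longlongrightarrow> l) (at_right a)" "\<exists>l. (f \<longlongrightarrow> l) (at_left b)"
proof -
  have K: "K \<ge> 0" using d[of "(a + b) / 2"] ab by force
  have lip: "\<bar>f y - f x\<bar> \<le> K * \<bar>y - x\<bar>" if "x \<in> {a<..<b}" "y \<in> {a<..<b}" for x y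
  proof -
    have *: "\<bar>f y - f x\<bar> \<le> K * (y - x)" if "x \<in> {a<..<b}" "y \<in> {a<..<b}" "x \<le> y" for x y
    proof (rule Lipschitz_finite_exceptions[of "{}"])
      show "continuous_on {x..y} f"
        using d that by (intro continuous_at_imp_continuous_on ballI)
          (metis DERIV_isCont atLeastAtMost_iff greaterThanLessThan_iff less_le_trans le_less_trans)
    qed (use that d in auto)
    show ?thesis using *[of x y] *[of y x] that by (cases "x \<le> y") (auto simp: abs_minus_commute)
  qed
  have uc: "uniformly_continuous_on {a<..<b} f"
  proof (rule lipschitz_on_uniformly_continuous)
    show "K-lipschitz_on {a<..<b} f"
      using lip K by (intro lipschitz_onI) (auto simp: dist_real_def)
  qed
  have "a \<in> closure {a<..<b}" "b \<in> closure {a<..<b}" using ab by auto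
  then obtain l l' where "(f \<longlongrightarrow> l) (at a within {a<..<b})" "(f \<longlongrightarrow> l') (at b within {a<..<b})"
    using uniformly_continuous_on_extension_at_closure[OF uc] by metis
  then show "\<exists>l. (f \<longlongrightarrow> l) (at_right a)" "\<exists>l. (f \<longlongrightarrow> l) (at_left b)"
  proof -
    have "at a within {a<..<b} = at_right a" by (rule at_within_nhd[of _ "{..<b}"]) (use ab in auto)
    moreover have "at b within {a<..<b} = at_left b" by (rule at_within_nhd[of _ "{a<..}"]) (use ab in auto)
    ultimately show "\<exists>l. (f \<longlongrightarrow> l) (at_right a)" "\<exists>l. (f \<longlongrightarrow> l) (at_left b)"
      using \<open>(f \<longlongrightarrow> l) (at a within {a<..<b})\<close> \<open>(f \<longlongrightarrow> l') (at b within {a<..<b})\<close> by auto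
  qed
qed

section \<open>Calculus of \<open>saw\<close> and \<open>bern\<close>\<close>

lemma floor_eventually_const:
  fixes x :: real assumes "x \<notin> \<int>" shows "eventually (\<lambda>y. \<lfloor>y\<rfloor> = \<lfloor>x\<rfloor>) (nhds x)"
proof -
  have "of_int \<lfloor>x\<rfloor> < x" "x < of_int \<lfloor>x\<rfloor> + 1"
    using assms by (metis Ints_of_int floor_correct less_le, simp)
  then have "eventually (\<lambda>y. y \<in> {of_int \<lfloor>x\<rfloor><..<of_int \<lfloor>x\<rfloor> + 1}) (nhds x)"
    by (intro eventually_nhds_in_open) auto
  then show ?thesis by eventually_elim (simp add: floor_eq_iff)
qed

lemma saw_deriv: assumes "x \<notin> \<int>" shows "(saw has_real_derivative -1) (at x)"
proof -
  have "eventually (\<lambda>y. saw y = 1/2 - y + \<lfloor>x\<rfloor>) (nhds x)"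
    using floor_eventually_const[OF assms] by eventually_elim (simp add: saw_floor)
  moreover have "((\<lambda>y. 1/2 - y + \<lfloor>x\<rfloor>) has_real_derivative -1) (at x)"
    by (auto intro!: derivative_eq_intros)
  ultimately show ?thesis by (subst DERIV_cong_ev[OF refl _ refl]) auto
qed

lemma bern_deriv: assumes "x \<notin> \<int>" shows "(bern has_real_derivative saw x) (at x)"
proof -
  have "eventually (\<lambda>y. bern y = (y - \<lfloor>x\<rfloor>) * (1 - (y - \<lfloor>x\<rfloor>)) / 2) (nhds x)"
    using floor_eventually_const[OF assms] by eventually_elim (simp add: bern_def frac_def)
  moreover have "((\<lambda>y. (y - \<lfloor>x\<rfloor>) * (1 - (y - \<lfloor>x\<rfloor>)) / 2) has_real_derivative saw x) (at x)"
    by (auto intro!: derivative_eq_intros simp: saw_floor field_simps)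
  ultimately show ?thesis by (subst DERIV_cong_ev[OF refl _ refl]) auto
qed

lemma continuous_on_bern: "continuous_on S bern"
proof (rule lipschitz_on_continuous_on)
  show "1-lipschitz_on S bern" using bern_Lipschitz by (intro lipschitz_onI) (auto simp: dist_real_def)
qed

lemma saw_at_right_0: "(saw \<longlongrightarrow> 1/2) (at_right 0)"
proof -
  have "eventually (\<lambda>y. saw y = 1/2 - y) (at_right 0)"
    unfolding eventually_at_right_field by (intro exI[of _ 1]) (auto simp: saw_def frac_eq)
  moreover have "((\<lambda>y::real. 1/2 - y) \<longlongrightarrow> 1/2 - 0) (at_right 0)" by (intro tendsto_intros)
  ultimately show ?thesis by (simp add: tendsto_cong)
qed

lemma saw_integral:
  assumes "0 \<le> p" "p < 1" shows "((\<lambda>z. saw (z - p)) has_integral 0) {0..1}"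
proof -
  have "((\<lambda>z. saw (z - p)) has_integral bern (1 - p) - bern (0 - p)) {0..1}"
  proof (rule fundamental_theorem_of_calculus_interior_strong[of "{p}"])
    show "continuous_on {0..1} (\<lambda>z. bern (z - p))"
      by (intro continuous_on_compose2[OF continuous_on_bern[of UNIV]] continuous_intros) auto
    fix x assume x: "x \<in> {0<..<1} - {p}"
    have "x - p \<notin> \<int>"
    proof
      assume "x - p \<in> \<int>"
      then obtain k where k: "x - p = of_int k" by (auto elim: Ints_cases)
      then have "of_int k > (-1::real)" "of_int k < (1::real)" using x assms by auto
      then have "k = 0" by linarith
      then show False using k x by simp
    qed
    then have "((\<lambda>z. bern (z - p)) has_real_derivative saw (x - p) * 1) (at x)"
      by (intro DERIV_chain2[OF bern_deriv]) (auto intro!: derivative_eq_intros)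
    then show "((\<lambda>z. bern (z - p)) has_vector_derivative saw (x - p)) (at x)"
      by (simp add: has_real_derivative_iff_has_vector_derivative)
  qed auto
  moreover have "bern (1 - p) = bern (0 - p)" using bern_periodic(2)[of "- p"] by (simp add: add.commute)
  ultimately show ?thesis by simp
qed

lemma integral_periodic_shift:
  fixes f :: "real \<Rightarrow> real"
  assumes c: "continuous_on UNIV f" and per: "\<And>x. f (x + 1) = f x" and a: "0 \<le> a" "a \<le> 1"
  shows "integral {0..1} (\<lambda>x. f (x + a)) = integral {0..1} f"
proof -
  have int: "f integrable_on {u..v}" for u v
    by (intro integrable_continuous_interval continuous_on_subset[OF c]) auto
  have "integral {0..1} (\<lambda>x. f (x + a)) = integral {a..a + 1} f"
    using integral_shift_Icc_real[of 0 1 f a] by (simp add: o_def add.commute)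
  also have "\<dots> = integral {a..1} f + integral {1..a + 1} f"
    using Henstock_Kurzweil_Integration.integral_combine[of a 1 "a + 1" f] a int by simp
  also have "integral {1..a + 1} f = integral {0..a} (\<lambda>x. f (x + 1))"
    using integral_shift_Icc_real[of 0 a f 1] by (simp add: o_def add.commute)
  also have "\<dots> = integral {0..a} f" by (simp add: per)
  also have "integral {a..1} f + integral {0..a} f = integral {0..1} f"
    using Henstock_Kurzweil_Integration.integral_combine[of 0 a 1 f] a int by simp
  finally show ?thesis .
qed

section \<open>Riemann sums when the derivative has bounded variation\<close>

lemma sum_even_le: "(\<And>i. a i \<ge> (0::real)) \<Longrightarrow> (\<Sum>j<n. a (2 * j)) \<le> (\<Sum>i<2 * n. a i)" for n :: nat
proof (induction n)
  case (Suc n)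
  have "(\<Sum>i<2 * Suc n. a i) = (\<Sum>i<2 * n. a i) + a (2 * n) + a (Suc (2 * n))" by simp
  then show ?case using Suc.IH[OF Suc.prems] Suc.prems[of "Suc (2 * n)"] by simp
qed simp

text \<open>Merging the points into one increasing sequence
  \<open>y 0, \<xi> 0, y 1, \<xi> 1, ...\<close> makes the left side every other increment of a
  variation sum.\<close>

lemma bounded_variation_interlaced:
  assumes "\<And>(n::nat) (t::nat \<Rightarrow> real). (\<forall>i\<le>n. t i \<in> S) \<Longrightarrow> (\<forall>i<n. t i \<le> t (Suc i)) \<Longrightarrow>
        (\<Sum>i<n. \<bar>g (t (Suc i)) - g (t i)\<bar>) \<le> B"
    and y: "\<And>j. j \<le> n \<Longrightarrow> y j \<in> S" and \<xi>: "\<And>j. j < n \<Longrightarrow> \<xi> j \<in> S \<and> y j \<le> \<xi> j \<and> \<xi> j \<le> y (Suc j)"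
  shows "(\<Sum>j<n. \<bar>g (\<xi> j) - g (y j)\<bar>) \<le> (B::real)"
proof -
  define t where "t = (\<lambda>i. if even i then y (i div 2) else \<xi> (i div 2))"
  let ?a = "\<lambda>i. \<bar>g (t (Suc i)) - g (t i)\<bar>"
  have "(\<Sum>j<n. \<bar>g (\<xi> j) - g (y j)\<bar>) = (\<Sum>j<n. ?a (2 * j))" by (simp add: t_def)
  also have "\<dots> \<le> (\<Sum>i<2 * n. ?a i)" by (rule sum_even_le) simp
  also have "\<dots> \<le> B"
  proof (rule assms(1))
    show "\<forall>i\<le>2 * n. t i \<in> S"
    proof (intro allI impI)
      fix i assume i: "i \<le> 2 * n"
      show "t i \<in> S"
      proof (cases "even i")
        case True then show ?thesis using i y by (auto simp: t_def)
      next
        case False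
        then have "i div 2 < n" using i by (auto elim!: oddE)
        then show ?thesis using False \<xi> by (auto simp: t_def)
      qed
    qed
    show "\<forall>i<2 * n. t i \<le> t (Suc i)"
    proof (intro allI impI)
      fix i assume i: "i < 2 * n"
      then have "i div 2 < n" by auto
      then show "t i \<le> t (Suc i)" using \<xi>[of "i div 2"] by (auto simp: t_def elim!: oddE)
    qed
  qed
  finally show ?thesis .
qed

text \<open>The bound is independent of \<open>q\<close>. By the mean value theorem \<open>q\<close>
  times an increment of \<open>h\<close> is a value of \<open>G\<close> between neighbouring points.
  Exchanging this value for \<open>G (y j)\<close> costs the variation \<open>B\<close>, and the
  increments of \<open>h\<close> telescope. Intervals containing a point of \<open>P\<close> cost
  \<open>2 K\<close> each, and there are at most \<open>card P\<close> of them.\<close>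

lemma Riemann_derivative_bound:
  fixes h G :: "real \<Rightarrow> real"
  assumes per: "\<And>x. h (x + 1) = h x" and cont: "continuous_on UNIV h"
    and P: "finite P" and der: "\<And>z. z \<in> {0<..<1} - P \<Longrightarrow> (h has_real_derivative G z) (at z)"
    and K: "\<And>z. z \<in> {0..<1} \<Longrightarrow> \<bar>G z\<bar> \<le> K"
    and B: "\<And>(n::nat) (t::nat \<Rightarrow> real). (\<forall>i\<le>n. t i \<in> {0..<1}) \<Longrightarrow> (\<forall>i<n. t i \<le> t (Suc i)) \<Longrightarrow>
        (\<Sum>i<n. \<bar>G (t (Suc i)) - G (t i)\<bar>) \<le> B"
    and q: "q \<ge> 1" and x: "0 < x" "x < 1 / real q" "\<And>j. j < q \<Longrightarrow> x + real j / real q \<notin> P"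
  shows "\<bar>\<Sum>j<q. G (x + real j / real q)\<bar> \<le> 2 * K + B + 2 * K * card P"
proof -
  have K0: "K \<ge> 0" using K[of 0] by simp
  have lip: "\<bar>h b - h a\<bar> \<le> K * (b - a)" if "0 \<le> a" "a \<le> b" "b \<le> 1" for a b
  proof (rule Lipschitz_finite_exceptions[OF P that(2)])
    show "continuous_on {a..b} h" by (rule continuous_on_subset[OF cont]) simp
    fix z assume "z \<in> {a<..<b} - P"
    then have z: "z \<in> {0<..<1} - P" using that by auto
    show "\<exists>D. (h has_real_derivative D) (at z) \<and> \<bar>D\<bar> \<le> K" using der[OF z] K[of z] z by auto
  qed
  define y where "y = (\<lambda>j. x + real j / real q)"
  have y01: "0 < y j" "y j < 1" if "j < q" for j
  proof -
    show "0 < y j" using x q by (simp add: y_def add_pos_nonneg)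
    have "real j + 1 \<le> real q" using that by simp
    then have "(real j + 1) / real q \<le> 1" using q by simp
    then show "y j < 1" using x by (simp add: y_def add_divide_distrib)
  qed
  have yS: "y (Suc j) = y j + 1 / real q" for j by (simp add: y_def add_divide_distrib)
  \<comment> \<open>The last of the \<open>q\<close> points has no successor in the unit interval;
    its value of \<open>G\<close> is estimated by \<open>K\<close> separately.\<close>
  define n where "n = q - 1"
  have nq: "q = Suc n" using q by (simp add: n_def)
  define bad where "bad = (\<lambda>j. \<exists>p\<in>P. y j < p \<and> p < y (Suc j))"
  have "\<exists>\<xi>. \<xi> \<in> {0..<1} \<and> y j \<le> \<xi> \<and> \<xi> \<le> y (Suc j) \<and> \<bar>real q * (h (y (Suc j)) - h (y j)) - G \<xi>\<bar> \<le> (if bad j then 2 * K else 0)"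
    if j: "j < n" for j
  proof -
    have yj: "0 < y j" "y (Suc j) < 1" "y j < y (Suc j)" using y01[of j] y01[of "Suc j"] j nq q by (auto simp: yS)
    show ?thesis
    proof (cases "bad j")
      case True
      have "\<bar>real q * (h (y (Suc j)) - h (y j))\<bar> \<le> real q * (K * (y (Suc j) - y j))"
        using lip[of "y j" "y (Suc j)"] yj by (simp add: abs_mult mult_left_mono)
      also have "\<dots> = K" using q by (simp add: yS)
      finally show ?thesis using True K[of "y j"] yj by (intro exI[of _ "y j"]) auto
    next
      case False
      have "(h has_real_derivative G z) (at z)" if "y j < z" "z < y (Suc j)" for z
        using False that yj by (intro der) (auto simp: bad_def)
      then obtain \<xi> where \<xi>: "y j < \<xi>" "\<xi> < y (Suc j)" "h (y (Suc j)) - h (y j) = G \<xi> * (y (Suc j) - y j)"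
        using mvt[OF yj(3), of h "\<lambda>z d. G z * d"] continuous_on_subset[OF cont]
        by (metis has_field_derivative_imp_has_derivative top_greatest)
      then have "real q * (h (y (Suc j)) - h (y j)) = G \<xi>" using q by (simp add: yS)
      then show ?thesis using \<xi> yj False by (intro exI[of _ \<xi>]) auto
    qed
  qed
  then obtain \<xi> where \<xi>: "\<And>j. j < n \<Longrightarrow> \<xi> j \<in> {0..<1} \<and> y j \<le> \<xi> j \<and> \<xi> j \<le> y (Suc j) \<and>
     \<bar>real q * (h (y (Suc j)) - h (y j)) - G (\<xi> j)\<bar> \<le> (if bad j then 2 * K else 0)" by metis
  have 1: "(\<Sum>j<n. \<bar>G (\<xi> j) - G (y j)\<bar>) \<le> B"
    using bounded_variation_interlaced[of "{0..<1}" G B n y \<xi>, OF B] y01 \<xi> nq by (auto simp: less_imp_le)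
  have 2: "(\<Sum>j<n. \<bar>real q * (h (y (Suc j)) - h (y j)) - G (\<xi> j)\<bar>) \<le> 2 * K * card P"
  proof -
    have "\<forall>j. bad j \<longrightarrow> (\<exists>p. p \<in> P \<and> y j < p \<and> p < y (Suc j))" by (auto simp: bad_def)
    then obtain c where c: "\<And>j. bad j \<Longrightarrow> c j \<in> P \<and> y j < c j \<and> c j < y (Suc j)" by metis
    have "c i \<noteq> c j" if "bad i" "bad j" "i < j" for i j
    proof -
      have "real (Suc i) \<le> real j" using that by simp
      then have "y (Suc i) \<le> y j" using q unfolding y_def by (intro add_left_mono divide_right_mono) auto
      then show ?thesis using c[OF that(1)] c[OF that(2)] by linarith
    qed
    then have "inj_on c {j \<in> {..<n}. bad j}" by (intro linorder_inj_onI) auto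
    then have "card {j \<in> {..<n}. bad j} \<le> card P" using c P by (intro card_inj_on_le[of c]) auto
    then have "2 * K * card {j \<in> {..<n}. bad j} \<le> 2 * K * card P" using K0 by (intro mult_left_mono) auto
    moreover have "(\<Sum>j<n. \<bar>real q * (h (y (Suc j)) - h (y j)) - G (\<xi> j)\<bar>) \<le> (\<Sum>j<n. if bad j then 2 * K else 0)"
      using \<xi> by (intro sum_mono) auto
    moreover have "(\<Sum>j<n. if bad j then 2 * K else 0) = 2 * K * card {j \<in> {..<n}. bad j}"
      by (simp add: sum.If_cases Int_def)
    ultimately show ?thesis by linarith
  qed
  \<comment> \<open>By periodicity the telescoped increment equals, up to sign, the increment over
    the complementary arc of length \<open>1 / q\<close>, which cancels the factor
    \<open>q\<close>.\<close>
  have 3: "\<bar>\<Sum>j<n. real q * (h (y (Suc j)) - h (y j))\<bar> \<le> K"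
  proof -
    have "(\<Sum>j<n. real q * (h (y (Suc j)) - h (y j))) = real q * (h (y n) - h (y 0))"
      unfolding sum_distrib_left[symmetric] using sum_lessThan_telescope[of "\<lambda>j. h (y j)" n] by simp
    moreover have "h 1 = h 0" using per[of 0] by simp
    moreover have "\<bar>h 1 - h (y n)\<bar> \<le> K * (1 - y n)" "\<bar>h (y 0) - h 0\<bar> \<le> K * (y 0 - 0)"
      using y01[of n] y01[of 0] nq by (intro lip; simp)+
    moreover have "y 0 - 0 + (1 - y n) = 1 / real q" using q by (simp add: y_def nq field_simps)
    ultimately have "\<bar>h (y n) - h (y 0)\<bar> \<le> K * (1 / real q)"
      by (smt (verit) distrib_left)
    then have "real q * \<bar>h (y n) - h (y 0)\<bar> \<le> real q * (K * (1 / real q))" by (intro mult_left_mono) auto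
    then show ?thesis
      using q \<open>(\<Sum>j<n. real q * (h (y (Suc j)) - h (y j))) = real q * (h (y n) - h (y 0))\<close> by (simp add: abs_mult)
  qed
  have "(\<Sum>j<q. G (x + real j / real q)) = (\<Sum>j<n. real q * (h (y (Suc j)) - h (y j)))
     - (\<Sum>j<n. real q * (h (y (Suc j)) - h (y j)) - G (\<xi> j)) - (\<Sum>j<n. G (\<xi> j) - G (y j)) + G (y n)"
    by (simp add: nq y_def sum_subtractf)
  moreover have "\<bar>G (y n)\<bar> \<le> K" using K[of "y n"] y01[of n] nq by simp
  moreover have "\<bar>\<Sum>j<n. real q * (h (y (Suc j)) - h (y j)) - G (\<xi> j)\<bar> \<le> 2 * K * card P"
    by (rule order_trans[OF sum_abs 2])
  moreover have "\<bar>\<Sum>j<n. G (\<xi> j) - G (y j)\<bar> \<le> B" by (rule order_trans[OF sum_abs 1])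
  ultimately show ?thesis using 3 by linarith
qed

text \<open>As a function of \<open>x\<close> the sum has period \<open>1 / q\<close> and, by the
  preceding bound, a Lipschitz constant independent of \<open>q\<close>. It thus varies by
  \<open>O(1 / q)\<close>, and its mean is \<open>q\<close> times the integral of
  \<open>h\<close>.\<close>

lemma Riemann_sum_bound:
  fixes h G :: "real \<Rightarrow> real"
  assumes per: "\<And>x. h (x + 1) = h x" and cont: "continuous_on UNIV h"
    and P: "finite P" and der: "\<And>z. z \<in> {0<..<1} - P \<Longrightarrow> (h has_real_derivative G z) (at z)"
    and K: "\<And>z. z \<in> {0..<1} \<Longrightarrow> \<bar>G z\<bar> \<le> K"
    and B: "\<And>(n::nat) (t::nat \<Rightarrow> real). (\<forall>i\<le>n. t i \<in> {0..<1}) \<Longrightarrow> (\<forall>i<n. t i \<le> t (Suc i)) \<Longrightarrow>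
        (\<Sum>i<n. \<bar>G (t (Suc i)) - G (t i)\<bar>) \<le> B"
    and q: "q \<ge> 1"
  shows "\<bar>(\<Sum>j<q. h (x + real j / real q)) - real q * integral {0..1} h\<bar> \<le> (2 * K + B + 2 * K * card P) / real q"
proof -
  define V where "V = 2 * K + B + 2 * K * card P"
  define F where "F = (\<lambda>x. \<Sum>j<q. h (x + real j / real q))"
  have contF: "continuous_on S F" for S
    unfolding F_def by (intro continuous_intros continuous_on_compose2[OF cont]) auto
  have F1: "\<bar>F b - F a\<bar> \<le> V * (b - a)" if "0 \<le> a" "a \<le> b" "b \<le> 1 / real q" for a b
  proof (rule Lipschitz_finite_exceptions[of "\<Union>j<q. (\<lambda>p. p - real j / real q) ` P"])
    fix x assume x: "x \<in> {a<..<b} - (\<Union>j<q. (\<lambda>p. p - real j / real q) ` P)"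
    have notP: "x + real j / real q \<notin> P" if "j < q" for j
    proof
      assume "x + real j / real q \<in> P"
      then have "(x + real j / real q) - real j / real q \<in> (\<lambda>p. p - real j / real q) ` P" by (rule imageI)
      then show False using x that by auto
    qed
    have x01: "0 < x" "x < 1 / real q" using x that by auto
    have "(h has_real_derivative G (x + real j / real q)) (at (x + real j / real q))" if "j < q" for j
    proof (rule der)
      have "real j + 1 \<le> real q" using that by simp
      then have "(real j + 1) / real q \<le> 1" using q by simp
      then have "x + real j / real q < 1" using x01 by (simp add: add_divide_distrib)
      then show "x + real j / real q \<in> {0<..<1} - P" using x01 notP[OF that] by (simp add: add_pos_nonneg)
    qed
    then have "((\<lambda>x. h (x + real j / real q)) has_real_derivative G (x + real j / real q) * 1) (at x)" if "j < q" for j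
      using that by (intro DERIV_chain2[of h]) (auto intro!: derivative_eq_intros)
    then have "(F has_real_derivative (\<Sum>j<q. G (x + real j / real q))) (at x)"
      unfolding F_def by (intro DERIV_sum) auto
    moreover have "\<bar>\<Sum>j<q. G (x + real j / real q)\<bar> \<le> V"
      unfolding V_def by (rule Riemann_derivative_bound[OF per cont P der K B q x01 notP])
    ultimately show "\<exists>D. (F has_real_derivative D) (at x) \<and> \<bar>D\<bar> \<le> V" by blast
  qed (use P that contF in auto)
  have V0: "V \<ge> 0"
  proof -
    have "0 \<le> V * (1 / real q - 0)" using F1[of 0 "1 / real q"] by (rule order_trans[OF abs_ge_zero]) auto
    then show ?thesis using q by (simp add: zero_le_divide_iff)
  qed
  have F2: "\<bar>F b - F a\<bar> \<le> V / real q" if ab: "a \<in> {0..1 / real q}" "b \<in> {0..1 / real q}" for a b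
  proof -
    have "V * \<bar>b - a\<bar> \<le> V * (1 / real q)" using V0 ab by (intro mult_left_mono) auto
    moreover have "\<bar>F b - F a\<bar> \<le> V * \<bar>b - a\<bar>"
      using F1[of a b] F1[of b a] ab by (cases "a \<le> b") (auto simp: abs_minus_commute)
    ultimately show ?thesis by simp
  qed
  have Fper: "F (x + 1 / real q) = F x" for x
  proof -
    have "F (x + 1 / real q) = (\<Sum>j<q. h (x + real (Suc j) / real q))"
      unfolding F_def by (intro sum.cong) (auto simp: add_divide_distrib add_ac)
    moreover have "(\<Sum>j<q. h (x + real (Suc j) / real q)) + h (x + real 0 / real q) = (\<Sum>j<Suc q. h (x + real j / real q))"
      by (subst sum.lessThan_Suc_shift) simp
    moreover have "h (x + real q / real q) = h x" using q per by simp
    ultimately show ?thesis by (simp add: F_def)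
  qed
  have Ffrac: "F x = F (frac (real q * x) / real q)" for x
  proof -
    have "(\<lambda>z. F (z / real q)) (frac (real q * x) + of_int \<lfloor>real q * x\<rfloor>) = (\<lambda>z. F (z / real q)) (frac (real q * x))"
      by (rule periodic_int) (simp add: add_divide_distrib Fper)
    moreover have "frac (real q * x) + of_int \<lfloor>real q * x\<rfloor> = real q * x" by (simp add: frac_def)
    ultimately show ?thesis using q by simp
  qed
  have in1: "frac z / real q \<in> {0..1 / real q}" for z
    using divide_right_mono[of "frac z" 1 "real q"] frac_lt_1[of z] by auto
  have F3: "\<bar>F b - F a\<bar> \<le> V / real q" for a b
    using F2[OF in1[of "real q * a"] in1[of "real q * b"]] Ffrac[of a] Ffrac[of b] by simp
  have int: "F integrable_on {0..1}" using contF by (rule integrable_continuous_interval)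
  have "integral {0..1} F = (\<Sum>j<q. integral {0..1} (\<lambda>x. h (x + real j / real q)))"
    unfolding F_def by (intro integral_sum integrable_continuous_interval continuous_on_compose2[OF cont] continuous_intros) auto
  also have "\<dots> = (\<Sum>j<q. integral {0..1} h)"
    using q by (intro sum.cong integral_periodic_shift[OF cont per]) auto
  finally have mean: "integral {0..1} F = real q * integral {0..1} h" by simp
  have b: "F y \<le> F x + V / real q" "F x - V / real q \<le> F y" for y using F3[of x y] by (simp_all add: abs_le_iff)
  have "integral {0..1} F \<le> integral {0..1} (\<lambda>_::real. F x + V / real q)" by (rule Henstock_Kurzweil_Integration.integral_le[OF int]) (use b in auto)
  moreover have "integral {0..1} (\<lambda>_::real. F x - V / real q) \<le> integral {0..1} F" by (rule Henstock_Kurzweil_Integration.integral_le[OF _ int]) (use b in auto)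
  ultimately have "\<bar>F x - integral {0..1} F\<bar> \<le> V / real q" by simp
  then show ?thesis unfolding mean by (simp add: F_def V_def)
qed

section \<open>Splitting off the jumps of the function\<close>

lemma saw_at_left: "((\<lambda>y. saw (y - z)) \<longlongrightarrow> -1/2) (at_left z)"
proof -
  have "saw (y - z) = - 1/2 - (y - z)" if "z - 1 < y" "y < z" for y
  proof -
    have "\<lfloor>y - z\<rfloor> = -1" using that by (simp add: floor_eq_iff)
    then show ?thesis by (simp add: saw_floor)
  qed
  then have "eventually (\<lambda>y. saw (y - z) = - 1/2 - (y - z)) (at_left z)"
    unfolding eventually_at_left_field by (intro exI[of _ "z - 1"]) auto
  moreover have "((\<lambda>y::real. - 1/2 - (y - z)) \<longlongrightarrow> - 1/2 - (z - z)) (at_left z)" by (intro tendsto_intros)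
  ultimately show ?thesis by (simp add: tendsto_cong)
qed

lemma not_Int_diff: "0 \<le> z \<Longrightarrow> z < 1 \<Longrightarrow> 0 \<le> p \<Longrightarrow> p < 1 \<Longrightarrow> z \<noteq> p \<Longrightarrow> z - p \<notin> \<int>" for z p :: real
proof
  assume *: "0 \<le> z" "z < 1" "0 \<le> p" "p < 1" "z \<noteq> p" "z - p \<in> \<int>"
  then obtain k where k: "z - p = of_int k" by (auto elim: Ints_cases)
  then have "of_int k > (-1::real)" "of_int k < (1::real)" using * by auto
  then have "k = 0" by linarith
  with k have "z = p" by simp
  then show False using * by simp
qed

lemma finite_frac_preimage:
  assumes "finite P" shows "finite {z \<in> {a..b}. frac z \<in> P}"
proof -
  have "{z \<in> {a..b}. frac z \<in> P} \<subseteq> (\<lambda>(n, p). of_int n + p) ` ({\<lfloor>a\<rfloor>..\<lfloor>b\<rfloor>} \<times> P)"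
  proof
    fix z assume z: "z \<in> {z \<in> {a..b}. frac z \<in> P}"
    then show "z \<in> (\<lambda>(n, p). of_int n + p) ` ({\<lfloor>a\<rfloor>..\<lfloor>b\<rfloor>} \<times> P)"
      by (intro image_eqI[of _ _ "(\<lfloor>z\<rfloor>, frac z)"]) (auto simp: frac_def floor_mono)
  qed
  then show ?thesis using assms by (meson finite_SigmaI finite_atLeastAtMost_int finite_imageI finite_subset)
qed

lemma eventually_frac_notin:
  fixes z :: real
  assumes "finite P" shows "eventually (\<lambda>y. frac y \<notin> P) (at z)"
proof -
  define S where "S = {y \<in> {z - 1..z + 1}. frac y \<in> P} - {z}"
  have "finite S" unfolding S_def using finite_frac_preimage[OF assms] by blast
  then have "closed S" by (rule finite_imp_closed)
  then have "open (- S)" by (rule open_Compl)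
  then have "eventually (\<lambda>y. y \<in> - S) (nhds z)" by (intro eventually_nhds_in_open) (auto simp: S_def)
  moreover have "eventually (\<lambda>y. y \<in> {z - 1<..<z + 1}) (nhds z)" by (intro eventually_nhds_in_open) auto
  ultimately have "eventually (\<lambda>y. y \<notin> S \<and> y \<in> {z - 1<..<z + 1}) (nhds z)" by eventually_elim auto
  then show ?thesis unfolding eventually_at_filter by eventually_elim (auto simp: S_def)
qed

lemma has_derivative_frac:
  fixes f :: "real \<Rightarrow> real"
  assumes per: "\<And>x. f (x + 1) = f x" and d: "(f has_real_derivative D) (at (frac z))"
  shows "(f has_real_derivative D) (at z)"
proof -
  have "(\<lambda>x. f (x - of_int \<lfloor>z\<rfloor>)) = f"
    using periodic_int[of f "_ - of_int \<lfloor>z\<rfloor>" "\<lfloor>z\<rfloor>", OF per] by (intro ext) simp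
  moreover have "((\<lambda>x. f (x - of_int \<lfloor>z\<rfloor>)) has_real_derivative D * 1) (at z)"
    using d by (intro DERIV_chain2[of f]) (auto intro!: derivative_eq_intros simp: frac_def)
  ultimately show ?thesis by simp
qed

text \<open>With \<open>L p\<close> the jump of \<open>f\<close> at \<open>p\<close>, subtracting
  the sawtooth functions leaves removable discontinuities only. \<open>f0\<close> fills them in, so
  the identity with \<open>f\<close> is claimed off the rationals. The sawtooth functions have mean
  zero, hence \<open>f\<close> and \<open>f0\<close> have the same integral.\<close>

lemma pw_smooth_decomposition:
  assumes pw: "pw_smooth_rat_disc f"
  shows "\<exists>(P :: real set) L f0 Lip V p0. finite P \<and> P \<subseteq> \<rat> \<inter> {0..<1} \<and> p0 \<in> P \<and> L p0 \<noteq> 0 \<and>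
    (\<forall>z. z \<notin> \<rat> \<longrightarrow> f z = (\<Sum>p\<in>P. L p * saw (z - p)) + f0 z) \<and>
    (\<forall>x. f0 (x + 1) = f0 x) \<and> (\<forall>x y. \<bar>f0 x - f0 y\<bar> \<le> Lip * \<bar>x - y\<bar>) \<and>
    (\<forall>x q. q \<ge> 1 \<longrightarrow> \<bar>(\<Sum>j<q. f0 (x + real j / real q)) - real q * integral {0..1} f\<bar> \<le> V / real q)"
proof -
  from pw have per: "\<And>x. f (x + 1) = f x" by (simp add: pw_smooth_rat_disc_def)
  from pw obtain xs g x0 J0 where xs: "xs \<noteq> []" "set xs \<subseteq> \<rat> \<inter> {0..<1}"
    and bv: "bounded_variation_on g {0..<1}"
    and der: "\<And>x. x \<in> {0..<1} - set xs \<Longrightarrow> (f has_real_derivative g x) (at x within {0..<1})"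
    and x0: "x0 \<in> set xs" "J0 \<noteq> 0" "((\<lambda>\<delta>. f (x0 - \<delta>) - f (x0 + \<delta>)) \<longlongrightarrow> J0) (at_right 0)"
    unfolding pw_smooth_rat_disc_def by blast
  \<comment> \<open>Differentiability at \<open>0\<close> within the half-open interval is
    one-sided, so the periodic function may jump there and \<open>0\<close> is treated as a possible
    jump.\<close>
  define P where "P = insert 0 (set xs)"
  have P: "finite P" "P \<subseteq> \<rat> \<inter> {0..<1}" "0 \<in> P" using xs by (auto simp: P_def)
  from bv obtain Bv where Bv: "\<And>(n::nat) (t::nat \<Rightarrow> real). (\<forall>i\<le>n. t i \<in> {0..<1}) \<Longrightarrow> (\<forall>i<n. t i \<le> t (Suc i)) \<Longrightarrow>
        (\<Sum>i<n. \<bar>g (t (Suc i)) - g (t i)\<bar>) \<le> Bv"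
    unfolding bounded_variation_on_def by blast
  define K where "K = \<bar>g 0\<bar> + Bv"
  have K: "\<bar>g z\<bar> \<le> K" if "z \<in> {0..<1}" for z
  proof -
    have "(\<Sum>i<(1::nat). \<bar>g (if Suc i = 0 then 0 else z) - g (if i = 0 then 0 else z)\<bar>) \<le> Bv"
      using that by (intro Bv) auto
    then show ?thesis by (simp add: K_def)
  qed
  have fder: "(f has_real_derivative g (frac z)) (at z)" if "frac z \<notin> P" for z
  proof (rule has_derivative_frac[where f = f, OF per])
    have z: "frac z \<in> {0<..<1}" using that P(3) frac_lt_1[of z] frac_ge_0[of z] by (metis greaterThanLessThan_iff less_le)
    have "(f has_real_derivative g (frac z)) (at (frac z) within {0<..<1})"
      using that z by (intro DERIV_subset[OF der]) (auto simp: P_def)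
    then show "(f has_real_derivative g (frac z)) (at (frac z))"
      by (simp only: at_within_open[OF z open_greaterThanLessThan])
  qed
  have lims: "\<exists>l. (f \<longlongrightarrow> l) (at_right z)" "\<exists>l. (f \<longlongrightarrow> l) (at_left z)" for z
  proof -
    obtain e where e: "e > 0" "\<And>y. y \<noteq> z \<Longrightarrow> dist y z < e \<Longrightarrow> frac y \<notin> P"
      using eventually_frac_notin[OF P(1), of z] by (auto simp: eventually_at)
    have d: "\<exists>D. (f has_real_derivative D) (at y) \<and> \<bar>D\<bar> \<le> K" if "y \<noteq> z" "dist y z < e" for y
      using fder[OF e(2)[OF that]] K[of "frac y"] frac_lt_1[of y] by (intro exI[of _ "g (frac y)"]) auto
    show "\<exists>l. (f \<longlongrightarrow> l) (at_right z)"
      by (rule one_sided_limits(1)[of z "z + e" f K]) (use e d in \<open>auto simp: dist_real_def\<close>)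
    show "\<exists>l. (f \<longlongrightarrow> l) (at_left z)"
      by (rule one_sided_limits(2)[of "z - e" z f K]) (use e d in \<open>auto simp: dist_real_def\<close>)
  qed
  obtain fr fl where fr: "\<And>z. (f \<longlongrightarrow> fr z) (at_right z)" and fl: "\<And>z. (f \<longlongrightarrow> fl z) (at_left z)"
    using lims by metis
  define L where "L = (\<lambda>p. fr p - fl p)"
  define J where "J = (\<lambda>z. \<Sum>p\<in>P. L p * saw (z - p))"
  \<comment> \<open>Each \<open>saw\<close> has slope \<open>-1\<close>; subtracting them all adds
    this constant to the derivative and leaves its variation unchanged.\<close>
  define \<Lambda> where "\<Lambda> = (\<Sum>p\<in>P. L p)"
  define h where "h = (\<lambda>z. f z - J z)"
  have hper: "h (z + 1) = h z" for z
  proof -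
    have "saw (z + 1 - p) = saw (z - p)" for p using saw_periodic(2)[of "z - p"] by (simp add: algebra_simps)
    then show ?thesis by (simp add: h_def J_def per)
  qed
  have hder: "(h has_real_derivative g (frac z) + \<Lambda>) (at z)" if z: "frac z \<notin> P" for z
  proof -
    have "((\<lambda>z. saw (z - p)) has_real_derivative -1 * 1) (at z)" if p: "p \<in> P" for p
    proof -
      have "z - p \<notin> \<int>"
      proof
        assume "z - p \<in> \<int>"
        then have "frac z = frac p" by (metis Ints_cases add_diff_cancel_left' diff_add_cancel frac_add_int add.commute)
        moreover have "frac p = p" using p P(2) by (auto simp: frac_eq)
        ultimately show False using z p by simp
      qed
      then show ?thesis by (intro DERIV_chain2[OF saw_deriv]) (auto intro!: derivative_eq_intros)
    qed
    then have "((\<lambda>z. L p * saw (z - p)) has_real_derivative L p * (-1)) (at z)" if "p \<in> P" for p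
      using that by (intro DERIV_cmult) auto
    then have "(J has_real_derivative (\<Sum>p\<in>P. L p * (-1))) (at z)"
      unfolding J_def by (intro DERIV_sum) auto
    from DERIV_diff[OF fder[OF z] this] show ?thesis
      by (simp add: h_def \<Lambda>_def sum_negf)
  qed
  \<comment> \<open>The limit from the right, where \<open>saw (y - z)\<close> tends to
    \<open>1/2\<close>. From the left it tends to \<open>-1/2\<close>, and the difference
    \<open>L z\<close> makes up for the jump of \<open>f\<close>.\<close>
  define hl where "hl = (\<lambda>z. fr z - L z / 2 - (\<Sum>p\<in>P - {z}. L p * saw (z - p)))"
  have hlim: "(h \<longlongrightarrow> hl z) (at z)" if z: "z \<in> P" for z
  proof -
    have rest: "((\<lambda>y. \<Sum>p\<in>P - {z}. L p * saw (y - p)) \<longlongrightarrow> (\<Sum>p\<in>P - {z}. L p * saw (z - p))) (at z)"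
    proof (intro tendsto_sum tendsto_mult tendsto_const)
      fix p assume "p \<in> P - {z}"
      then have "z - p \<notin> \<int>" using P(2) z by (intro not_Int_diff) auto
      then have "((\<lambda>y. saw (y - p)) has_real_derivative -1 * 1) (at z)"
        by (intro DERIV_chain2[OF saw_deriv]) (auto intro!: derivative_eq_intros)
      then have "isCont (\<lambda>y. saw (y - p)) z" by (rule DERIV_isCont)
      then show "((\<lambda>y. saw (y - p)) \<longlongrightarrow> saw (z - p)) (at z)" by (simp add: isCont_def)
    qed
    have Jz: "J y = L z * saw (y - z) + (\<Sum>p\<in>P - {z}. L p * saw (y - p))" for y
      unfolding J_def using P(1) z by (rule sum.remove)
    have r: "((\<lambda>y. saw (y - z)) \<longlongrightarrow> 1/2) (at_right z)"
      using saw_at_right_0 filtermap_at_right_shift[of "-z" 0]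
      by (simp add: filterlim_at_right_to_0[of _ _ z])
    have l: "((\<lambda>y. saw (y - z)) \<longlongrightarrow> -1/2) (at_left z)"
      by (rule saw_at_left)
    have "((\<lambda>y. f y - (L z * saw (y - z) + (\<Sum>p\<in>P - {z}. L p * saw (y - p)))) \<longlongrightarrow> fr z - (L z * (1/2) + (\<Sum>p\<in>P - {z}. L p * saw (z - p)))) (at_right z)"
      by (intro tendsto_intros fr r tendsto_mono[OF _ rest]) (auto simp: at_le)
    then have right: "(h \<longlongrightarrow> hl z) (at_right z)" by (simp add: h_def Jz hl_def algebra_simps)
    have "((\<lambda>y. f y - (L z * saw (y - z) + (\<Sum>p\<in>P - {z}. L p * saw (y - p)))) \<longlongrightarrow> fl z - (L z * (-1/2) + (\<Sum>p\<in>P - {z}. L p * saw (z - p)))) (at_left z)"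
      by (intro tendsto_intros fl l tendsto_mono[OF _ rest]) (auto simp: at_le)
    moreover have "fl z - (L z * (-1/2) + (\<Sum>p\<in>P - {z}. L p * saw (z - p))) = hl z"
      by (simp add: hl_def L_def field_simps)
    ultimately have left: "(h \<longlongrightarrow> hl z) (at_left z)" by (simp add: h_def Jz)
    show ?thesis using left right by (simp add: filterlim_at_split)
  qed
  define f0 where "f0 = (\<lambda>z. if frac z \<in> P then hl (frac z) else h z)"
  have f0per: "f0 (z + 1) = f0 z" for z
    using frac_add_int[of z 1] by (simp add: f0_def hper)
  have f0ev: "eventually (\<lambda>y. f0 y = h y) (at z)" for z
    using eventually_frac_notin[OF P(1), of z] by eventually_elim (simp add: f0_def)
  have f0der: "(f0 has_real_derivative g (frac z) + \<Lambda>) (at z)" if z: "frac z \<notin> P" for z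
  proof -
    have "eventually (\<lambda>y. f0 y = h y) (nhds z)"
      using f0ev[of z] z unfolding eventually_at_filter by (auto elim!: eventually_mono simp: f0_def)
    then show ?thesis using hder[OF z] by (subst DERIV_cong_ev[OF refl _ refl]) auto
  qed
  have cont01: "isCont f0 z" if z: "0 \<le> z" "z < 1" for z
  proof (cases "z \<in> P")
    case True
    have "frac z = z" using z by (simp add: frac_eq)
    then have "(h \<longlongrightarrow> f0 z) (at z)" using hlim[OF True] True by (simp add: f0_def)
    then have "(f0 \<longlongrightarrow> f0 z) (at z)" using f0ev[of z] by (simp add: tendsto_cong)
    then show ?thesis by (simp add: isCont_def)
  next
    case False
    then have "frac z \<notin> P" using z by (simp add: frac_eq)
    then show ?thesis using f0der DERIV_isCont by blast
  qed
  have cont: "isCont f0 z" for z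
  proof -
    have "(\<lambda>x. f0 (x - of_int \<lfloor>z\<rfloor>)) = f0"
      using periodic_int[of f0 "_ - of_int \<lfloor>z\<rfloor>" "\<lfloor>z\<rfloor>", OF f0per] by (intro ext) simp
    moreover have "isCont (\<lambda>x. f0 (x - of_int \<lfloor>z\<rfloor>)) z"
    proof (rule isCont_o2[where g = f0])
      show "isCont f0 (z - of_int \<lfloor>z\<rfloor>)" using cont01[of "frac z"] frac_lt_1[of z] by (simp add: frac_def)
    qed auto
    ultimately show ?thesis by simp
  qed
  define K' where "K' = K + \<bar>\<Lambda>\<bar>"
  have K': "\<bar>g z + \<Lambda>\<bar> \<le> K'" if "z \<in> {0..<1}" for z using K[OF that] by (simp add: K'_def)
  have lip0: "\<bar>f0 b - f0 a\<bar> \<le> K' * (b - a)" if "a \<le> b" for a b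
  proof (rule Lipschitz_finite_exceptions[OF finite_frac_preimage[OF P(1), of a b] that])
    show "continuous_on {a..b} f0" using cont by (simp add: continuous_at_imp_continuous_on)
    fix x assume "x \<in> {a<..<b} - {z \<in> {a..b}. frac z \<in> P}"
    then show "\<exists>D. (f0 has_real_derivative D) (at x) \<and> \<bar>D\<bar> \<le> K'"
      using f0der[of x] K'[of "frac x"] frac_lt_1[of x] by (intro exI[of _ "g (frac x) + \<Lambda>"]) auto
  qed
  have lip: "\<bar>f0 x - f0 y\<bar> \<le> K' * \<bar>x - y\<bar>" for x y
    using lip0[of x y] lip0[of y x] by (cases "x \<le> y") (auto simp: abs_minus_commute)
  have f_eq: "f z = J z + f0 z" if "frac z \<notin> P" for z using that by (simp add: f0_def h_def)
  have contU: "continuous_on UNIV f0" using cont by (simp add: continuous_at_imp_continuous_on)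
  have int: "integral {0..1} f = integral {0..1} f0"
  proof -
    have J0: "(J has_integral (\<Sum>p\<in>P. L p * 0)) {0..1}"
      unfolding J_def using P by (intro has_integral_sum has_integral_mult_right saw_integral) auto
    have f0i: "(f0 has_integral integral {0..1} f0) {0..1}"
      by (intro integrable_integral integrable_continuous_interval continuous_on_subset[OF contU]) auto
    have "((\<lambda>z. J z + f0 z) has_integral integral {0..1} f0) {0..1}"
      using has_integral_add[OF J0 f0i] by simp
    then have "(f has_integral integral {0..1} f0) {0..1}"
      by (rule has_integral_spike_finite[OF finite_frac_preimage[OF P(1), of 0 1], rotated]) (auto simp: f_eq)
    then show ?thesis by (rule integral_unique)
  qed
  have Riem: "\<bar>(\<Sum>j<q. f0 (x + real j / real q)) - real q * integral {0..1} f\<bar> \<le> (2 * K' + Bv + 2 * K' * card P) / real q"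
    if "q \<ge> 1" for x q
    unfolding int
  proof (rule Riemann_sum_bound[of f0 P "\<lambda>z. g z + \<Lambda>", OF f0per contU P(1) _ K' _ that])
    show "(f0 has_real_derivative g z + \<Lambda>) (at z)" if "z \<in> {0<..<1} - P" for z
    proof -
      have "frac z = z" using that by (simp add: frac_eq)
      then show ?thesis using f0der[of z] that by simp
    qed
    show "(\<Sum>i<n. \<bar>g (t (Suc i)) + \<Lambda> - (g (t i) + \<Lambda>)\<bar>) \<le> Bv"
      if "\<forall>i\<le>n. t i \<in> {0..<1}" "\<forall>i<n. t i \<le> t (Suc i)" for n and t :: "nat \<Rightarrow> real"
      using Bv[OF that] by simp
  qed
  have "L x0 \<noteq> 0"
  proof -
    have r: "((\<lambda>\<delta>. f (x0 + \<delta>)) \<longlongrightarrow> fr x0) (at_right 0)"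
      using fr[of x0] by (simp add: filterlim_at_right_to_0[of f _ x0] add.commute)
    have l: "((\<lambda>\<delta>. f (x0 - \<delta>)) \<longlongrightarrow> fl x0) (at_right 0)"
      using fl[of x0] by (simp add: filterlim_at_left_to_right filterlim_at_right_to_0[of _ _ "- x0"])
    have "((\<lambda>\<delta>. f (x0 - \<delta>) - f (x0 + \<delta>)) \<longlongrightarrow> fl x0 - fr x0) (at_right 0)"
      by (intro tendsto_diff l r)
    then have "J0 = fl x0 - fr x0" using x0(3) tendsto_unique trivial_limit_at_right_real by blast
    then show ?thesis using x0(2) by (simp add: L_def)
  qed
  moreover have "f z = (\<Sum>p\<in>P. L p * saw (z - p)) + f0 z" if "z \<notin> \<rat>" for z
  proof -
    have "frac z \<notin> P"
    proof
      assume "frac z \<in> P"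
      then have "frac z + of_int \<lfloor>z\<rfloor> \<in> \<rat>" using P(2) by (intro Rats_add) auto
      then show False using that by (simp add: frac_def)
    qed
    then show ?thesis using f_eq by (simp add: J_def)
  qed
  moreover have "x0 \<in> P" using x0 by (simp add: P_def)
  ultimately show ?thesis using P(1,2) f0per lip Riem by (intro exI[of _ P] exI[of _ L] exI[of _ f0] exI[of _ K'] exI) blast
qed

section \<open>Birkhoff sums along the convergents\<close>

text \<open>A common divisor divides the determinant of the convergents, which is plus or minus
  one.\<close>

lemma coprime_num_den: "coprime (num w) (den w)"
proof (rule coprimeI)
  fix c assume c: "c dvd num w" "c dvd den w"
  have "int (num' w) * int (den w) - int (num w) * int (den' w) = (-1) ^ length w"
  proof -
    have "real_of_int (int (num' w) * int (den w) - int (num w) * int (den' w)) = real_of_int ((-1) ^ length w)"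
      using det[of w] by simp
    then show ?thesis by (simp only: of_int_eq_iff)
  qed
  moreover have "int c dvd int (num' w) * int (den w) - int (num w) * int (den' w)"
    using c by (intro dvd_diff dvd_mult dvd_mult2) (simp_all only: int_dvd_int_iff)
  ultimately have "int c dvd (-1) ^ length w" by simp
  then have "int c dvd 1" by (cases "even (length w)") auto
  then show "is_unit c" by simp
qed

definition tail :: "real \<Rightarrow> nat \<Rightarrow> real" where "tail x k = (gauss ^^ k) x"
definition qd :: "real \<Rightarrow> nat \<Rightarrow> nat" where "qd x k = den (pre x k)"
definition pd :: "real \<Rightarrow> nat \<Rightarrow> nat" where "pd x k = num (pre x k)"

text \<open>The distances to the nearest integer of consecutive multiples: \<open>gap x k = |qd x k * x - pd x k|\<close>
  and \<open>gap' x k = gap x (k - 1)\<close>.\<close>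
definition gap :: "real \<Rightarrow> nat \<Rightarrow> real" where
  "gap x k = tail x k / (real (qd x k) + tail x k * real (den' (pre x k)))"
definition gap' :: "real \<Rightarrow> nat \<Rightarrow> real" where
  "gap' x k = 1 / (real (qd x k) + tail x k * real (den' (pre x k)))"

lemma gap_tail: "gap x k = tail x k * gap' x k"
  by (simp add: gap_def gap'_def)

context
  fixes x :: real assumes x: "x \<in> irr"
begin

lemma tail_irr: "tail x k \<in> irr" unfolding tail_def using gauss_pow_irr[OF x] .

lemma tail_pos: "0 < tail x k" "tail x k < 1" using tail_irr irrD by blast+

lemma qd_pos: "qd x k \<ge> 1" unfolding qd_def using den_pos pre_positive x by blast

lemma qd_den_le: "den' (pre x k) \<le> qd x k" unfolding qd_def using den'_le pre_positive x by blast

lemma inverse_tail: "1 / tail x k = real (dig x k) + tail x (Suc k)"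
  unfolding tail_def using inverse_gauss_pow[OF x] .

lemma gap_denominator_pos: "real (qd x k) + tail x k * real (den' (pre x k)) > 0"
  using qd_pos[of k] tail_pos[of k] by (intro add_pos_nonneg) auto

lemma gap_nonneg: "gap x k > 0" "gap' x k > 0"
  unfolding gap_def gap'_def using gap_denominator_pos tail_pos by auto

lemma qd_Suc: "qd x (Suc k) = dig x k * qd x k + den' (pre x k)" "den' (pre x (Suc k)) = qd x k"
  by (simp_all add: qd_def pre_Suc)

lemma gap'_Suc: "gap' x (Suc k) = gap x k"
proof -
  have "real (qd x (Suc k)) + tail x (Suc k) * real (den' (pre x (Suc k))) = (real (dig x k) + tail x (Suc k)) * real (qd x k) + real (den' (pre x k))"
    by (simp add: qd_Suc algebra_simps)
  also have "\<dots> = (real (qd x k) + tail x k * real (den' (pre x k))) / tail x k"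
    unfolding inverse_tail[symmetric] using tail_pos[of k] by (simp add: field_simps)
  finally show ?thesis by (simp add: gap'_def gap_def)
qed

lemma gap'_rec: "gap' x k = real (dig x k) * gap x k + gap x (Suc k)"
proof -
  have "gap x (Suc k) = tail x (Suc k) * gap x k" using gap'_Suc[of k] gap_tail[of x "Suc k"] by simp
  moreover have "gap' x k = gap x k * (1 / tail x k)" using tail_pos[of k] by (simp add: gap_def gap'_def)
  ultimately show ?thesis unfolding inverse_tail by (simp add: algebra_simps)
qed

lemma gap_eq: "real (qd x k) * x - real (pd x k) = (-1) ^ k * gap x k"
proof -
  let ?w = "pre x k"
  have "x = (real (num ?w) + tail x k * real (num' ?w)) / (real (den ?w) + tail x k * real (den' ?w))"
    using mob_pre[OF x, of k] by (simp add: mob_def tail_def)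
  then have "real (qd x k) * x - real (pd x k) = real (den ?w) * ((real (num ?w) + tail x k * real (num' ?w)) / (real (den ?w) + tail x k * real (den' ?w))) - real (num ?w)"
    by (simp only: qd_def pd_def)
  also have "\<dots> = tail x k * (real (num' ?w) * real (den ?w) - real (num ?w) * real (den' ?w)) / (real (den ?w) + tail x k * real (den' ?w))"
    using gap_denominator_pos[of k] by (simp add: field_simps qd_def)
  also have "\<dots> = (-1) ^ k * gap x k" by (simp add: det gap_def qd_def)
  finally show ?thesis .
qed

text \<open>Since \<open>1 / tail x k\<close> is the digit plus the next tail, the left side exceeds
  the digit by a tail and a ratio of denominators, each at most one.\<close>

lemma inverse_gap: "1 / (real (qd x k) * gap x k) = 1 / tail x k + real (den' (pre x k)) / real (qd x k)"
  using gap_denominator_pos[of k] tail_pos[of k] qd_pos[of k] by (simp add: gap_def field_simps)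

lemma inverse_gap_bounds:
  "real (dig x k) \<le> 1 / (real (qd x k) * gap x k)" "1 / (real (qd x k) * gap x k) \<le> real (dig x k) + 2"
proof -
  have "real (den' (pre x k)) / real (qd x k) \<le> 1" using qd_den_le[of k] qd_pos[of k] by simp
  moreover have "real (den' (pre x k)) / real (qd x k) \<ge> 0" by simp
  ultimately show "real (dig x k) \<le> 1 / (real (qd x k) * gap x k)" "1 / (real (qd x k) * gap x k) \<le> real (dig x k) + 2"
    unfolding inverse_gap inverse_tail using tail_pos[of "Suc k"] by linarith+
qed

lemma qd_gap_le: "real (qd x k) * gap x k \<le> 1 / real (dig x k)"
proof -
  have p: "real (qd x k) * gap x k > 0" using gap_nonneg qd_pos[of k] by simp
  have "real (dig x k) > 0" using dig_pos[OF x, of k] by simp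
  then show ?thesis using inverse_gap_bounds(1)[of k] p by (simp add: field_simps)
qed

text \<open>Greedy division by the largest denominator: the quotient is at most the digit because
  \<open>N\<close> is below \<open>(dig x k + 1) * qd x k\<close>.\<close>

lemma Ostrowski_digits: "N < qd x k \<Longrightarrow> \<exists>b. (\<forall>i. b i \<le> dig x i) \<and> N = (\<Sum>i<k. b i * qd x i)"
proof (induction k arbitrary: N)
  case 0
  then show ?case by (intro exI[of _ "\<lambda>_. 0"]) (simp add: qd_def)
next
  case (Suc k)
  define c where "c = N div qd x k"
  have q: "qd x k > 0" using qd_pos[of k] by simp
  have "N < dig x k * qd x k + qd x k" using Suc.prems qd_den_le[of k] by (simp add: qd_Suc)
  then have "N < (dig x k + 1) * qd x k" by simp
  then have "c < dig x k + 1" unfolding c_def by (rule less_mult_imp_div_less)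
  then have c: "c \<le> dig x k" by simp
  obtain b where b: "\<forall>i. b i \<le> dig x i" "N mod qd x k = (\<Sum>i<k. b i * qd x i)"
    using Suc.IH[of "N mod qd x k"] q by auto
  have "N = N mod qd x k + c * qd x k" by (simp only: c_def mod_div_mult_eq)
  also have "\<dots> = (\<Sum>i<Suc k. (b(k := c)) i * qd x i)" using b(2) by simp
  finally show ?case using b(1) c by (intro exI[of _ "b(k := c)"]) auto
qed

end

text \<open>\<open>1 / t\<close> differs from \<open>a\<close> by at most \<open>2\<close>.
  Replacing \<open>1 / \<theta>\<close> by \<open>\<epsilon> a\<close> costs \<open>2\<close>, as
  the \<open>bern\<close> difference is at most \<open>b t <= 1\<close>. Replacing the endpoints
  moves them by \<open>4 / a\<close> and \<open>2 / a\<close>, which after multiplication by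
  \<open>a\<close> costs \<open>6\<close>.\<close>

lemma level_estimate:
  fixes a b :: nat and \<epsilon> t u u' \<theta> :: real
  assumes a: "a \<ge> 1" "b \<le> a" and \<epsilon>: "\<epsilon> = 1 \<or> \<epsilon> = -1" and t: "t > 0" "\<theta> = \<epsilon> * t" "real a \<le> 1 / t" "1 / t \<le> real a + 2"
    and u: "\<bar>u' - u\<bar> \<le> 2 / real a"
  shows "\<bar>(bern (u' + real b * \<theta>) - bern u') / \<theta> - \<epsilon> * real a * (bern (u + \<epsilon> * real b / real a) - bern u)\<bar> \<le> 8"
proof -
  define T' where "T' = bern (u' + real b * \<theta>) - bern u'"
  define T where "T = bern (u + \<epsilon> * real b / real a) - bern u"
  have ee: "\<epsilon> * \<epsilon> = 1" "\<bar>\<epsilon>\<bar> = 1" using \<epsilon> by auto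
  have ta: "t * real a \<le> 1" "t * (real a + 2) \<ge> 1" using t by (simp_all add: field_simps)
  have bt: "real b * t \<le> 1"
  proof -
    have "real b * t \<le> real a * t" using a t by (intro mult_right_mono) auto
    then show ?thesis using ta by (simp add: mult.commute)
  qed
  have 1: "\<bar>T' / \<theta> - \<epsilon> * real a * T'\<bar> \<le> 2"
  proof -
    have "T' / \<theta> - \<epsilon> * real a * T' = \<epsilon> * T' * (1 / t - real a)"
      using t ee by (simp add: field_simps)
    then have "\<bar>T' / \<theta> - \<epsilon> * real a * T'\<bar> = \<bar>T'\<bar> * (1 / t - real a)" using t ee by (simp add: abs_mult)
    also have "\<dots> \<le> (real b * t) * 2"
    proof (rule mult_mono)
      show "\<bar>T'\<bar> \<le> real b * t"
        using bern_Lipschitz[of "u' + real b * \<theta>" u'] t ee by (simp add: T'_def abs_mult)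
    qed (use t in auto)
    finally show ?thesis using bt by simp
  qed
  have 2: "\<bar>T' - T\<bar> \<le> 6 / real a"
  proof -
    have "\<bar>real b * \<theta> - \<epsilon> * real b / real a\<bar> = real b * \<bar>t - 1 / real a\<bar>"
    proof -
      have "real b * \<theta> - \<epsilon> * real b / real a = \<epsilon> * real b * (t - 1 / real a)" using t by (simp add: algebra_simps)
      then show ?thesis using ee by (simp add: abs_mult)
    qed
    also have "\<bar>t - 1 / real a\<bar> = (1 - t * real a) / real a" using ta a by (simp add: field_simps)
    also have "real b * \<dots> \<le> real b * (2 * t / real a)"
      using ta a by (intro mult_left_mono divide_right_mono) (auto simp: algebra_simps)
    also have "\<dots> = 2 * (real b * t) / real a" by simp
    also have "\<dots> \<le> 2 * 1 / real a" using bt by (intro divide_right_mono mult_left_mono) auto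
    finally have s: "\<bar>real b * \<theta> - \<epsilon> * real b / real a\<bar> \<le> 2 / real a" by simp
    have "\<bar>bern (u' + real b * \<theta>) - bern (u + \<epsilon> * real b / real a)\<bar> \<le> \<bar>(u' + real b * \<theta>) - (u + \<epsilon> * real b / real a)\<bar>"
      by (rule bern_Lipschitz)
    also have "\<dots> \<le> 2 / real a + 2 / real a" using s u by linarith
    finally have "\<bar>bern (u' + real b * \<theta>) - bern (u + \<epsilon> * real b / real a)\<bar> \<le> 2 / real a + 2 / real a" .
    moreover have "\<bar>bern u' - bern u\<bar> \<le> 2 / real a" using bern_Lipschitz[of u' u] u by linarith
    ultimately have "\<bar>T' - T\<bar> \<le> 2 / real a + 2 / real a + 2 / real a" unfolding T'_def T_def by linarith
    then show ?thesis by simp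
  qed
  have 3: "\<bar>\<epsilon> * real a * T' - \<epsilon> * real a * T\<bar> \<le> 6"
  proof -
    have "\<epsilon> * real a * T' - \<epsilon> * real a * T = \<epsilon> * (real a * (T' - T))" by (simp add: algebra_simps)
    then have "\<bar>\<epsilon> * real a * T' - \<epsilon> * real a * T\<bar> = real a * \<bar>T' - T\<bar>" using ee by (simp add: abs_mult)
    also have "\<dots> \<le> real a * (6 / real a)" using 2 by (intro mult_left_mono) auto
    also have "\<dots> = 6" using a by simp
    finally show ?thesis .
  qed
  show ?thesis using 1 3 unfolding T'_def[symmetric] T_def[symmetric] by linarith
qed

text \<open>The decomposition of \<open>f\<close> together with a start \<open>q0\<close> and a
  common denominator \<open>d\<close> of its distances to the jumps. With \<open>d >= 2\<close> the
  residue \<open>1\<close> is distinct from \<open>0\<close>.\<close>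

locale jump_data =
  fixes f f0 L :: "real \<Rightarrow> real" and P :: "real set" and Lip V q0 :: real and d :: nat
  assumes finP: "finite P"
    and f_eq: "\<And>z. z \<notin> \<rat> \<Longrightarrow> f z = (\<Sum>p\<in>P. L p * saw (z - p)) + f0 z"
    and per0: "\<And>x. f0 (x + 1) = f0 x"
    and lip0: "\<And>x y. \<bar>f0 x - f0 y\<bar> \<le> Lip * \<bar>x - y\<bar>"
    and Riem: "\<And>x q. q \<ge> 1 \<Longrightarrow> \<bar>(\<Sum>j<q. f0 (x + real j / real q)) - real q * integral {0..1} f\<bar> \<le> V / real q"
    and q0: "q0 \<in> \<rat>"
    and d: "d \<ge> 2" "\<And>p. p \<in> P \<Longrightarrow> real d * (q0 - p) \<in> \<int>"
begin

text \<open>Agrees with \<open>f\<close> off the rationals, where the orbit of \<open>q0\<close>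
  under an irrational rotation lies from its first step on, but satisfies the decomposition at every
  real point.\<close>

definition fh :: "real \<Rightarrow> real" where "fh z = (\<Sum>p\<in>P. L p * saw (z - p)) + f0 z"
text \<open>With \<open>t = q (q x - p)\<close>, a sum of \<open>saw\<close> along \<open>b q\<close> steps is, up to a bounded error, \<open>1 / t\<close> times
  an integral of \<open>saw\<close> over an interval of length \<open>b t\<close>; hence the antiderivative \<open>bern\<close>.\<close>
definition jump_term :: "nat \<Rightarrow> real \<Rightarrow> real" where
  "jump_term r z = (\<Sum>p\<in>P. L p * (bern (z + real r * (q0 - p)) - bern (real r * (q0 - p))))"
definition W :: real where "W = (\<Sum>p\<in>P. \<bar>L p\<bar>)"
text \<open>\<open>14\<close> is \<open>6\<close> from \<open>saw_block\<close> plus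
  \<open>8\<close> from \<open>level_estimate\<close>, per unit of jump; \<open>Lip\<close> is the
  drift error of the smooth part.\<close>

definition C1 :: real where "C1 = 14 * W + Lip"

lemma W_nonneg: "W \<ge> 0" by (simp add: W_def sum_nonneg)

lemma Lip_nonneg: "Lip \<ge> 0"
  using order_trans[OF abs_ge_zero lip0[of 1 0]] by simp

lemma V_nonneg: "V \<ge> 0"
  using order_trans[OF abs_ge_zero Riem[of 1 0]] by simp

lemma C1_nonneg: "C1 \<ge> 0" using W_nonneg Lip_nonneg by (simp add: C1_def)

lemma jump_term_0 [simp]: "jump_term r 0 = 0" by (simp add: jump_term_def)

lemma jump_term_periodic [simp]: "jump_term r (z + 1) = jump_term r z"
proof -
  have "bern (z + 1 + y) = bern (z + y)" for y using bern_periodic(2)[of "z + y"] by (simp add: add_ac)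
  then show ?thesis by (simp add: jump_term_def)
qed

text \<open>Changing \<open>r\<close> by a multiple of \<open>d\<close> moves the arguments of
  \<open>bern\<close> by integers, since \<open>d\<close> clears the denominators of
  \<open>q0 - p\<close>.\<close>

lemma jump_term_mod: assumes "r mod d = r' mod d" shows "jump_term r = jump_term r'"
proof -
  have "bern (z + real r * (q0 - p)) = bern (z + real r' * (q0 - p))" if p: "p \<in> P" for p z
  proof -
    obtain m where m: "real d * (q0 - p) = of_int m" using d(2)[OF p] by (auto elim: Ints_cases)
    have "int d dvd int r - int r'" using assms by (metis mod_eq_dvd_iff of_nat_mod)
    then obtain k where "int r - int r' = int d * k" by blast
    then have "real_of_int (int r - int r') = real_of_int (int d * k)" by (simp only:)
    then have "real r = real r' + real d * of_int k" by simp
    then have "z + real r * (q0 - p) = (z + real r' * (q0 - p)) + of_int (k * m)"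
      using m by (simp add: algebra_simps)
    then show ?thesis by (metis bern_periodic(1))
  qed
  from this[of _ 0] this show ?thesis by (intro ext) (simp add: jump_term_def)
qed

lemma jump_term_Lipschitz: "\<bar>jump_term r y - jump_term r z\<bar> \<le> W * \<bar>y - z\<bar>"
proof -
  have "jump_term r y - jump_term r z = (\<Sum>p\<in>P. L p * (bern (y + real r * (q0 - p)) - bern (z + real r * (q0 - p))))"
    by (simp add: jump_term_def sum_subtractf[symmetric] algebra_simps)
  also have "\<bar>\<dots>\<bar> \<le> (\<Sum>p\<in>P. \<bar>L p\<bar> * \<bar>y - z\<bar>)"
  proof (rule order_trans[OF sum_abs sum_mono])
    fix p
    show "\<bar>L p * (bern (y + real r * (q0 - p)) - bern (z + real r * (q0 - p)))\<bar> \<le> \<bar>L p\<bar> * \<bar>y - z\<bar>"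
      unfolding abs_mult using bern_Lipschitz[of "y + real r * (q0 - p)" "z + real r * (q0 - p)"]
      by (intro mult_left_mono) auto
  qed
  finally show ?thesis by (simp add: W_def sum_distrib_right)
qed

lemma jump_term_bound: "\<bar>jump_term r z\<bar> \<le> W"
proof -
  have "\<bar>jump_term r z\<bar> \<le> (\<Sum>p\<in>P. \<bar>L p\<bar> * 1)"
    unfolding jump_term_def
  proof (rule order_trans[OF sum_abs sum_mono])
    fix p
    have "\<bar>bern (z + real r * (q0 - p)) - bern (real r * (q0 - p))\<bar> \<le> 1"
      using bern_bounds[of "z + real r * (q0 - p)"] bern_bounds[of "real r * (q0 - p)"] by linarith
    then show "\<bar>L p * (bern (z + real r * (q0 - p)) - bern (real r * (q0 - p)))\<bar> \<le> \<bar>L p\<bar> * 1"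
      unfolding abs_mult by (intro mult_left_mono) auto
  qed
  then show ?thesis by (simp add: W_def)
qed

lemma fh_periodic: "fh (z + of_int k) = fh z"
proof -
  have "saw (z + of_int k - p) = saw (z - p)" for p
    using saw_periodic(1)[of "z - p" k] by (simp add: algebra_simps)
  moreover have "f0 (z + of_int k) = f0 z" using periodic_int[of f0, OF per0] .
  ultimately show ?thesis by (simp add: fh_def)
qed

text \<open>The offset \<eta> is what the higher levels have added to the start. At scale
  \<open>q\<close> it moves the arguments by at most \<open>2 / a\<close>, which is the displacement
  that \<open>level_estimate\<close> absorbs.\<close>

lemma level:
  assumes x: "x \<in> irr" and b: "b \<le> dig x k" and \<eta>: "real (qd x k) * \<bar>\<eta>\<bar> \<le> 2 / real (dig x k)"
  shows "\<bar>(\<Sum>n=1..b * qd x k. fh (q0 + \<eta> + real n * x)) - real (b * qd x k) * integral {0..1} f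
     - (-1) ^ k * real (dig x k) * jump_term (qd x k) ((-1) ^ k * real b / real (dig x k))\<bar> \<le> C1 + real b * V / real (qd x k)"
proof -
  define q where "q = qd x k"
  define a where "a = dig x k"
  define \<epsilon> :: real where "\<epsilon> = (-1) ^ k"
  define t where "t = real q * gap x k"
  define \<delta> where "\<delta> = \<epsilon> * gap x k / real q"
  define \<theta> where "\<theta> = (real q)\<^sup>2 * \<delta>"
  let ?c = "integral {0..1} f"
  have q: "q \<ge> 1" unfolding q_def using qd_pos[OF x] .
  have a: "a \<ge> 1" "b \<le> a" unfolding a_def using dig_pos[OF x] b by auto
  have \<epsilon>: "\<epsilon> = 1 \<or> \<epsilon> = -1" unfolding \<epsilon>_def by (cases "even k") auto
  have t: "t > 0" "real a \<le> 1 / t" "1 / t \<le> real a + 2"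
    using gap_nonneg(1)[OF x, of k] q inverse_gap_bounds[OF x, of k] by (auto simp: t_def q_def a_def)
  have \<theta>t: "\<theta> = \<epsilon> * t" using q by (simp add: \<theta>_def \<delta>_def t_def power2_eq_square)
  have \<theta>: "\<theta> \<noteq> 0" "\<bar>\<theta>\<bar> = t" using t \<epsilon> by (auto simp: \<theta>t)
  have "real a * t \<le> 1" using t by (simp add: field_simps)
  moreover have "real b * t \<le> real a * t" using a t by (intro mult_right_mono) auto
  ultimately have bt: "real b * \<bar>\<theta>\<bar> \<le> 1" using \<theta> by simp
  have pq: "coprime (pd x k) q" unfolding pd_def q_def qd_def by (rule coprime_num_den)
  have xeq: "x = real (pd x k) / real q + \<delta>"
    using gap_eq[OF x, of k] q unfolding q_def[symmetric] \<epsilon>_def[symmetric] by (simp add: \<delta>_def field_simps)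
  have saw: "\<bar>(\<Sum>n=1..b * q. saw (q0 + \<eta> - p + real n * x)) - \<epsilon> * real a * (bern (\<epsilon> * real b / real a + real q * (q0 - p)) - bern (real q * (q0 - p)))\<bar> \<le> 14" for p
  proof -
    have "\<bar>(\<Sum>n=1..b * q. saw (q0 + \<eta> - p + real n * x)) - (bern (real q * (q0 + \<eta> - p) + real b * \<theta>) - bern (real q * (q0 + \<eta> - p))) / \<theta>\<bar> \<le> 6"
      by (rule saw_block[OF pq q xeq \<theta>_def \<theta>(1) bt])
    moreover have "\<bar>(bern (real q * (q0 + \<eta> - p) + real b * \<theta>) - bern (real q * (q0 + \<eta> - p))) / \<theta>
       - \<epsilon> * real a * (bern (real q * (q0 - p) + \<epsilon> * real b / real a) - bern (real q * (q0 - p)))\<bar> \<le> 8"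
    proof (rule level_estimate[OF a \<epsilon> t(1) \<theta>t t(2,3)])
      have "real q * (q0 + \<eta> - p) - real q * (q0 - p) = real q * \<eta>" by (simp add: algebra_simps)
      then show "\<bar>real q * (q0 + \<eta> - p) - real q * (q0 - p)\<bar> \<le> 2 / real a"
        using \<eta> by (simp add: abs_mult q_def a_def)
    qed
    ultimately show ?thesis by (simp add: add.commute)
  qed
  have smooth: "\<bar>(\<Sum>n=1..b * q. f0 (q0 + \<eta> + real n * x)) - real (b * q) * ?c\<bar> \<le> Lip + real b * V / real q"
    by (rule Lipschitz_block[OF pq q xeq \<theta>_def bt per0 lip0 Riem[OF q]])
  have split: "(\<Sum>n=1..b * q. fh (q0 + \<eta> + real n * x)) - real (b * q) * ?c - \<epsilon> * real a * jump_term q (\<epsilon> * real b / real a)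
     = (\<Sum>p\<in>P. L p * ((\<Sum>n=1..b * q. saw (q0 + \<eta> - p + real n * x)) - \<epsilon> * real a * (bern (\<epsilon> * real b / real a + real q * (q0 - p)) - bern (real q * (q0 - p)))))
      + ((\<Sum>n=1..b * q. f0 (q0 + \<eta> + real n * x)) - real (b * q) * ?c)"
  proof -
    have "(\<Sum>n=1..b * q. fh (q0 + \<eta> + real n * x)) = (\<Sum>n=1..b * q. \<Sum>p\<in>P. L p * saw (q0 + \<eta> - p + real n * x)) + (\<Sum>n=1..b * q. f0 (q0 + \<eta> + real n * x))"
      unfolding fh_def sum.distrib by (simp add: algebra_simps)
    also have "(\<Sum>n=1..b * q. \<Sum>p\<in>P. L p * saw (q0 + \<eta> - p + real n * x)) = (\<Sum>p\<in>P. L p * (\<Sum>n=1..b * q. saw (q0 + \<eta> - p + real n * x)))"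
      by (subst sum.swap) (simp add: sum_distrib_left)
    finally have 1: "(\<Sum>n=1..b * q. fh (q0 + \<eta> + real n * x)) = (\<Sum>p\<in>P. L p * (\<Sum>n=1..b * q. saw (q0 + \<eta> - p + real n * x))) + (\<Sum>n=1..b * q. f0 (q0 + \<eta> + real n * x))" .
    have 2: "\<epsilon> * real a * jump_term q (\<epsilon> * real b / real a) = (\<Sum>p\<in>P. L p * (\<epsilon> * real a * (bern (\<epsilon> * real b / real a + real q * (q0 - p)) - bern (real q * (q0 - p)))))"
      unfolding jump_term_def sum_distrib_left by (intro sum.cong) (simp_all add: mult_ac)
    show ?thesis unfolding 1 2 right_diff_distrib[of "L _"] sum_subtractf by simp
  qed
  have "\<bar>\<Sum>p\<in>P. L p * ((\<Sum>n=1..b * q. saw (q0 + \<eta> - p + real n * x)) - \<epsilon> * real a * (bern (\<epsilon> * real b / real a + real q * (q0 - p)) - bern (real q * (q0 - p))))\<bar> \<le> (\<Sum>p\<in>P. \<bar>L p\<bar> * 14)"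
    by (rule order_trans[OF sum_abs sum_mono]) (unfold abs_mult, rule mult_left_mono[OF saw abs_ge_zero])
  also have "\<dots> = 14 * W" by (simp add: W_def sum_distrib_left mult.commute)
  finally show ?thesis
    using smooth split abs_triangle_ineq unfolding q_def[symmetric] a_def[symmetric] \<epsilon>_def[symmetric] C1_def by linarith
qed

text \<open>A level with digit zero produces no error at all, so a digit vector supported on a block
  pays the constant \<open>C1\<close> only for that block.\<close>

definition err :: "real \<Rightarrow> (nat \<Rightarrow> nat) \<Rightarrow> nat \<Rightarrow> real" where
  "err x b k = (\<Sum>i<k. if b i = 0 then 0 else C1 + real (dig x i) * V / real (qd x i))"

text \<open>The orbit is cut from the top: the \<open>b k * qd x k\<close> steps of the highest
  level come first and shift the start of the lower levels. The bound on \<eta> reproduces itself,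
  because \<open>gap' x k\<close> is \<open>dig x k\<close> times \<open>gap x k\<close> plus
  \<open>gap x (Suc k)\<close>.\<close>

lemma levels:
  assumes x: "x \<in> irr" and b: "\<And>i. b i \<le> dig x i" and \<eta>: "\<bar>\<eta>\<bar> \<le> gap' x k + gap x k"
  shows "\<bar>(\<Sum>n=1..(\<Sum>i<k. b i * qd x i). fh (q0 + \<eta> + real n * x)) - real (\<Sum>i<k. b i * qd x i) * integral {0..1} f
     - (\<Sum>i<k. (-1) ^ i * real (dig x i) * jump_term (qd x i) ((-1) ^ i * real (b i) / real (dig x i)))\<bar> \<le> err x b k"
  using \<eta>
proof (induction k arbitrary: \<eta>)
  case 0
  show ?case by (simp add: err_def)
next
  case (Suc k)
  define N where "N = (\<Sum>i<k. b i * qd x i)"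
  define M where "M = b k * qd x k"
  define \<eta>' where "\<eta>' = \<eta> + real (b k) * ((-1) ^ k * gap x k)"
  let ?c = "integral {0..1} f"
  let ?\<Lambda> = "\<lambda>i. (-1) ^ i * real (dig x i) * jump_term (qd x i) ((-1) ^ i * real (b i) / real (dig x i))"
  have \<eta>: "\<bar>\<eta>\<bar> \<le> gap x k + gap x (Suc k)" using Suc.prems by (simp add: gap'_Suc[OF x])
  have g: "gap x k > 0" "gap x (Suc k) > 0" using gap_nonneg[OF x] by auto
  have gg: "gap x (Suc k) \<le> gap x k"
  proof -
    have "gap x (Suc k) = tail x (Suc k) * gap x k" using gap'_Suc[OF x, of k] gap_tail[of x "Suc k"] by simp
    then show ?thesis using tail_pos[OF x, of "Suc k"] g by (simp add: mult_left_le_one_le)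
  qed
  have ba: "real (b k) * gap x k \<le> real (dig x k) * gap x k" using b[of k] g by (intro mult_right_mono) auto
  have "\<bar>\<eta>'\<bar> \<le> \<bar>\<eta>\<bar> + \<bar>real (b k) * ((-1) ^ k * gap x k)\<bar>" unfolding \<eta>'_def by (rule abs_triangle_ineq)
  also have "\<bar>real (b k) * ((-1) ^ k * gap x k)\<bar> = real (b k) * gap x k" using g by (simp add: abs_mult)
  finally have \<eta>': "\<bar>\<eta>'\<bar> \<le> gap' x k + gap x k" using \<eta> ba gap'_rec[OF x, of k] by linarith
  have IH: "\<bar>(\<Sum>n=1..N. fh (q0 + \<eta>' + real n * x)) - real N * ?c - (\<Sum>i<k. ?\<Lambda> i)\<bar> \<le> err x b k"
    unfolding N_def by (rule Suc.IH[OF \<eta>'])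
  have top: "\<bar>(\<Sum>n=1..M. fh (q0 + \<eta> + real n * x)) - real M * ?c - ?\<Lambda> k\<bar> \<le> (if b k = 0 then 0 else C1 + real (dig x k) * V / real (qd x k))"
  proof (cases "b k = 0")
    case False
    have "real (qd x k) * \<bar>\<eta>\<bar> \<le> real (qd x k) * (2 * gap x k)" using \<eta> gg by (intro mult_left_mono) auto
    also have "\<dots> \<le> 2 * (1 / real (dig x k))" using qd_gap_le[OF x, of k] by simp
    finally have "real (qd x k) * \<bar>\<eta>\<bar> \<le> 2 / real (dig x k)" by simp
    from level[OF x b this] have "\<bar>(\<Sum>n=1..M. fh (q0 + \<eta> + real n * x)) - real M * ?c - ?\<Lambda> k\<bar> \<le> C1 + real (b k) * V / real (qd x k)"
      by (simp add: M_def)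
    also have "\<dots> \<le> C1 + real (dig x k) * V / real (qd x k)"
      using b[of k] V_nonneg by (intro add_left_mono divide_right_mono mult_right_mono) auto
    finally show ?thesis using False by simp
  qed (simp add: M_def)
  have "(\<Sum>n=1..M + N. fh (q0 + \<eta> + real n * x)) = (\<Sum>n=1..M. fh (q0 + \<eta> + real n * x)) + (\<Sum>n=M + 1..M + N. fh (q0 + \<eta> + real n * x))"
    by (rule sum.ub_add_nat) simp
  also have "(\<Sum>n=M + 1..M + N. fh (q0 + \<eta> + real n * x)) = (\<Sum>n=1..N. fh (q0 + \<eta> + real (n + M) * x))"
    using sum.shift_bounds_cl_nat_ivl[of "\<lambda>n. fh (q0 + \<eta> + real n * x)" 1 M N] by (simp add: add.commute)
  also have "\<dots> = (\<Sum>n=1..N. fh (q0 + \<eta>' + real n * x))"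
  proof (rule sum.cong[OF refl])
    fix n
    have "real M * x = real (b k) * (real (qd x k) * x - real (pd x k)) + real (b k * pd x k)" by (simp add: M_def algebra_simps)
    then have "q0 + \<eta> + real (n + M) * x = (q0 + \<eta>' + real n * x) + of_int (int (b k * pd x k))"
      unfolding gap_eq[OF x] by (simp add: \<eta>'_def algebra_simps)
    then show "fh (q0 + \<eta> + real (n + M) * x) = fh (q0 + \<eta>' + real n * x)" by (simp only: fh_periodic)
  qed
  finally have "(\<Sum>n=1..M + N. fh (q0 + \<eta> + real n * x)) = (\<Sum>n=1..M. fh (q0 + \<eta> + real n * x)) + (\<Sum>n=1..N. fh (q0 + \<eta>' + real n * x))" .
  moreover have "(\<Sum>i<Suc k. b i * qd x i) = M + N" by (simp add: M_def N_def)
  moreover have "real (M + N) * ?c = real M * ?c + real N * ?c" by (simp add: algebra_simps)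
  moreover have "err x b (Suc k) = err x b k + (if b k = 0 then 0 else C1 + real (dig x k) * V / real (qd x k))"
    by (simp add: err_def)
  ultimately show ?case using IH top by (simp only: sum.lessThan_Suc)
qed

lemma birkhoff_levels:
  assumes x: "x \<in> irr" and b: "\<And>i. b i \<le> dig x i"
  shows "\<bar>birkhoff_S f x q0 (\<Sum>i<k. b i * qd x i)
     - (\<Sum>i<k. (-1) ^ i * real (dig x i) * jump_term (qd x i) ((-1) ^ i * real (b i) / real (dig x i)))\<bar> \<le> err x b k"
proof -
  have "f (real n * x + q0) = fh (q0 + 0 + real n * x)" if "n \<ge> 1" for n
  proof -
    have "real n * x + q0 \<notin> \<rat>"
    proof
      assume "real n * x + q0 \<in> \<rat>"
      then have "(real n * x + q0 - q0) / real n \<in> \<rat>" using q0 by (intro Rats_divide Rats_diff) auto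
      then show False using irrD(3)[OF x] that by simp
    qed
    then show ?thesis by (simp add: f_eq fh_def add.commute)
  qed
  then have "birkhoff_S f x q0 N = (\<Sum>n=1..N. fh (q0 + 0 + real n * x)) - real N * integral {0..1} f" for N
    unfolding birkhoff_S_def by simp
  then show ?thesis
    using levels[OF x b, where \<eta> = 0 and k = k] gap_nonneg[OF x, of k] by simp
qed

end

section \<open>The convergent case\<close>

lemma summable_div:
  fixes u :: "nat \<Rightarrow> real"
  assumes u: "summable u" "\<And>k. u k \<ge> 0" and m: "m \<ge> 1"
  shows "summable (\<lambda>i. u (i div m))"
proof (rule summableI_nonneg_bounded)
  fix n
  have "(\<Sum>i<n. u (i div m)) \<le> (\<Sum>i<n * m. u (i div m))"
    using u(2) m by (intro sum_mono2) auto
  also have "\<dots> = (\<Sum>k<n. \<Sum>i\<in>{k * m..<k * m + m}. u (i div m))" by (rule sum.nat_group[symmetric])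
  also have "\<dots> = (\<Sum>k<n. real m * u k)"
  proof (rule sum.cong[OF refl])
    fix k
    have "(\<Sum>i\<in>{k * m..<k * m + m}. u (i div m)) = (\<Sum>i\<in>{k * m..<k * m + m}. u k)"
    proof (rule sum.cong[OF refl])
      fix i assume "i \<in> {k * m..<k * m + m}"
      then have "i div m = k" by (intro div_nat_eqI) (auto simp: mult.commute)
      then show "u (i div m) = u k" by simp
    qed
    then show "(\<Sum>i\<in>{k * m..<k * m + m}. u (i div m)) = real m * u k" by simp
  qed
  also have "\<dots> = real m * (\<Sum>k<n. u k)" by (simp add: sum_distrib_left)
  also have "\<dots> \<le> real m * suminf u" using u by (intro mult_left_mono sum_le_suminf) auto
  finally show "(\<Sum>i<n. u (i div m)) \<le> real m * suminf u" .
qed (use u in auto)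

lemma AE_irr: "(AE x in lborel. x \<in> irr \<longrightarrow> Q x) \<Longrightarrow> (AE x in lborel. x \<in> {0..<1} \<longrightarrow> Q x)"
proof -
  assume Q: "AE x in lborel. x \<in> irr \<longrightarrow> Q x"
  have "AE x in lborel. x \<notin> \<rat>" using Rats_null by (rule AE_not_in)
  with Q show ?thesis
  proof eventually_elim
    case (elim x)
    then show ?case by (cases "x = 0") (auto simp: irr_def)
  qed
qed

lemma qd_mono:
  assumes x: "x \<in> irr" and ij: "i \<le> j" shows "qd x i \<le> qd x j"
proof (rule lift_Suc_mono_le[OF _ ij])
  fix n
  have "1 * qd x n \<le> dig x n * qd x n" using dig_pos[OF x] by (rule mult_le_mono1)
  then show "qd x n \<le> qd x (Suc n)" unfolding qd_Suc(1)[OF x] by linarith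
qed

lemma qd_ge_power: "x \<in> irr \<Longrightarrow> 2 ^ (k div 2) \<le> qd x k"
proof (induction k rule: nat_less_induct)
  case (1 k)
  show ?case
  proof (cases "k < 2")
    case True
    then show ?thesis using qd_pos[OF 1(2), of k] by simp
  next
    case False
    define m where "m = k - 2"
    have k: "k = Suc (Suc m)" using False by (simp add: m_def)
    have p: "pre x k = pre x m @ [dig x m, dig x (Suc m)]" by (simp add: k pre_Suc)
    have "2 * qd x m \<le> qd x k" unfolding qd_def p
      using dig_pos[OF 1(2)] pre_positive[OF 1(2)] by (intro den_fib) auto
    moreover have "2 ^ (m div 2) \<le> qd x m" using 1 k by auto
    ultimately show ?thesis by (simp add: k)
  qed
qed

context jump_data
begin

definition C2 :: real where "C2 = W + C1 + V + 1"

lemma C2_pos: "C2 > 0" using W_nonneg C1_nonneg V_nonneg by (simp add: C2_def)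

lemma birkhoff_bound:
  assumes x: "x \<in> irr" and N: "N < qd x k"
  shows "\<bar>birkhoff_S f x q0 N\<bar> \<le> C2 * real (\<Sum>i<k. dig x i)"
proof -
  obtain b where b: "\<And>i. b i \<le> dig x i" "N = (\<Sum>i<k. b i * qd x i)" using Ostrowski_digits[OF x N] by auto
  let ?\<Lambda> = "\<lambda>i. (-1) ^ i * real (dig x i) * jump_term (qd x i) ((-1) ^ i * real (b i) / real (dig x i))"
  have 1: "\<bar>\<Sum>i<k. ?\<Lambda> i\<bar> \<le> (\<Sum>i<k. W * real (dig x i))"
  proof (rule order_trans[OF sum_abs sum_mono])
    fix i
    have "\<bar>?\<Lambda> i\<bar> = real (dig x i) * \<bar>jump_term (qd x i) ((-1) ^ i * real (b i) / real (dig x i))\<bar>"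
      by (simp add: abs_mult power_abs)
    also have "\<dots> \<le> real (dig x i) * W" by (intro mult_left_mono jump_term_bound) auto
    finally show "\<bar>?\<Lambda> i\<bar> \<le> W * real (dig x i)" by (simp add: mult.commute)
  qed
  have 2: "err x b k \<le> (\<Sum>i<k. (C1 + V) * real (dig x i))"
    unfolding err_def
  proof (rule sum_mono)
    fix i
    have a: "real (dig x i) \<ge> 1" using dig_pos[OF x, of i] by simp
    have "C1 * 1 \<le> C1 * real (dig x i)" using a C1_nonneg by (intro mult_left_mono) auto
    moreover have "real (dig x i) * V / real (qd x i) \<le> real (dig x i) * V / 1"
      using qd_pos[OF x, of i] V_nonneg by (intro divide_left_mono) auto
    moreover have "(C1 + V) * real (dig x i) \<ge> 0" using C1_nonneg V_nonneg by simp
    ultimately show "(if b i = 0 then 0 else C1 + real (dig x i) * V / real (qd x i)) \<le> (C1 + V) * real (dig x i)"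
      by (simp add: algebra_simps)
  qed
  have "\<bar>birkhoff_S f x q0 N\<bar> \<le> (\<Sum>i<k. W * real (dig x i)) + (\<Sum>i<k. (C1 + V) * real (dig x i))"
    using birkhoff_levels[OF x b(1), of k] 1 2 unfolding b(2)[symmetric] by linarith
  also have "\<dots> = (W + C1 + V) * real (\<Sum>i<k. dig x i)"
    by (simp add: sum_distrib_left sum.distrib algebra_simps)
  also have "\<dots> \<le> C2 * real (\<Sum>i<k. dig x i)"
    by (intro mult_right_mono of_nat_0_le_iff) (simp add: C2_def)
  finally show ?thesis .
qed

theorem finitely_many_large:
  fixes psi :: "real \<Rightarrow> real"
  assumes mono: "mono_on {0<..} psi" and pos: "\<forall>x>0. psi x > 0"
    and sum: "summable (\<lambda>k::nat. 1 / psi (real k + 1))"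
  shows "\<exists>c>0. AE x in lborel. x \<in> {0..<1} \<longrightarrow>
    finite {N. 1 \<le> N \<and> \<bar>birkhoff_S f x q0 N\<bar> \<ge> psi (ln (real N)) + c * ln (real N) * ln (ln (real N))}"
proof -
  \<comment> \<open>\<open>624 = 78 * 8\<close>, where \<open>8\<close> compares
    \<open>K ln K\<close> with \<open>l ln l\<close> for \<open>l = ln N\<close>. Of the two extra
    units one absorbs the finitely many early digits and the other makes the inequality
    strict.\<close>
  define c where "c = 624 * C2 + 2"
  \<comment> \<open>The division by \<open>8\<close> is compensated by \<open>K <= 4 l\<close>: an
    index below \<open>K\<close> is then sent below \<open>l\<close>, so monotonicity of
    \<open>psi\<close> applies.\<close>
  define \<phi> where "\<phi> = (\<lambda>i::nat. psi (real (i + 1) / 8) / C2)"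
  have \<phi>pos: "\<phi> i > 0" for i unfolding \<phi>_def using C2_pos pos by simp
  have "summable (\<lambda>i. 1 / \<phi> i)"
  proof -
    \<comment> \<open>This is \<open>1 / psi k\<close> for positive \<open>k\<close>; at
      \<open>k = 0\<close> truncated subtraction repeats \<open>1 / psi 1\<close>, which keeps the
      argument of \<open>psi\<close> positive.\<close>
    define u where "u = (\<lambda>k::nat. 1 / psi (real (k - 1) + 1))"
    have "summable (\<lambda>k. u (Suc k))" using sum by (simp add: u_def)
    then have "summable u" by (simp only: summable_Suc_iff)
    then have "summable (\<lambda>i. u (i div 8))"
      using pos by (intro summable_div) (auto simp: u_def intro: less_imp_le)
    then have s: "summable (\<lambda>i. C2 * u (i div 8))" by (rule summable_mult)
    show ?thesis
    proof (rule summable_comparison_test'[OF s, of 8])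
      fix i :: nat assume i: "i \<ge> 8"
      have k: "i div 8 \<ge> 1" using i by (simp add: less_eq_div_iff_mult_less_eq)
      have "real (8 * (i div 8)) \<le> real i" by (simp only: of_nat_le_iff times_div_less_eq_dividend)
      then have "psi (real (i div 8 - 1) + 1) \<le> psi (real (i + 1) / 8)"
        using k by (intro mono_onD[OF mono]) (auto simp: of_nat_diff)
      moreover have "psi (real (i div 8 - 1) + 1) > 0" using pos by simp
      ultimately have "1 / psi (real (i + 1) / 8) \<le> u (i div 8)" unfolding u_def by (intro divide_left_mono mult_pos_pos) auto
      then have "C2 * (1 / psi (real (i + 1) / 8)) \<le> C2 * u (i div 8)" using C2_pos by (intro mult_left_mono) auto
      moreover have "1 / \<phi> i = C2 * (1 / psi (real (i + 1) / 8))" by (simp add: \<phi>_def)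
      moreover have "1 / \<phi> i > 0" using \<phi>pos[of i] by simp
      ultimately show "norm (1 / \<phi> i) \<le> C2 * u (i div 8)" by simp
    qed
  qed
  from AE_dig_le[OF \<phi>pos this] AE_trimmed_sum
  have "AE x in lborel. x \<in> irr \<longrightarrow>
    finite {N. 1 \<le> N \<and> \<bar>birkhoff_S f x q0 N\<bar> \<ge> psi (ln (real N)) + c * ln (real N) * ln (ln (real N))}"
  proof eventually_elim
    case (elim x)
    show ?case
    proof
      assume x: "x \<in> irr"
      obtain i0 where i0: "\<And>i. i \<ge> i0 \<Longrightarrow> real (dig x i) \<le> \<phi> i"
        using elim(1) x by (auto simp: eventually_sequentially)
      obtain n0 where n0: "\<And>n. n \<ge> n0 \<Longrightarrow> \<exists>k<n. real (\<Sum>i\<in>{..<n} - {k}. dig x i) \<le> 78 * (real n * ln (real n))"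
        using elim(2) x by (auto simp: eventually_sequentially)
      define M where "M = real (\<Sum>i<i0. dig x i)"
      have "filterlim (\<lambda>N::nat. ln (real N) * ln (ln (real N))) at_top sequentially" by real_asymp
      then have "eventually (\<lambda>N::nat. C2 * M \<le> ln (real N) * ln (ln (real N))) sequentially"
        by (simp add: filterlim_at_top)
      moreover have "eventually (\<lambda>N::nat. ln (real N) \<ge> 2) sequentially" by real_asymp
      moreover have "eventually (\<lambda>N::nat. ln (ln (real N)) \<ge> ln 4) sequentially" by real_asymp
      moreover have "eventually (\<lambda>N::nat. N \<ge> qd x n0) sequentially" by (rule eventually_ge_at_top)
      ultimately have "eventually (\<lambda>N::nat. \<bar>birkhoff_S f x q0 N\<bar> < psi (ln (real N)) + c * ln (real N) * ln (ln (real N))) sequentially"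
      proof eventually_elim
        case (elim N)
        note N = elim
        have Npos: "N \<ge> 1" using N(4) qd_pos[OF x, of n0] by linarith
        define l where "l = ln (real N)"
        have l: "l \<ge> 2" using N(2) by (simp add: l_def)
        have ll: "ln l \<ge> ln 4" using N(3) by (simp add: l_def)
        have ll0: "ln l > 0" using ll by (rule less_le_trans[rotated]) simp
        have ex: "N < qd x (2 * N)"
          using less_le_trans[OF less_exp[of N], of "qd x (2 * N)"] qd_ge_power[OF x, of "2 * N"] by simp
        \<comment> \<open>Minimality gives \<open>qd x (K - 1) <= N\<close>, and denominators at
          least double every two steps, so \<open>K\<close> is at most a multiple of
          \<open>ln N\<close>.\<close>
        define K where "K = (LEAST k. N < qd x k)"
        have K: "N < qd x K" unfolding K_def using ex by (rule LeastI)
        have K1: "K \<ge> 1"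
        proof (rule ccontr)
          assume "\<not> K \<ge> 1"
          then have "K = 0" by simp
          then have "qd x K = 1" by (simp add: qd_def)
          then show False using K Npos by simp
        qed
        have "\<not> N < qd x (K - 1)" using K1 not_less_Least[of "K - 1" "\<lambda>k. N < qd x k"] by (simp add: K_def)
        then have "2 ^ ((K - 1) div 2) \<le> N" using qd_ge_power[OF x, of "K - 1"] by linarith
        then have "real (2 ^ ((K - 1) div 2)) \<le> real N" by (simp only: of_nat_le_iff)
        then have "ln (2 ^ ((K - 1) div 2)) \<le> l" using Npos unfolding l_def by (subst ln_le_cancel_iff) auto
        then have "real ((K - 1) div 2) * ln 2 \<le> l" by (simp add: ln_realpow)
        moreover have "real ((K - 1) div 2) * (2/3) \<le> real ((K - 1) div 2) * ln 2"
          using ln2_ge_two_thirds by (intro mult_left_mono) auto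
        moreover have "real K \<le> 2 * real ((K - 1) div 2) + 2"
        proof -
          have "K \<le> 2 * ((K - 1) div 2) + 2" using K1 by presburger
          then have "real K \<le> real (2 * ((K - 1) div 2) + 2)" by (simp only: of_nat_le_iff)
          then show ?thesis by simp
        qed
        ultimately have K4: "real K \<le> 4 * l" using l by linarith
        have "K \<ge> n0"
        proof (rule ccontr)
          assume "\<not> K \<ge> n0"
          then have "qd x K \<le> qd x n0" using qd_mono[OF x] by simp
          then show False using K N(4) by simp
        qed
        then obtain \<kappa> where \<kappa>: "\<kappa> < K" "real (\<Sum>i\<in>{..<K} - {\<kappa>}. dig x i) \<le> 78 * (real K * ln (real K))"
          using n0 by blast
        \<comment> \<open>The removed digit either sits late enough to obey the Borel--Cantelli
          bound or is one of the first \<open>i0\<close> digits, whose sum is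
          \<open>M\<close>.\<close>
        have big: "C2 * real (dig x \<kappa>) \<le> psi l + C2 * M"
        proof (cases "\<kappa> \<ge> i0")
          case True
          have "real (\<kappa> + 1) \<le> real K" using \<kappa>(1) by (simp only: of_nat_le_iff)
          then have "psi (real (\<kappa> + 1) / 8) \<le> psi l"
            using K4 l by (intro mono_onD[OF mono]) auto
          moreover have "C2 * real (dig x \<kappa>) \<le> C2 * \<phi> \<kappa>" using i0[OF True] C2_pos by (intro mult_left_mono) auto
          moreover have "C2 * \<phi> \<kappa> = psi (real (\<kappa> + 1) / 8)" using C2_pos by (simp add: \<phi>_def)
          moreover have "C2 * M \<ge> 0" unfolding M_def by (intro mult_nonneg_nonneg less_imp_le[OF C2_pos] of_nat_0_le_iff)
          ultimately show ?thesis by linarith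
        next
          case False
          then have "dig x \<kappa> \<le> (\<Sum>i<i0. dig x i)" by (intro member_le_sum) auto
          then have "real (dig x \<kappa>) \<le> M" by (simp only: M_def of_nat_le_iff)
          then have "C2 * real (dig x \<kappa>) \<le> C2 * M" using C2_pos by (intro mult_left_mono) auto
          moreover have "psi l > 0" using pos l by simp
          ultimately show ?thesis by linarith
        qed
        have rest: "real K * ln (real K) \<le> 8 * (l * ln l)"
        proof -
          have "ln (real K) \<le> ln (4 * l)" using K1 K4 by (subst ln_le_cancel_iff) auto
          also have "\<dots> = ln 4 + ln l" using l by (subst ln_mult) auto
          also have "\<dots> \<le> 2 * ln l" using ll by simp
          finally have "real K * ln (real K) \<le> (4 * l) * (2 * ln l)"
            using K4 K1 l by (intro mult_mono) auto
          then show ?thesis by simp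
        qed
        have "(\<Sum>i<K. dig x i) = dig x \<kappa> + (\<Sum>i\<in>{..<K} - {\<kappa>}. dig x i)"
          using \<kappa>(1) by (intro sum.remove) auto
        then have "real (\<Sum>i<K. dig x i) = real (dig x \<kappa>) + real (\<Sum>i\<in>{..<K} - {\<kappa>}. dig x i)" by (simp only: of_nat_add)
        also have "\<dots> \<le> real (dig x \<kappa>) + 624 * (l * ln l)" using \<kappa>(2) rest by linarith
        finally have "C2 * real (\<Sum>i<K. dig x i) \<le> C2 * (real (dig x \<kappa>) + 624 * (l * ln l))"
          using C2_pos by (intro mult_left_mono) auto
        also have "\<dots> = C2 * real (dig x \<kappa>) + 624 * C2 * (l * ln l)" by (simp add: algebra_simps)
        finally have "\<bar>birkhoff_S f x q0 N\<bar> \<le> psi l + C2 * M + 624 * C2 * (l * ln l)"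
          using birkhoff_bound[OF x K] big by linarith
        also have "\<dots> \<le> psi l + l * ln l + 624 * C2 * (l * ln l)" using N(1) by (simp add: l_def)
        also have "\<dots> < psi l + l * ln l + 624 * C2 * (l * ln l) + l * ln l" using l ll0 by simp
        also have "\<dots> = psi l + c * l * ln l" by (simp add: c_def algebra_simps)
        finally show ?case by (simp add: l_def)
      qed
      then obtain N0 where "\<And>N. N \<ge> N0 \<Longrightarrow> \<bar>birkhoff_S f x q0 N\<bar> < psi (ln (real N)) + c * ln (real N) * ln (ln (real N))"
        by (auto simp: eventually_sequentially)
      then have "{N. 1 \<le> N \<and> \<bar>birkhoff_S f x q0 N\<bar> \<ge> psi (ln (real N)) + c * ln (real N) * ln (ln (real N))} \<subseteq> {..<N0}"
        by (auto simp: not_le[symmetric])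
      then show "finite {N. 1 \<le> N \<and> \<bar>birkhoff_S f x q0 N\<bar> \<ge> psi (ln (real N)) + c * ln (real N) * ln (ln (real N))}"
        by (rule finite_subset) simp
    qed
  qed
  then have "AE x in lborel. x \<in> {0..<1} \<longrightarrow>
    finite {N. 1 \<le> N \<and> \<bar>birkhoff_S f x q0 N\<bar> \<ge> psi (ln (real N)) + c * ln (real N) * ln (ln (real N))}"
    by (rule AE_irr)
  moreover have "c > 0" using C2_pos by (simp add: c_def)
  ultimately show ?thesis by blast
qed

end

section \<open>Prefixes modulo \<open>d\<close> and Ostrowski digit vectors\<close>

text \<open>This pair determines the residues of all later denominators. The empty word has the pair
  \<open>(1, 0)\<close>, so after a prefix with that pair the residues evolve as if nothing had come
  before.\<close>

definition state :: "nat \<Rightarrow> nat list \<Rightarrow> nat \<times> nat" where "state d w = (den w mod d, den' w mod d)"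

lemma state_append: "state d v = state d w \<Longrightarrow> state d (v @ e) = state d (w @ e)"
proof (induction e rule: rev_induct)
  case (snoc a e)
  then have IH: "den (v @ e) mod d = den (w @ e) mod d" "den' (v @ e) mod d = den' (w @ e) mod d"
    by (simp_all add: state_def)
  have "(a * den (v @ e) + den' (v @ e)) mod d = (a * den (w @ e) + den' (w @ e)) mod d"
    using IH by (metis mod_add_cong mod_mult_cong)
  then show ?case using IH den_snoc[of "v @ e" a] den_snoc[of "w @ e" a] by (simp add: state_def)
qed simp

lemma state_step:
  "den (w @ [d * c + a]) mod d = (a * den w + den' w) mod d" "den' (w @ [c]) mod d = den w mod d"
proof -
  have "(d * c + a) * den w + den' w = (a * den w + den' w) + d * (c * den w)" by (simp add: algebra_simps)
  then show "den (w @ [d * c + a]) mod d = (a * den w + den' w) mod d"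
    by (simp only: den_snoc mod_mult_self2)
qed simp

text \<open>Modulo \<open>d\<close> the step with digit \<open>a\<close> is invertible: the digits
  \<open>0, -a, 0\<close> undo it, and \<open>d, a (d - 1), d\<close> are positive representatives.
  Undoing the digits of \<open>w\<close> from the last to the first leads back to
  \<open>(1, 0)\<close>.\<close>

lemma state_undo:
  assumes d: "d \<ge> 2"
  shows "positive w \<Longrightarrow> \<exists>e. positive e \<and> (\<forall>v. state d v = state d w \<longrightarrow> state d (v @ e) = (1, 0))"
proof (induction w rule: rev_induct)
  case Nil
  then show ?case using d by (intro exI[of _ "[]"]) (simp add: state_def)
next
  case (snoc a w)
  then obtain e where e: "positive e" "\<And>v. state d v = state d w \<Longrightarrow> state d (v @ e) = (1, 0)" by auto
  define c where "c = a * (d - 1)"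
  have c: "c \<ge> 1" using d snoc.prems by (auto simp: c_def)
  have "state d (v @ ([d, c, d] @ e)) = (1, 0)" if v: "state d v = state d (w @ [a])" for v
  proof -
    have "state d (w @ [a, d, c, d]) = state d w"
    proof -
      let ?q = "den w" and ?q' = "den' w"
      have 1: "den (w @ [a, d]) mod d = ?q mod d" "den' (w @ [a, d]) = a * ?q + ?q'"
        using state_step(1)[of "w @ [a]" d 1 0] den_snoc[of "w @ [a]" d] by simp_all
      have 2: "den (w @ [a, d, c]) = c * den (w @ [a, d]) + den' (w @ [a, d])" "den' (w @ [a, d, c]) = den (w @ [a, d])"
        using den_snoc[of "w @ [a, d]" c] by simp_all
      have 3: "den (w @ [a, d, c, d]) mod d = den' (w @ [a, d, c]) mod d" "den' (w @ [a, d, c, d]) = den (w @ [a, d, c])"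
        using state_step(1)[of "w @ [a, d, c]" d 1 0] den_snoc[of "w @ [a, d, c]" d] by simp_all
      have "(c * den (w @ [a, d]) + (a * ?q + ?q')) mod d = (c * ?q + (a * ?q + ?q')) mod d"
        using 1(1) by (metis mod_add_cong mod_mult_cong)
      also have "c * ?q + (a * ?q + ?q') = ?q' + d * (a * ?q)"
        using d by (simp add: c_def algebra_simps diff_mult_distrib2)
      finally show ?thesis using 1 2 3 by (simp add: state_def)
    qed
    then have "state d (v @ [d, c, d]) = state d w" using state_append[OF v, of "[d, c, d]"] by simp
    from e(2)[OF this] show ?thesis by simp
  qed
  moreover have "positive ([d, c, d] @ e)" using e c d by auto
  ultimately show ?case by blast
qed

text \<open>Two words that return to \<open>(1, 0)\<close>, one of even and one of odd length; they
  allow the parity of a prefix to be corrected.\<close>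

lemma state_flip:
  assumes d: "d \<ge> 2" and v: "state d v = (1, 0)"
  shows "state d (v @ [d, d]) = (1, 0)" "state d (v @ [1, d - 1, d]) = (1, 0)"
proof -
  have n: "state d v = state d []" using v d by (simp add: state_def)
  have "state d ([] @ [d, d]) = (1, 0)" using d by (simp add: state_def den_Cons mod_Suc)
  then show "state d (v @ [d, d]) = (1, 0)" using state_append[OF n, of "[d, d]"] by simp
  obtain d' where d': "d = Suc d'" using d by (cases d) auto
  have "state d ([] @ [1, d - 1, d]) = (1, 0)"
    using d mod_mult_self2[of 1 "Suc d'" "Suc d'"] by (simp add: state_def den_Cons d' add_ac)
  then show "state d (v @ [1, d - 1, d]) = (1, 0)" using state_append[OF n, of "[1, d - 1, d]"] by simp
qed

text \<open>There are finitely many residue pairs, so one bound \<open>R\<close> serves all words.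
  Appending \<open>[d, d]\<close> ensures length at least two, and the further three digits change
  the parity when necessary.\<close>

lemma extend_to_trivial_state:
  assumes d: "d \<ge> 2"
  shows "\<exists>R. \<forall>w \<pi>. positive w \<longrightarrow> (\<exists>e. positive e \<and> 2 \<le> length e \<and> length e \<le> R \<and> (\<forall>a\<in>set e. a \<le> R) \<and>
    even (length (w @ e)) = \<pi> \<and> state d (w @ e) = (1, 0))"
proof -
  define S where "S = state d ` {w. positive w}"
  have "S \<subseteq> {..<d} \<times> {..<d}" using d by (auto simp: S_def state_def)
  then have finS: "finite S" by (rule finite_subset) auto
  have "\<forall>s\<in>S. \<exists>e. positive e \<and> (\<forall>v. state d v = s \<longrightarrow> state d (v @ e) = (1, 0))"
    using state_undo[OF d] by (auto simp: S_def)
  then obtain E where E: "\<And>s. s \<in> S \<Longrightarrow> positive (E s)" "\<And>s v. s \<in> S \<Longrightarrow> state d v = s \<Longrightarrow> state d (v @ E s) = (1, 0)"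
    by metis
  define R0 where "R0 = (\<Sum>s\<in>S. length (E s) + sum_list (E s))"
  \<comment> \<open>Five letters are appended to \<open>E s\<close> at most, and none of them
    exceeds \<open>d\<close>.\<close>
  define R where "R = R0 + d + 5"
  have R0: "length (E s) \<le> R0" "a \<in> set (E s) \<Longrightarrow> a \<le> R0" if "s \<in> S" for s a
  proof -
    have "length (E s) + sum_list (E s) \<le> R0" unfolding R0_def using finS that by (intro member_le_sum) auto
    then show "length (E s) \<le> R0" "a \<in> set (E s) \<Longrightarrow> a \<le> R0" using member_le_sum_list[of a "E s"] by auto
  qed
  show ?thesis
  proof (intro exI[of _ R] allI impI)
    fix w \<pi> assume w: "positive w"
    define s where "s = state d w"
    have s: "s \<in> S" using w by (simp add: S_def s_def)
    define e0 where "e0 = E s @ [d, d]"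
    have e0: "state d (w @ e0) = (1, 0)"
      using state_flip(1)[OF d E(2)[OF s s_def[symmetric]]] by (simp add: e0_def)
    define e1 where "e1 = e0 @ [1, d - 1, d]"
    have e1: "state d (w @ e1) = (1, 0)" using state_flip(2)[OF d e0] by (simp add: e1_def)
    have p: "positive e0" "positive e1" using E(1)[OF s] d by (auto simp: e0_def e1_def)
    have l: "2 \<le> length e0" "length e0 \<le> R" "2 \<le> length e1" "length e1 \<le> R"
      using R0(1)[OF s] by (auto simp: e0_def e1_def R_def)
    have b: "\<forall>a\<in>set e0. a \<le> R" "\<forall>a\<in>set e1. a \<le> R"
      using R0(2)[OF s] by (auto simp: e0_def e1_def R_def intro: trans_le_add1)
    have par: "even (length (w @ e1)) \<longleftrightarrow> \<not> even (length (w @ e0))" by (simp add: e1_def)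
    show "\<exists>e. positive e \<and> 2 \<le> length e \<and> length e \<le> R \<and> (\<forall>a\<in>set e. a \<le> R) \<and> even (length (w @ e)) = \<pi> \<and> state d (w @ e) = (1, 0)"
    proof (cases "even (length (w @ e0)) = \<pi>")
      case True then show ?thesis using e0 p l b by blast
    next
      case False then show ?thesis using e1 p l b par by blast
    qed
  qed
qed

text \<open>Digit vectors obeying the Ostrowski rule: a maximal digit is preceded by a zero digit.\<close>
fun ostrowski :: "(nat \<Rightarrow> nat) \<Rightarrow> nat \<Rightarrow> (nat \<Rightarrow> nat) set" where
  "ostrowski a 0 = {\<lambda>_. 0}"
| "ostrowski a (Suc 0) = (\<lambda>c. (\<lambda>_. 0)(0 := c)) ` {..<a 0}"
| "ostrowski a (Suc (Suc k)) = (\<lambda>(b, c). b(Suc k := c)) ` (ostrowski a (Suc k) \<times> {..<a (Suc k)}) \<union> (\<lambda>b. b(Suc k := a (Suc k))) ` ostrowski a k"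

lemma ostrowski_support: "b \<in> ostrowski a k \<Longrightarrow> (\<forall>i. b i \<le> a i) \<and> (\<forall>i\<ge>k. b i = 0)"
proof (induction a k arbitrary: b rule: ostrowski.induct)
  case (3 a k)
  from 3(3) show ?case
  proof (simp, elim disjE)
    assume "b \<in> (\<lambda>(b, c). b(Suc k := c)) ` (ostrowski a (Suc k) \<times> {..<a (Suc k)})"
    then obtain b' c where b: "b = b'(Suc k := c)" "b' \<in> ostrowski a (Suc k)" "c < a (Suc k)" by auto
    with 3(1)[OF b(2)] show "(\<forall>i. b i \<le> a i) \<and> (\<forall>i\<ge>Suc (Suc k). b i = 0)" by auto
  next
    assume "b \<in> (\<lambda>b. b(Suc k := a (Suc k))) ` ostrowski a k"
    then obtain b' where b: "b = b'(Suc k := a (Suc k))" "b' \<in> ostrowski a k" by auto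
    with 3(2)[OF b(2)] show "(\<forall>i. b i \<le> a i) \<and> (\<forall>i\<ge>Suc (Suc k). b i = 0)" by auto
  qed
qed auto

lemma ostrowski_finite: "finite (ostrowski a k)"
  by (induction a k rule: ostrowski.induct) auto

lemma ostrowski_cong: "(\<And>i. i < k \<Longrightarrow> a i = a' i) \<Longrightarrow> ostrowski a k = ostrowski a' k"
  by (induction a k rule: ostrowski.induct) auto

text \<open>The cases of a smaller and of a maximal top digit are disjoint, so the cardinalities
  satisfy the recurrence of the denominators.\<close>

lemma ostrowski_card: "card (ostrowski a k) = den (map a [0..<k])"
proof (induction a k rule: ostrowski.induct)
  case (2 a)
  have "inj_on (\<lambda>c. (\<lambda>_. 0)(0 := c)) {..<a 0}"
    by (rule inj_onI) (metis fun_upd_same)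
  from card_image[OF this] show ?case by (simp add: den_Cons)
next
  case (3 a k)
  let ?A = "(\<lambda>(b, c). b(Suc k := c)) ` (ostrowski a (Suc k) \<times> {..<a (Suc k)})"
  let ?B = "(\<lambda>b. b(Suc k := a (Suc k))) ` ostrowski a k"
  have upd_inj: "b = b'" if "b(Suc k := c) = b'(Suc k := c')" "b (Suc k) = 0" "b' (Suc k) = 0" for b b' :: "nat \<Rightarrow> nat" and c c'
  proof
    fix i show "b i = b' i" using that by (metis fun_upd_apply)
  qed
  have z: "b (Suc k) = 0" if "b \<in> ostrowski a (Suc k) \<or> b \<in> ostrowski a k" for b using that ostrowski_support by force
  have "inj_on (\<lambda>(b, c). b(Suc k := c)) (ostrowski a (Suc k) \<times> {..<a (Suc k)})"
  proof (rule inj_onI, clarify)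
    fix b c b' c' assume *: "b \<in> ostrowski a (Suc k)" "b' \<in> ostrowski a (Suc k)" "b(Suc k := c) = b'(Suc k := c')"
    then show "b = b' \<and> c = c'" using upd_inj[OF *(3)] z by (metis fun_upd_same)
  qed
  then have A: "card ?A = den (map a [0..<Suc k]) * a (Suc k)" using 3(1) by (simp add: card_image card_cartesian_product)
  have "inj_on (\<lambda>b. b(Suc k := a (Suc k))) (ostrowski a k)"
    by (rule inj_onI) (metis upd_inj z)
  then have B: "card ?B = den (map a [0..<k])" using 3(2) by (simp add: card_image)
  have "?A \<inter> ?B = {}" by (auto dest: fun_cong[of _ _ "Suc k"])
  then have "card (ostrowski a (Suc (Suc k))) = card ?A + card ?B" by (simp add: card_Un_disjoint ostrowski_finite)
  also have "\<dots> = den (map a [0..<Suc (Suc k)])"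
  proof -
    have 1: "map a [0..<Suc (Suc k)] = map a [0..<Suc k] @ [a (Suc k)]" by simp
    have "map a [0..<Suc k] = map a [0..<k] @ [a k]" by simp
    then have 2: "den' (map a [0..<Suc k]) = den (map a [0..<k])" by (simp only: den_snoc)
    show ?thesis unfolding A B 1 den_snoc 2 by (simp only: mult.commute)
  qed
  finally show ?case .
qed simp

definition dval :: "(nat \<Rightarrow> nat) \<Rightarrow> (nat \<Rightarrow> nat) \<Rightarrow> nat \<Rightarrow> nat" where
  "dval Q b k = (\<Sum>i<k. b i * Q i)"

text \<open>The weights are abstract because they will be the denominators of \<open>x\<close> after
  a prefix, whose recurrence starts from an arbitrary pair. The top digit is recovered as the
  quotient by \<open>Q (Suc k)\<close>; when it is maximal, the zero digit before it keeps the
  remainder below \<open>Q k\<close>, so the value stays below the next weight.\<close>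

lemma ostrowski_dval:
  assumes "Q 0 \<ge> 1" "a 0 * Q 0 \<le> Q 1" "\<And>i. Q (Suc (Suc i)) = a (Suc i) * Q (Suc i) + Q i" "\<And>i. Q i \<le> Q (Suc i)"
  shows "(\<forall>b\<in>ostrowski a k. dval Q b k < Q k) \<and> inj_on (\<lambda>b. dval Q b k) (ostrowski a k)"
  using assms
proof (induction a k rule: ostrowski.induct)
  case (1 a)
  then show ?case by (simp add: dval_def)
next
  case (2 a)
  have "c * Q 0 < Q 1" if "c < a 0" for c
    using that 2(1,2) by (meson mult_less_mono1 less_le_trans zero_less_one le_trans less_numeral_extra(1) order_less_le_trans)
  moreover have "inj_on (\<lambda>b. dval Q b 1) (ostrowski a (Suc 0))"
    using 2(1) by (auto simp: inj_on_def dval_def)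
  ultimately show ?case by (auto simp: dval_def)
next
  case (3 a k)
  have IH1: "\<And>b. b \<in> ostrowski a (Suc k) \<Longrightarrow> dval Q b (Suc k) < Q (Suc k)" "inj_on (\<lambda>b. dval Q b (Suc k)) (ostrowski a (Suc k))"
    using 3(1)[OF 3(3-6)] by auto
  have IH2: "\<And>b. b \<in> ostrowski a k \<Longrightarrow> dval Q b k < Q k" "inj_on (\<lambda>b. dval Q b k) (ostrowski a k)"
    using 3(2)[OF 3(3-6)] by auto
  have dv: "dval Q (b(Suc k := c)) (Suc (Suc k)) = dval Q b (Suc k) + c * Q (Suc k)" for b c
    by (simp add: dval_def)
  have dvS: "dval Q b (Suc k) = dval Q b k" if "b \<in> ostrowski a k" for b
    using ostrowski_support[OF that] by (simp add: dval_def)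
  have decomp: "\<exists>b' c. b = b'(Suc k := c) \<and> b' (Suc k) = 0 \<and> dval Q b (Suc (Suc k)) = dval Q b' (Suc k) + c * Q (Suc k) \<and> dval Q b' (Suc k) < Q (Suc k) \<and>
     (c < a (Suc k) \<and> b' \<in> ostrowski a (Suc k) \<or> c = a (Suc k) \<and> b' \<in> ostrowski a k \<and> dval Q b' (Suc k) < Q k)" if "b \<in> ostrowski a (Suc (Suc k))" for b
  proof -
    from that consider b' c where "b = b'(Suc k := c)" "b' \<in> ostrowski a (Suc k)" "c < a (Suc k)" | b' where "b = b'(Suc k := a (Suc k))" "b' \<in> ostrowski a k"
      by auto
    then show ?thesis
    proof cases
      case 1
      then show ?thesis using IH1(1)[of b'] ostrowski_support[of b' a "Suc k"] dv by (intro exI[of _ b'] exI[of _ c]) auto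
    next
      case 2
      have "dval Q b' (Suc k) < Q k" using IH2(1) dvS 2 by simp
      moreover have "Q k \<le> Q (Suc k)" using 3(6) .
      ultimately show ?thesis using 2 ostrowski_support[of b' a k] dv by (intro exI[of _ b'] exI[of _ "a (Suc k)"]) auto
    qed
  qed
  have "dval Q b (Suc (Suc k)) < Q (Suc (Suc k))" if bb: "b \<in> ostrowski a (Suc (Suc k))" for b
  proof -
    obtain b' c where *: "dval Q b (Suc (Suc k)) = dval Q b' (Suc k) + c * Q (Suc k)" "dval Q b' (Suc k) < Q (Suc k)"
      "c < a (Suc k) \<or> c = a (Suc k) \<and> dval Q b' (Suc k) < Q k" using decomp[OF bb] by blast
    from *(3) show ?thesis
    proof
      assume "c < a (Suc k)"
      then have "Suc c * Q (Suc k) \<le> a (Suc k) * Q (Suc k)" by (intro mult_le_mono1) simp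
      then show ?thesis using * 3(5)[of k] by simp
    next
      assume "c = a (Suc k) \<and> dval Q b' (Suc k) < Q k"
      then show ?thesis using * 3(5)[of k] by simp
    qed
  qed
  moreover have "inj_on (\<lambda>b. dval Q b (Suc (Suc k))) (ostrowski a (Suc (Suc k)))"
  proof (rule inj_onI)
    fix b1 b2 assume b: "b1 \<in> ostrowski a (Suc (Suc k))" "b2 \<in> ostrowski a (Suc (Suc k))" and eq: "dval Q b1 (Suc (Suc k)) = dval Q b2 (Suc (Suc k))"
    obtain b1' c1 where 1: "b1 = b1'(Suc k := c1)" "dval Q b1 (Suc (Suc k)) = dval Q b1' (Suc k) + c1 * Q (Suc k)" "dval Q b1' (Suc k) < Q (Suc k)"
      "c1 < a (Suc k) \<and> b1' \<in> ostrowski a (Suc k) \<or> c1 = a (Suc k) \<and> b1' \<in> ostrowski a k" using decomp[OF b(1)] by blast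
    obtain b2' c2 where 2: "b2 = b2'(Suc k := c2)" "dval Q b2 (Suc (Suc k)) = dval Q b2' (Suc k) + c2 * Q (Suc k)" "dval Q b2' (Suc k) < Q (Suc k)"
      "c2 < a (Suc k) \<and> b2' \<in> ostrowski a (Suc k) \<or> c2 = a (Suc k) \<and> b2' \<in> ostrowski a k" using decomp[OF b(2)] by blast
    have c: "c1 = c2"
    proof -
      have "(dval Q b1' (Suc k) + c1 * Q (Suc k)) div Q (Suc k) = c1" using 1(3) by simp
      moreover have "(dval Q b2' (Suc k) + c2 * Q (Suc k)) div Q (Suc k) = c2" using 2(3) by simp
      ultimately show ?thesis using eq 1(2) 2(2) by simp
    qed
    then have e: "dval Q b1' (Suc k) = dval Q b2' (Suc k)" using eq 1(2) 2(2) by simp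
    have "b1' = b2'"
    proof (cases "c1 < a (Suc k)")
      case True
      then show ?thesis using e 1(4) 2(4) c IH1(2) by (auto dest: inj_onD)
    next
      case False
      then have "b1' \<in> ostrowski a k" "b2' \<in> ostrowski a k" using 1(4) 2(4) c by auto
      then show ?thesis using e dvS IH2(2) by (auto dest: inj_onD)
    qed
    then show "b1 = b2" using 1(1) 2(1) c by simp
  qed
  ultimately show ?case by blast
qed

section \<open>Recurrence of large digits\<close>

lemma den_extend_le:
  assumes "positive (w @ e)" "\<forall>a\<in>set e. a \<le> R"
  shows "real (den (w @ e)) \<le> real (R + 1) ^ length e * real (den w)"
  using assms
proof (induction e rule: rev_induct)
  case (snoc a e)
  have "den (w @ e @ [a]) = a * den (w @ e) + den' (w @ e)" using den_snoc(1)[of "w @ e" a] by simp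
  also have "\<dots> \<le> R * den (w @ e) + den (w @ e)" using snoc.prems den'_le[of "w @ e"] by (intro add_mono mult_le_mono1) auto
  also have "\<dots> = (R + 1) * den (w @ e)" by simp
  finally have "real (den (w @ e @ [a])) \<le> real ((R + 1) * den (w @ e))" by (simp only: of_nat_le_iff)
  also have "\<dots> = real (R + 1) * real (den (w @ e))" by (simp only: of_nat_mult)
  also have "\<dots> \<le> real (R + 1) * (real (R + 1) ^ length e * real (den w))"
    using snoc by (intro mult_left_mono) auto
  finally show ?case by (simp add: mult_ac)
qed simp

lemma cyl_measure_bounds:
  assumes "positive w"
  shows "1 / (2 * real (den w) ^ 2) \<le> measure lborel (cyl w)" "measure lborel (cyl w) \<le> 1 / real (den w) ^ 2"
    "measure lborel (cyl w) > 0"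
proof -
  define q q' where "q = real (den w)" "q' = real (den' w)"
  have q: "q \<ge> 1" "q' \<ge> 0" "q' \<le> q" using den_pos[OF assms] den'_le[OF assms] by (auto simp: q_q'_def)
  have m: "measure lborel (cyl w) = 1 / (q * (q + q'))" by (simp add: cyl_measure[OF assms] q_q'_def)
  have "q * (q + q') \<le> q * (2 * q)" using q by (intro mult_left_mono) auto
  then show "1 / (2 * real (den w) ^ 2) \<le> measure lborel (cyl w)"
    unfolding m q_q'_def(1)[symmetric] using q by (intro divide_left_mono mult_pos_pos) (auto simp: power2_eq_square)
  have "q * q \<le> q * (q + q')" using q by (intro mult_left_mono) auto
  then show "measure lborel (cyl w) \<le> 1 / real (den w) ^ 2"
    unfolding m q_q'_def(1)[symmetric] using q by (intro divide_left_mono mult_pos_pos) (auto simp: power2_eq_square)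
  show "measure lborel (cyl w) > 0" unfolding m using q by (intro divide_pos_pos mult_pos_pos) auto
qed

text \<open>Each appended digit multiplies the denominator by at most \<open>R + 1\<close>, so
  forcing a bounded word costs a factor depending on \<open>R\<close> only.\<close>

lemma cyl_extend_lower:
  assumes p: "positive (w @ e)" and e: "\<forall>a\<in>set e. a \<le> R" "length e \<le> R"
  shows "measure lborel (cyl (w @ e)) \<ge> 1 / (2 * real (R + 1) ^ (2 * R)) * measure lborel (cyl w)"
proof -
  have pw: "positive w" using p by auto
  have q: "real (den w) \<ge> 1" using den_pos[OF pw] by simp
  have "real (R + 1) ^ length e \<le> real (R + 1) ^ R" using e by (intro power_increasing) auto
  then have "real (den (w @ e)) \<le> real (R + 1) ^ R * real (den w)"
    using den_extend_le[OF p e(1)] by (meson mult_right_mono of_nat_0_le_iff order_trans)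
  then have "real (den (w @ e)) ^ 2 \<le> (real (R + 1) ^ R * real (den w)) ^ 2" by (intro power_mono) auto
  also have "\<dots> = real (R + 1) ^ (2 * R) * real (den w) ^ 2" by (simp add: power_mult_distrib power_mult[symmetric] mult.commute)
  finally have "2 * real (den (w @ e)) ^ 2 \<le> 2 * real (R + 1) ^ (2 * R) * real (den w) ^ 2" by simp
  then have "1 / (2 * real (R + 1) ^ (2 * R) * real (den w) ^ 2) \<le> 1 / (2 * real (den (w @ e)) ^ 2)"
    using den_pos[OF p] q by (intro divide_left_mono mult_pos_pos) auto
  also have "\<dots> \<le> measure lborel (cyl (w @ e))" by (rule cyl_measure_bounds(1)[OF p])
  finally have 1: "1 / (2 * real (R + 1) ^ (2 * R)) * (1 / real (den w) ^ 2) \<le> measure lborel (cyl (w @ e))" by simp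
  have "1 / (2 * real (R + 1) ^ (2 * R)) * measure lborel (cyl w) \<le> 1 / (2 * real (R + 1) ^ (2 * R)) * (1 / real (den w) ^ 2)"
    by (intro mult_left_mono cyl_measure_bounds(2)[OF pw]) auto
  then show ?thesis using 1 by linarith
qed

text \<open>Quasi-independence from below. Since \<open>den' v <= den v\<close> and
  \<open>num u <= den u\<close>, the denominator of the concatenation is at most twice the product
  of the denominators.\<close>

lemma cyl_append_lower:
  assumes v: "positive v" and u: "positive u"
  shows "measure lborel (cyl (v @ u)) \<ge> 1/2 * measure lborel (cyl v) * measure lborel (cyl u)"
proof -
  have p: "positive (v @ u)" using v u by auto
  define q q' where "q = real (den v)" "q' = real (den' v)"
  define r r' where "r = real (den u)" "r' = real (den' u)"
  define s s' where "s = real (num u)" "s' = real (num' u)"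
  have q: "q \<ge> 1" "q' \<ge> 0" "q' \<le> q" using den_pos[OF v] den'_le[OF v] by (auto simp: q_q'_def)
  have r: "r \<ge> 1" "r' \<ge> 0" using den_pos[OF u] by (auto simp: r_r'_def)
  have "real (num u + num' u) \<le> real (den u + den' u)" using num_le[OF u] by (simp only: of_nat_le_iff)
  then have s: "s \<le> r" "s + s' \<le> r + r'" "s \<ge> 0" using num_le[OF u] by (auto simp: r_r'_def s_s'_def)
  have "q' * s \<le> q * r" using q r s by (intro mult_mono) auto
  then have 1: "q * r + q' * s \<le> 2 * q * r" by simp
  have "q' * (s + s') \<le> q' * (r + r')" using q s by (intro mult_left_mono) auto
  then have 2: "(q * r + q' * s) + (q * r' + q' * s') \<le> (q + q') * (r + r')" by (simp add: algebra_simps)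
  have pos: "q * r + q' * s > 0" using q r s by (intro add_pos_nonneg) auto
  have pos': "(q * r + q' * s) + (q * r' + q' * s') > 0"
    using pos q r by (intro add_pos_nonneg) (auto simp: s_s'_def)
  have "(q * r + q' * s) * ((q * r + q' * s) + (q * r' + q' * s')) \<le> (2 * q * r) * ((q + q') * (r + r'))"
    using 1 2 pos pos' q r by (intro mult_mono) auto
  then have "1 / ((2 * q * r) * ((q + q') * (r + r'))) \<le> 1 / ((q * r + q' * s) * ((q * r + q' * s) + (q * r' + q' * s')))"
  proof (rule divide_left_mono)
    have d: "2 * q * r > 0" "(q + q') * (r + r') > 0" using q r by (auto intro!: mult_pos_pos add_pos_nonneg)
    show "0 < 2 * q * r * ((q + q') * (r + r')) * ((q * r + q' * s) * (q * r + q' * s + (q * r' + q' * s')))"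
      by (rule mult_pos_pos[OF mult_pos_pos[OF d] mult_pos_pos[OF pos pos']])
  qed simp
  moreover have "measure lborel (cyl (v @ u)) = 1 / ((q * r + q' * s) * ((q * r + q' * s) + (q * r' + q' * s')))"
    by (simp add: cyl_measure[OF p] den_append q_q'_def r_r'_def s_s'_def)
  moreover have "1/2 * measure lborel (cyl v) * measure lborel (cyl u) = 1 / ((2 * q * r) * ((q + q') * (r + r')))"
    by (simp add: cyl_measure[OF v] cyl_measure[OF u] q_q'_def r_r'_def)
  ultimately show ?thesis by (simp only:)
qed

text \<open>A difference of two tail events; \<open>6\<close> is the product of the factors
  \<open>2\<close> and \<open>3\<close> in the bounds for \<open>X\<close> and \<open>Y\<close>. The
  upper end \<open>2 A\<close> keeps the chosen digit polynomial in its position when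
  \<open>A\<close> is.\<close>

lemma cyl_dig_window:
  assumes w: "positive w" and A: "A \<ge> 1"
  shows "{x \<in> cyl w. A \<le> dig x (length w) \<and> dig x (length w) < 2 * A} \<in> sets lborel"
    "measure lborel {x \<in> cyl w. A \<le> dig x (length w) \<and> dig x (length w) < 2 * A} \<ge> 1 / (6 * real A) * measure lborel (cyl w)"
proof -
  let ?S = "\<lambda>A. {x \<in> cyl w. dig x (length w) \<ge> A}"
  have A2: "2 * A \<ge> 1" using A by simp
  have eq: "{x \<in> cyl w. A \<le> dig x (length w) \<and> dig x (length w) < 2 * A} = ?S A - ?S (2 * A)" by auto
  show "{x \<in> cyl w. A \<le> dig x (length w) \<and> dig x (length w) < 2 * A} \<in> sets lborel"
    unfolding eq using cyl_dig_ge_measure(1)[OF w A] cyl_dig_ge_measure(1)[OF w A2] by (rule sets.Diff)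
  define q q' where "q = real (den w)" "q' = real (den' w)"
  have q: "q \<ge> 1" "q' \<ge> 0" "q' \<le> q" using den_pos[OF w] den'_le[OF w] by (auto simp: q_q'_def)
  have a: "real A \<ge> 1" using A by simp
  define X where "X = real A * q + q'"
  define Y where "Y = 2 * real A * q + q'"
  have aq: "q \<le> real A * q" using a q by simp
  have X: "X > 0" "X \<le> 2 * (real A * q)" using q aq unfolding X_def by linarith+
  have Y: "Y > 0" "Y \<le> 3 * (real A * q)" using q aq unfolding Y_def by linarith+
  have "measure lborel (?S A - ?S (2 * A)) = measure lborel (?S A) - measure lborel (?S (2 * A))"
  proof (rule measurable_measure_Diff)
    show "?S A \<in> fmeasurable lborel" using cyl_subset[of w] cyl_dig_ge_measure(1)[OF w A] by (intro fmeasurable_irr) auto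
  qed (use cyl_dig_ge_measure(1)[OF w A2] in auto)
  also have "\<dots> = 1 / (q * X) - 1 / (q * Y)"
    using cyl_dig_ge_measure(2)[OF w A] cyl_dig_ge_measure(2)[OF w A2] by (simp add: q_q'_def X_def Y_def)
  also have "\<dots> = real A / (X * Y)"
  proof -
    have "Y - X = real A * q" by (simp add: X_def Y_def)
    moreover have "1 / (q * X) - 1 / (q * Y) = (Y - X) / (q * (X * Y))" using X Y q by (simp add: field_simps)
    ultimately show ?thesis using q by simp
  qed
  finally have m: "measure lborel (?S A - ?S (2 * A)) = real A / (X * Y)" .
  have "X * Y \<le> (2 * (real A * q)) * (3 * (real A * q))" using X Y by (intro mult_mono) auto
  then have "real A / ((2 * (real A * q)) * (3 * (real A * q))) \<le> real A / (X * Y)"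
    using X Y a q by (intro divide_left_mono mult_pos_pos) auto
  moreover have "real A / ((2 * (real A * q)) * (3 * (real A * q))) = 1 / (6 * real A) * (1 / q ^ 2)"
    using a q by (simp add: power2_eq_square)
  moreover have "1 / (6 * real A) * measure lborel (cyl w) \<le> 1 / (6 * real A) * (1 / q ^ 2)"
    unfolding q_q'_def(1) by (intro mult_left_mono cyl_measure_bounds(2)[OF w]) auto
  ultimately show "measure lborel {x \<in> cyl w. A \<le> dig x (length w) \<and> dig x (length w) < 2 * A} \<ge> 1 / (6 * real A) * measure lborel (cyl w)"
    unfolding eq m by linarith
qed

text \<open>Paley--Zygmund: the indicator of \<open>X > 0\<close> dominates \<open>2 * l * X - l\<^sup>2 * X\<^sup>2\<close> for every \<open>l\<close>.\<close>
lemma measure_UN_lower: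
  assumes J: "finite J" and S: "\<And>j. j \<in> J \<Longrightarrow> S j \<in> sets lborel" "\<And>j. j \<in> J \<Longrightarrow> S j \<subseteq> irr"
  shows "measure lborel (\<Union>j\<in>J. S j) \<ge> 2 * l * (\<Sum>j\<in>J. measure lborel (S j)) - l\<^sup>2 * (\<Sum>i\<in>J. \<Sum>j\<in>J. measure lborel (S i \<inter> S j))"
proof -
  have int: "integrable lborel (indicator T :: real \<Rightarrow> real)" if "T \<in> sets lborel" "T \<subseteq> irr" for T
    using that emeasure_eq_measure_irr[OF that(2,1)] by (simp add: less_top[symmetric])
  have UN: "(\<Union>j\<in>J. S j) \<in> sets lborel" "(\<Union>j\<in>J. S j) \<subseteq> irr" using J S by auto
  have SS: "S i \<inter> S j \<in> sets lborel" "S i \<inter> S j \<subseteq> irr" if "i \<in> J" "j \<in> J" for i j using S that by auto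
  let ?g = "\<lambda>x. 2 * l * (\<Sum>j\<in>J. indicator (S j) x) - l\<^sup>2 * (\<Sum>i\<in>J. \<Sum>j\<in>J. indicator (S i \<inter> S j) x) :: real"
  have I1: "integrable lborel (\<lambda>x. 2 * l * (\<Sum>j\<in>J. indicator (S j) x) :: real)"
    by (intro integrable_mult_right Bochner_Integration.integrable_sum int S)
  have I2: "integrable lborel (\<lambda>x. l\<^sup>2 * (\<Sum>i\<in>J. \<Sum>j\<in>J. indicator (S i \<inter> S j) x) :: real)"
    by (intro integrable_mult_right Bochner_Integration.integrable_sum int SS)
  have "integral\<^sup>L lborel ?g \<le> integral\<^sup>L lborel (indicator (\<Union>j\<in>J. S j) :: real \<Rightarrow> real)"
  proof (rule integral_mono)
    show "integrable lborel ?g" using I1 I2 by (rule Bochner_Integration.integrable_diff)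
    show "integrable lborel (indicator (\<Union>j\<in>J. S j) :: real \<Rightarrow> real)" using UN by (rule int)
    fix x
    define X where "X = (\<Sum>j\<in>J. indicator (S j) x :: real)"
    have "(\<Sum>i\<in>J. \<Sum>j\<in>J. indicator (S i \<inter> S j) x) = X\<^sup>2"
      by (simp add: X_def power2_eq_square sum_product indicator_inter_arith)
    then have g: "?g x = 2 * l * X - l\<^sup>2 * X\<^sup>2" by (simp add: X_def)
    show "?g x \<le> indicator (\<Union>j\<in>J. S j) x"
    proof (cases "x \<in> (\<Union>j\<in>J. S j)")
      case True
      have "0 \<le> (1 - l * X)\<^sup>2" by simp
      then have "2 * l * X - l\<^sup>2 * X\<^sup>2 \<le> 1" by (simp add: power2_eq_square algebra_simps)
      then show ?thesis using True g by simp
    next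
      case False
      then have "X = 0" by (auto simp: X_def)
      then show ?thesis using g by simp
    qed
  qed
  also have "integral\<^sup>L lborel (indicator (\<Union>j\<in>J. S j) :: real \<Rightarrow> real) = measure lborel (\<Union>j\<in>J. S j)"
    using UN by simp
  also have "integral\<^sup>L lborel ?g = integral\<^sup>L lborel (\<lambda>x. 2 * l * (\<Sum>j\<in>J. indicator (S j) x)) - integral\<^sup>L lborel (\<lambda>x. l\<^sup>2 * (\<Sum>i\<in>J. \<Sum>j\<in>J. indicator (S i \<inter> S j) x))"
    using I1 I2 by (rule Bochner_Integration.integral_diff)
  also have "integral\<^sup>L lborel (\<lambda>x. 2 * l * (\<Sum>j\<in>J. indicator (S j) x)) = 2 * l * (\<Sum>j\<in>J. integral\<^sup>L lborel (indicator (S j) :: real \<Rightarrow> real))"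
  proof -
    have "integral\<^sup>L lborel (\<lambda>x. \<Sum>j\<in>J. indicator (S j) x :: real) = (\<Sum>j\<in>J. integral\<^sup>L lborel (indicator (S j) :: real \<Rightarrow> real))"
      by (rule Bochner_Integration.integral_sum) (intro int S)
    then show ?thesis by simp
  qed
  also have "(\<Sum>j\<in>J. integral\<^sup>L lborel (indicator (S j) :: real \<Rightarrow> real)) = (\<Sum>j\<in>J. measure lborel (S j))"
    using S by (intro sum.cong) auto
  also have "integral\<^sup>L lborel (\<lambda>x. l\<^sup>2 * (\<Sum>i\<in>J. \<Sum>j\<in>J. indicator (S i \<inter> S j) x)) = l\<^sup>2 * (\<Sum>i\<in>J. \<Sum>j\<in>J. integral\<^sup>L lborel (indicator (S i \<inter> S j) :: real \<Rightarrow> real))"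
  proof -
    have "integral\<^sup>L lborel (\<lambda>x. \<Sum>i\<in>J. \<Sum>j\<in>J. indicator (S i \<inter> S j) x :: real) = (\<Sum>i\<in>J. integral\<^sup>L lborel (\<lambda>x. \<Sum>j\<in>J. indicator (S i \<inter> S j) x))"
      by (rule Bochner_Integration.integral_sum) (intro Bochner_Integration.integrable_sum int SS)
    also have "\<dots> = (\<Sum>i\<in>J. \<Sum>j\<in>J. integral\<^sup>L lborel (indicator (S i \<inter> S j) :: real \<Rightarrow> real))"
      by (intro sum.cong refl Bochner_Integration.integral_sum int SS)
    finally show ?thesis by simp
  qed
  also have "(\<Sum>i\<in>J. \<Sum>j\<in>J. integral\<^sup>L lborel (indicator (S i \<inter> S j) :: real \<Rightarrow> real)) = (\<Sum>i\<in>J. \<Sum>j\<in>J. measure lborel (S i \<inter> S j))"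
    using SS by (intro sum.cong refl) auto
  finally show ?thesis .
qed

text \<open>A quantitative form relative to a set of measure \<mu>: first and second moments over a
  finite stretch bound the measure of the tail unions from below, uniformly in the starting index,
  and these unions decrease to the limsup.\<close>

lemma Kochen_Stone:
  fixes F :: "nat \<Rightarrow> real set" and p :: "nat \<Rightarrow> real"
  assumes F: "\<And>l. F l \<in> sets lborel" "\<And>l. F l \<subseteq> irr"
    and p: "\<And>l. p l \<ge> 0" "\<not> summable p"
    and c: "c > 0" "C > 0" "\<mu> > 0"
    and lower: "\<And>l. measure lborel (F l) \<ge> c * p l * \<mu>"
    and upper: "\<And>l. measure lborel (F l) \<le> C * p l * \<mu>"
    and pair: "\<And>k l. k < l \<Longrightarrow> measure lborel (F k \<inter> F l) \<le> C * (p k * p l) * \<mu>"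
  shows "measure lborel (\<Inter>n. \<Union>l\<in>{n..}. F l) \<ge> c\<^sup>2 / (2 * C) * \<mu>"
proof -
  let ?U = "\<lambda>n. \<Union>l\<in>{n..}. F l"
  have U: "?U n \<in> sets lborel" "?U n \<subseteq> irr" for n using F by auto
  have pair': "measure lborel (F k \<inter> F l) \<le> C * (p k * p l) * \<mu> + (if k = l then C * p k * \<mu> else 0)" for k l
  proof (cases k l rule: linorder_cases)
    case less then show ?thesis using pair by simp
  next
    case greater
    have "measure lborel (F k \<inter> F l) = measure lborel (F l \<inter> F k)" by (simp only: Int_commute)
    then show ?thesis using greater pair[OF greater] by (simp add: mult.commute)
  next
    case equal
    have "C * (p k * p k) * \<mu> \<ge> 0" using c p by simp
    then show ?thesis using equal upper[of k] by simp
  qed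
  have big: "measure lborel (?U n) \<ge> c\<^sup>2 / (2 * C) * \<mu>" for n
  proof -
    \<comment> \<open>A stretch of total weight \<open>s >= 1\<close> makes the diagonal terms, of
      order \<open>s\<close>, no larger than the \<open>s\<^sup>2\<close> of the other
      terms.\<close>
    have "\<exists>m. (\<Sum>l\<in>{n..<m}. p l) \<ge> 1"
    proof (rule ccontr)
      assume no: "\<not> (\<exists>m. (\<Sum>l\<in>{n..<m}. p l) \<ge> 1)"
      have "summable p"
      proof (rule summableI_nonneg_bounded)
        fix m
        have "(\<Sum>l<m. p l) \<le> (\<Sum>l\<in>{..<n} \<union> {n..<m}. p l)" using p(1) by (intro sum_mono2) auto
        also have "\<dots> = (\<Sum>l<n. p l) + (\<Sum>l\<in>{n..<m}. p l)" by (intro sum.union_disjoint) auto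
        also have "\<dots> \<le> (\<Sum>l<n. p l) + 1" using no by (simp add: not_le less_imp_le)
        finally show "(\<Sum>l<m. p l) \<le> (\<Sum>l<n. p l) + 1" .
      qed (use p in auto)
      then show False using p by blast
    qed
    then obtain m where m: "(\<Sum>l\<in>{n..<m}. p l) \<ge> 1" by blast
    let ?J = "{n..<m}"
    define s where "s = (\<Sum>l\<in>?J. p l)"
    have s: "s \<ge> 1" using m by (simp add: s_def)
    \<comment> \<open>The maximiser of \<open>2 l c s - 2 C l\<^sup>2 s\<^sup>2\<close>, with value
      \<open>c\<^sup>2 / (2 C)\<close> independent of the stretch.\<close>
    define l where "l = c / (2 * C * s)"
    have l: "l > 0" using c s by (simp add: l_def)
    have 1: "(\<Sum>j\<in>?J. measure lborel (F j)) \<ge> c * s * \<mu>"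
    proof -
      have "c * s * \<mu> = (\<Sum>j\<in>?J. c * p j * \<mu>)" by (simp add: s_def sum_distrib_left sum_distrib_right)
      also have "\<dots> \<le> (\<Sum>j\<in>?J. measure lborel (F j))" using lower by (intro sum_mono)
      finally show ?thesis .
    qed
    have 2: "(\<Sum>i\<in>?J. \<Sum>j\<in>?J. measure lborel (F i \<inter> F j)) \<le> 2 * C * s\<^sup>2 * \<mu>"
    proof -
      have "(\<Sum>i\<in>?J. \<Sum>j\<in>?J. measure lborel (F i \<inter> F j)) \<le> (\<Sum>i\<in>?J. \<Sum>j\<in>?J. C * (p i * p j) * \<mu> + (if i = j then C * p i * \<mu> else 0))"
        using pair' by (intro sum_mono)
      also have "\<dots> = C * (s * s) * \<mu> + C * s * \<mu>"
      proof -
        have "(\<Sum>i\<in>?J. \<Sum>j\<in>?J. C * (p i * p j) * \<mu>) = C * (s * s) * \<mu>"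
          unfolding s_def sum_product sum_distrib_left sum_distrib_right by (rule sum.swap)
        moreover have "(\<Sum>i\<in>?J. C * p i * \<mu>) = C * s * \<mu>"
          unfolding s_def sum_distrib_left sum_distrib_right ..
        ultimately show ?thesis by (simp add: sum.distrib)
      qed
      also have "\<dots> \<le> C * (s * s) * \<mu> + C * (s * s) * \<mu>"
        using s c by (intro add_left_mono mult_right_mono mult_left_mono) auto
      finally show ?thesis by (simp add: power2_eq_square mult_ac)
    qed
    have "c\<^sup>2 / (2 * C) * \<mu> = 2 * l * (c * s * \<mu>) - l\<^sup>2 * (2 * C * s\<^sup>2 * \<mu>)"
      using c s by (simp add: l_def field_simps power2_eq_square)
    also have "\<dots> \<le> 2 * l * (\<Sum>j\<in>?J. measure lborel (F j)) - l\<^sup>2 * (\<Sum>i\<in>?J. \<Sum>j\<in>?J. measure lborel (F i \<inter> F j))"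
      using 1 2 l by (intro diff_mono mult_left_mono) auto
    also have "\<dots> \<le> measure lborel (\<Union>j\<in>?J. F j)"
      using F by (intro measure_UN_lower) auto
    also have "\<dots> \<le> measure lborel (?U n)"
      using F U by (intro measure_mono_fmeasurable fmeasurable_irr) auto
    finally show ?thesis .
  qed
  have "(\<lambda>n. measure lborel (?U n)) \<longlonglongrightarrow> measure lborel (\<Inter>n. ?U n)"
  proof (rule Lim_measure_decseq)
    show "range ?U \<subseteq> sets lborel" using U by auto
    show "decseq ?U" unfolding decseq_def by (intro allI impI UN_mono) auto
    show "emeasure lborel (?U i) \<noteq> \<infinity>" for i using emeasure_eq_measure_irr[OF U(2,1)] by simp
  qed
  then show ?thesis using big by (intro LIMSEQ_le_const) auto
qed

lemma cyl_diameter: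
  assumes "positive w" "y \<in> cyl w" "z \<in> cyl w"
  shows "\<bar>y - z\<bar> \<le> 1 / real (den w) ^ 2"
proof -
  obtain s t where st: "s \<in> irr" "t \<in> irr" "y = mob w s" "z = mob w t"
    using assms by (auto simp: cyl_mob)
  define q q' where "q = real (den w)" "q' = real (den' w)"
  have q: "q \<ge> 1" "q' \<ge> 0" using den_pos[OF assms(1)] by (auto simp: q_q'_def)
  have s: "0 < s" "s < 1" "0 < t" "t < 1" using st irrD by auto
  have "\<bar>y - z\<bar> = \<bar>s - t\<bar> / ((q + s * q') * (q + t * q'))"
  proof -
    have p: "q + s * q' > 0" "q + t * q' > 0" using q s by (auto intro!: add_pos_nonneg)
    show ?thesis
      using mob_diff[OF assms(1), of t s] s p unfolding st(3,4) q_q'_def[symmetric] by (simp add: abs_mult)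
  qed
  also have "\<dots> \<le> 1 / (q * q)"
  proof (rule frac_le)
    show "q * q \<le> (q + s * q') * (q + t * q')" using q s by (intro mult_mono) auto
  qed (use s q in auto)
  finally show ?thesis by (simp add: q_q'_def power2_eq_square)
qed

text \<open>Knopp's lemma. The complement \<open>Z\<close>, of measure \<open>z\<close>, takes at
  most the proportion \<open>1 - \<delta>\<close> of every cylinder. Filling an open set of measure
  close to \<open>z\<close> around \<open>Z\<close> with cylinders gives
  \<open>z <= (1 - \<delta>) (z + e)\<close> for every positive \<open>e\<close>, which forces
  \<open>z = 0\<close>.\<close>

lemma full_measure_of_local:
  assumes L: "L \<in> sets lborel" "L \<subseteq> irr" and \<delta>: "\<delta> > 0"
    and loc: "\<And>w. positive w \<Longrightarrow> measure lborel (L \<inter> cyl w) \<ge> \<delta> * measure lborel (cyl w)"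
  shows "AE x in lborel. x \<in> irr \<longrightarrow> x \<in> L"
proof -
  define Z where "Z = irr - L"
  have Z: "Z \<in> sets lborel" "Z \<subseteq> irr" using L irr_sets by (auto simp: Z_def)
  define z where "z = measure lborel Z"
  have z0: "z \<ge> 0" by (simp add: z_def)
  have \<delta>1: "\<delta> \<le> 1"
  proof -
    have "\<delta> * measure lborel (cyl []) \<le> measure lborel (L \<inter> cyl [])" by (rule loc) simp
    also have "\<dots> \<le> measure lborel (cyl [])"
      using L cyl_subset cyl_sets by (intro measure_mono_fmeasurable fmeasurable_irr) auto
    finally show ?thesis by (simp add: cyl_measure)
  qed
  have loc': "measure lborel (Z \<inter> cyl w) \<le> (1 - \<delta>) * measure lborel (cyl w)" if "positive w" for w
  proof -
    have "Z \<inter> cyl w = cyl w - L \<inter> cyl w" using cyl_subset[of w] by (auto simp: Z_def)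
    also have "measure lborel \<dots> = measure lborel (cyl w) - measure lborel (L \<inter> cyl w)"
      using L cyl_subset[of w] cyl_sets[of w] by (intro measurable_measure_Diff fmeasurable_irr) auto
    finally show ?thesis using loc[OF that] by (simp add: algebra_simps)
  qed
  have key: "z \<le> (1 - \<delta>) * (z + e)" if e: "e > 0" for e
  proof -
    obtain U where U: "open U" "Z \<subseteq> U" "emeasure lborel (U - Z) < ennreal e"
      using outer_regular_lborel[OF _ e, of Z] Z by auto
    \<comment> \<open>Cylinders of one fixed length are disjoint. As \<open>n\<close> grows their
      union increases, and it exhausts \<open>Z\<close> because the diameters shrink to
      zero.\<close>
    define I where "I = (\<lambda>n. {w. length w = n \<and> positive w \<and> cyl w \<subseteq> U})"
    define On where "On = (\<lambda>n. \<Union>w\<in>I n. cyl w)"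
    have On: "On n \<in> sets lborel" "On n \<subseteq> irr" "On n \<subseteq> U" for n
      unfolding On_def using cyl_sets cyl_subset by (auto intro!: sets.countable_UN' countableI_type simp: I_def simp del: sets_lborel)
    have 1: "measure lborel (Z \<inter> On n) \<le> (1 - \<delta>) * (z + e)" for n
    proof -
      have "Z \<inter> On n = (\<Union>w\<in>I n. Z \<inter> cyl w)" by (auto simp: On_def)
      also have "measure lborel \<dots> \<le> (1 - \<delta>) * measure lborel (\<Union>w\<in>I n. cyl w)"
      proof (rule compare_union)
        show "disjoint_family_on cyl (I n)" "disjoint_family_on (\<lambda>w. Z \<inter> cyl w) (I n)"
          using disjoint_cyl[of n] by (auto simp: I_def disjoint_family_on_def)
        show "Z \<inter> cyl w \<in> sets lborel" for w using Z cyl_sets by blast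
        show "cyl w \<in> sets lborel" for w by (rule cyl_sets)
        show "measure lborel (Z \<inter> cyl w) \<le> (1 - \<delta>) * measure lborel (cyl w)" if "w \<in> I n" for w
          using loc' that by (auto simp: I_def)
      qed (use Z cyl_subset \<delta>1 in \<open>auto intro: countableI_type\<close>)
      also have "measure lborel (\<Union>w\<in>I n. cyl w) \<le> z + e"
      proof -
        have UZ: "irr \<inter> U - Z \<in> sets lborel" using U(1) Z irr_sets by auto
        have "emeasure lborel (irr \<inter> U - Z) \<le> emeasure lborel (U - Z)"
          using U(1) Z by (intro emeasure_mono) auto
        also note U(3)
        finally have "emeasure lborel (irr \<inter> U - Z) < ennreal e" .
        moreover have "emeasure lborel (irr \<inter> U - Z) = ennreal (measure lborel (irr \<inter> U - Z))"
          by (rule emeasure_eq_measure_irr[OF _ UZ]) auto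
        ultimately have "ennreal (measure lborel (irr \<inter> U - Z)) \<le> ennreal e" by simp
        then have "measure lborel (irr \<inter> U - Z) \<le> e" using e by (simp add: ennreal_le_iff)
        have sub: "On n \<subseteq> Z \<union> (irr \<inter> U - Z)" using On[of n] by auto
        have "measure lborel (On n) \<le> measure lborel (Z \<union> (irr \<inter> U - Z))"
          using Z(2) by (intro measure_mono_fmeasurable[OF sub On(1)] fmeasurable_irr sets.Un Z(1) UZ) auto
        also have "\<dots> \<le> z + measure lborel (irr \<inter> U - Z)"
          unfolding z_def using Z UZ by (intro measure_Un_le)
        finally show ?thesis using \<open>measure lborel (irr \<inter> U - Z) \<le> e\<close> by (simp add: On_def)
      qed
      finally show ?thesis using \<delta>1 by (simp add: mult_left_mono)
    qed
    have "(\<lambda>n. measure lborel (Z \<inter> On n)) \<longlonglongrightarrow> measure lborel (\<Union>n. Z \<inter> On n)"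
    proof (rule Lim_measure_incseq)
      show "range (\<lambda>n. Z \<inter> On n) \<subseteq> sets lborel" using Z On by auto
      show "incseq (\<lambda>n. Z \<inter> On n)"
      proof (rule incseq_SucI)
        fix n
        show "Z \<inter> On n \<subseteq> Z \<inter> On (Suc n)"
        proof
          fix x assume x: "x \<in> Z \<inter> On n"
          then obtain w where w: "w \<in> I n" "x \<in> cyl w" by (auto simp: On_def)
          have xi: "x \<in> irr" using w cyl_subset by auto
          have "cyl (pre x (Suc n)) \<subseteq> cyl w"
          proof
            fix y assume "y \<in> cyl (pre x (Suc n))"
            then have y: "y \<in> irr" "pre y (Suc n) = pre x (Suc n)" by (auto simp: cyl_def)
            then have "pre y n = pre x n" using pre_eq_mono[of y "Suc n" x n] by simp
            then show "y \<in> cyl w" using y w by (auto simp: cyl_def I_def)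
          qed
          then have "pre x (Suc n) \<in> I (Suc n)" using w pre_positive[OF xi] by (auto simp: I_def)
          moreover have "x \<in> cyl (pre x (Suc n))" using xi by (simp add: cyl_def)
          ultimately show "x \<in> Z \<inter> On (Suc n)" using x by (auto simp: On_def)
        qed
      qed
      have "(\<Union>n. Z \<inter> On n) \<in> sets lborel" "(\<Union>n. Z \<inter> On n) \<subseteq> irr" using Z On by auto
      then show "emeasure lborel (\<Union>n. Z \<inter> On n) \<noteq> \<infinity>" using emeasure_eq_measure_irr by simp
    qed
    moreover have "(\<Union>n. Z \<inter> On n) = Z"
    proof (intro equalityI subsetI)
      fix x assume x: "x \<in> Z"
      then have xi: "x \<in> irr" "x \<in> U" using Z U by auto
      obtain r where r: "r > 0" "ball x r \<subseteq> U" using U(1) xi(2) open_contains_ball by blast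
      obtain k where k: "(1/4 :: real) ^ k < r" using real_arch_pow_inv[OF r(1), of "1/4"] by auto
      define w where "w = pre x (2 * k)"
      have w: "positive w" "length w = 2 * k" "x \<in> cyl w"
        using pre_positive[OF xi(1)] xi by (auto simp: w_def cyl_def)
      have "2 ^ k \<le> den w" using qd_ge_power[OF xi(1), of "2 * k"] by (simp add: w_def qd_def)
      then have "real (2 ^ k) \<le> real (den w)" by (simp only: of_nat_le_iff)
      then have "(2 ^ k)\<^sup>2 \<le> real (den w) ^ 2" by (intro power_mono) auto
      then have "1 / real (den w) ^ 2 \<le> 1 / (2 ^ k)\<^sup>2" by (intro divide_left_mono mult_pos_pos) (use den_pos[OF w(1)] in auto)
      also have "1 / (2 ^ k)\<^sup>2 = (1/4 :: real) ^ k" by (simp add: power_mult[symmetric] mult.commute[of k 2] power_divide) (simp add: power_mult)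
      finally have d: "1 / real (den w) ^ 2 < r" using k by linarith
      have "cyl w \<subseteq> U"
      proof
        fix y assume "y \<in> cyl w"
        then have "\<bar>x - y\<bar> < r" using cyl_diameter[OF w(1,3)] d by fastforce
        then show "y \<in> U" using r by (auto simp: dist_real_def)
      qed
      then show "x \<in> (\<Union>n. Z \<inter> On n)" using x w by (auto simp: On_def I_def)
    qed auto
    ultimately have "(\<lambda>n. measure lborel (Z \<inter> On n)) \<longlonglongrightarrow> z" by (simp add: z_def)
    then show ?thesis using 1 by (intro LIMSEQ_le_const2) auto
  qed
  have "z = 0"
  proof (rule ccontr)
    assume "z \<noteq> 0"
    then have zp: "z > 0" using z0 by simp
    define e where "e = \<delta> * z / 2"
    have "z \<le> (1 - \<delta>) * (z + e)" using zp \<delta> by (intro key) (simp add: e_def)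
    also have "\<dots> = z - \<delta> * z / 2 - \<delta> * e" by (simp add: e_def field_simps)
    finally have "\<delta> * z / 2 + \<delta> * e \<le> 0" by simp
    moreover have "\<delta> * z / 2 > 0" "\<delta> * e > 0" using \<delta> zp by (auto simp: e_def)
    ultimately show False by linarith
  qed
  then have "emeasure lborel Z = 0" using emeasure_eq_measure_irr[OF Z(2,1)] by (simp add: z_def)
  then have "Z \<in> null_sets lborel" using Z(1) by (rule null_setsI)
  then have "AE x in lborel. x \<notin> Z" by (rule AE_not_in)
  then show ?thesis by eventually_elim (auto simp: Z_def)
qed

section \<open>Large sums\<close>

lemma sum_window:
  fixes h :: "nat \<Rightarrow> 'a :: comm_monoid_add"
  assumes "\<And>i. i < n \<Longrightarrow> \<not> (m \<le> i \<and> i < m + j) \<Longrightarrow> h i = 0" "m + j \<le> n"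
  shows "(\<Sum>i<Suc n. h i) = (\<Sum>i<j. h (m + i)) + h n"
proof -
  have "(\<Sum>i<n. h i) = (\<Sum>i\<in>{m..<m + j}. h i)" using assms by (intro sum.mono_neutral_right) auto
  also have "\<dots> = (\<Sum>i<j. h (m + i))"
    using sum.shift_bounds_nat_ivl[of h 0 m j] by (simp add: add.commute atLeast0LessThan)
  finally show ?thesis by simp
qed

context jump_data
begin

text \<open>The main term contributed by a block, with signs and denominators computed as if
  \<open>u\<close> stood at the beginning of the expansion.\<close>

definition jump_sum :: "nat list \<Rightarrow> (nat \<Rightarrow> nat) \<Rightarrow> real" where
  "jump_sum u b = (\<Sum>i<length u. (-1) ^ i * real (u ! i) * jump_term (den (take i u)) ((-1) ^ i * real (b i) / real (u ! i)))"

text \<open>At least half of the digit vectors of \<open>u\<close> have a nonnegative main term. If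
  this fails, more than half have a negative one, so one of the two parities is always
  favourable.\<close>

definition good :: "nat list \<Rightarrow> bool" where
  "good u \<longleftrightarrow> card (ostrowski ((!) u) (length u)) \<le> 2 * card {b \<in> ostrowski ((!) u) (length u). jump_sum u b \<ge> 0}"

lemma qd_double: assumes "x \<in> irr" shows "2 * qd x k \<le> qd x (Suc (Suc k))"
proof -
  have p: "pre x (Suc (Suc k)) = pre x k @ [dig x k, dig x (Suc k)]" by (simp add: pre_Suc)
  show ?thesis unfolding qd_def p
    using dig_pos[OF assms] pre_positive[OF assms] by (intro den_fib) auto
qed

text \<open>The digit vectors of the middle block \<open>u\<close> are used as they are if \<open>v\<close> has even length, and
  complemented if it has odd length: the two choices flip the sign of the Birkhoff sum.\<close>
lemma many_large_sums:
  assumes x: "x \<in> irr" and n: "n = length v + length u + length g" and pre: "pre x n = v @ u @ g"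
    and st: "state d v = (1, 0)" "state d (v @ u @ g) = (1, 0)" and g: "length g \<ge> 2"
    and sel: "even (length v) \<and> good u \<or> odd (length v) \<and> \<not> good u"
  shows "\<exists>S. finite S \<and> den u \<le> 2 * card S \<and> (\<forall>N\<in>S. N < qd x n \<and> (\<forall>c\<le>dig x n.
     birkhoff_S f x q0 (N + c * qd x n) \<ge> (-1) ^ n * real (dig x n) * jump_term 1 ((-1) ^ n * real c / real (dig x n))
       - C1 * real (length u + 1) - (\<Sum>i<Suc n. real (dig x i) * V / real (qd x i))))"
proof -
  define m where "m = length v"
  define j where "j = length u"
  define a where "a = (\<lambda>i. dig x (m + i))"
  define Q where "Q = (\<lambda>i. qd x (m + i))"
  have nj: "n = m + j + length g" by (simp add: n m_def j_def)
  have au: "a i = u ! i" if "i < j" for i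
  proof -
    have "(v @ u @ g) ! (m + i) = u ! i" using that by (simp add: m_def j_def nth_append)
    moreover have "pre x n ! (m + i) = dig x (m + i)" using that by (intro nth_pre) (simp add: nj)
    ultimately show ?thesis unfolding pre by (simp add: a_def)
  qed
  have takes: "pre x (m + i) = v @ take i u" if "i \<le> j" for i
  proof -
    have "pre x (m + i) = take (m + i) (pre x n)" using that by (intro take_pre[symmetric]) (simp add: nj)
    also have "\<dots> = v @ take i u" unfolding pre using that by (simp add: m_def j_def)
    finally show ?thesis .
  qed
  have d1: "1 < d" using d(1) by simp
  have stv: "den v mod d = 1" "den' v mod d = 0" using st(1) by (auto simp: state_def)
  \<comment> \<open>After the prefix \<open>v\<close> with residues \<open>(1, 0)\<close> the
    denominators of \<open>x\<close> have the residues of the denominators of \<open>u\<close>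
    alone.\<close>
  have GGu: "jump_term (Q i) = jump_term (den (take i u))" if "i \<le> j" for i
  proof (rule jump_term_mod)
    have "Q i = den v * den (take i u) + den' v * num (take i u)"
      by (simp add: Q_def qd_def takes[OF that] den_append)
    moreover have "(den v * den (take i u) + den' v * num (take i u)) mod d = (1 * den (take i u) + 0 * num (take i u)) mod d"
      using stv d1 by (intro mod_add_cong mod_mult_cong) auto
    ultimately show "Q i mod d = den (take i u) mod d" by simp
  qed
  have GGn: "jump_term (qd x n) = jump_term 1"
    using st(2) d1 unfolding qd_def pre by (intro jump_term_mod) (simp add: state_def)
  have BSa: "ostrowski a j = ostrowski ((!) u) j" using au by (intro ostrowski_cong) auto
  have cardBS: "card (ostrowski a j) = den u"
  proof -
    have "map a [0..<j] = u" using au by (intro nth_equalityI) (auto simp: j_def)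
    then show ?thesis by (simp add: ostrowski_card)
  qed
  have Qrec: "Q (Suc i) = a i * Q i + den' (pre x (m + i))" for i
    by (simp add: Q_def a_def qd_Suc(1)[OF x])
  have dv: "(\<forall>b\<in>ostrowski a j. dval Q b j < Q j) \<and> inj_on (\<lambda>b. dval Q b j) (ostrowski a j)"
  proof (rule ostrowski_dval)
    show "Q 0 \<ge> 1" unfolding Q_def by (rule qd_pos[OF x])
    show "a 0 * Q 0 \<le> Q 1" using Qrec[of 0] by simp
    show "Q (Suc (Suc i)) = a (Suc i) * Q (Suc i) + Q i" for i
      using Qrec[of "Suc i"] qd_Suc(2)[OF x, of "m + i"] by (simp add: Q_def)
    show "Q i \<le> Q (Suc i)" for i unfolding Q_def by (rule qd_mono[OF x]) simp
  qed
  \<comment> \<open>Telescoping of \<open>a i * Q i = Q (i + 1) - Q (i - 1)\<close>. Complemented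
    digit vectors may violate the Ostrowski rule, so their values are bounded through the vector of
    all maximal digits.\<close>
  have full: "dval Q a k + qd x m + den' (pre x m) = Q k + den' (pre x (m + k))" for k
  proof (induction k)
    case (Suc k)
    have "den' (pre x (m + Suc k)) = Q k" using qd_Suc(2)[OF x, of "m + k"] by (simp add: Q_def)
    then show ?case using Suc Qrec[of k] by (simp add: dval_def)
  qed (simp add: dval_def Q_def)
  \<comment> \<open>The two or more digits of \<open>g\<close> double the denominator, which makes
    room for complemented values up to almost \<open>2 * Q j\<close> below
    \<open>qd x n\<close>.\<close>
  have Q2: "2 * Q j \<le> qd x n"
  proof -
    have "2 * Q j \<le> qd x (Suc (Suc (m + j)))" unfolding Q_def by (rule qd_double[OF x])
    also have "\<dots> \<le> qd x n" using g by (intro qd_mono[OF x]) (simp add: nj)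
    finally show ?thesis .
  qed
  have full_lt: "dval Q a j < qd x n"
  proof -
    have "den' (pre x (m + j)) \<le> Q j" unfolding Q_def using qd_den_le[OF x] .
    moreover have "qd x m \<ge> 1" using qd_pos[OF x] .
    ultimately show ?thesis using full[of j] Q2 by linarith
  qed
  let ?E = "C1 * real (j + 1) + (\<Sum>i<Suc n. real (dig x i) * V / real (qd x i))"
  let ?top = "\<lambda>c. (-1) ^ n * real (dig x n) * jump_term 1 ((-1) ^ n * real c / real (dig x n))"
  have main: "birkhoff_S f x q0 (dval Q b j + c * qd x n) \<ge>
      (\<Sum>i<j. (-1) ^ (m + i) * real (u ! i) * jump_term (den (take i u)) ((-1) ^ (m + i) * real (b i) / real (u ! i))) + ?top c - ?E"
    if b: "\<And>i. b i \<le> a i" and c: "c \<le> dig x n" for b c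
  proof -
    \<comment> \<open>The digits of \<open>b\<close> occupy the block and \<open>c\<close> the top
      position; all digits of the prefix and of \<open>g\<close> are zero.\<close>
    define \<beta> where "\<beta> = (\<lambda>i. if i < m then 0 else if i < m + j then b (i - m) else if i = n then c else 0)"
    have \<beta>: "\<beta> i \<le> dig x i" for i using b[of "i - m"] c by (auto simp: \<beta>_def a_def)
    have \<beta>v: "\<beta> (m + i) = b i" if "i < j" for i using that by (simp add: \<beta>_def)
    have \<beta>n: "\<beta> n = c" using g by (simp add: \<beta>_def nj)
    have \<beta>0: "\<beta> i = 0" if "i < n" "\<not> (m \<le> i \<and> i < m + j)" for i using that by (auto simp: \<beta>_def)
    have mj: "m + j \<le> n" by (simp add: nj)
    let ?\<Lambda> = "\<lambda>i. (-1) ^ i * real (dig x i) * jump_term (qd x i) ((-1) ^ i * real (\<beta> i) / real (dig x i))"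
    have N: "(\<Sum>i<Suc n. \<beta> i * qd x i) = dval Q b j + c * qd x n"
      using sum_window[of n m j "\<lambda>i. \<beta> i * qd x i", OF _ mj] \<beta>0 \<beta>v \<beta>n by (simp add: dval_def Q_def)
    have "(\<Sum>i<Suc n. ?\<Lambda> i) = (\<Sum>i<j. ?\<Lambda> (m + i)) + ?\<Lambda> n"
      by (rule sum_window[OF _ mj]) (simp add: \<beta>0)
    moreover have "(\<Sum>i<j. ?\<Lambda> (m + i)) = (\<Sum>i<j. (-1) ^ (m + i) * real (u ! i) * jump_term (den (take i u)) ((-1) ^ (m + i) * real (b i) / real (u ! i)))"
    proof (rule sum.cong[OF refl])
      fix i assume "i \<in> {..<j}"
      then have i: "i < j" by simp
      have "dig x (m + i) = u ! i" using au[OF i] by (simp add: a_def)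
      moreover have "jump_term (qd x (m + i)) = jump_term (den (take i u))" using GGu[of i] i by (simp add: Q_def)
      ultimately show "?\<Lambda> (m + i) = (-1) ^ (m + i) * real (u ! i) * jump_term (den (take i u)) ((-1) ^ (m + i) * real (b i) / real (u ! i))"
        by (simp only: \<beta>v[OF i])
    qed
    moreover have "?\<Lambda> n = ?top c" by (simp only: \<beta>n GGn)
    moreover have "err x \<beta> (Suc n) \<le> ?E"
    proof -
      let ?h = "\<lambda>i. if \<beta> i = 0 then 0 else C1"
      have "err x \<beta> (Suc n) \<le> (\<Sum>i<Suc n. ?h i + real (dig x i) * V / real (qd x i))"
        unfolding err_def using V_nonneg by (intro sum_mono) auto
      also have "\<dots> = (\<Sum>i<Suc n. ?h i) + (\<Sum>i<Suc n. real (dig x i) * V / real (qd x i))" by (rule sum.distrib)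
      also have "(\<Sum>i<Suc n. ?h i) = (\<Sum>i<j. ?h (m + i)) + ?h n"
        by (rule sum_window[OF _ mj]) (simp add: \<beta>0)
      also have "(\<Sum>i<j. ?h (m + i)) \<le> (\<Sum>i<j. C1)" using C1_nonneg by (intro sum_mono) auto
      also have "?h n \<le> C1" using C1_nonneg by simp
      finally show ?thesis by (simp add: algebra_simps)
    qed
    ultimately show ?thesis
      using birkhoff_levels[OF x \<beta>, of "Suc n"] unfolding N by linarith
  qed
  show ?thesis
  proof (cases "even m")
    case True
    then have gd: "good u" using sel by (simp add: m_def)
    define T where "T = {b \<in> ostrowski a j. jump_sum u b \<ge> 0}"
    have T: "T \<subseteq> ostrowski a j" "finite T" using ostrowski_finite[of a j] by (auto simp: T_def)
    define S where "S = (\<lambda>b. dval Q b j) ` T"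
    have "card S = card T" unfolding S_def using dv T(1) by (intro card_image) (auto intro: inj_on_subset)
    moreover have "den u \<le> 2 * card T" using gd unfolding good_def T_def j_def[symmetric] BSa[symmetric] cardBS .
    moreover have "N < qd x n \<and> (\<forall>c\<le>dig x n. birkhoff_S f x q0 (N + c * qd x n) \<ge> ?top c - C1 * real (j + 1) - (\<Sum>i<Suc n. real (dig x i) * V / real (qd x i)))"
      if "N \<in> S" for N
    proof -
      obtain b where b: "b \<in> T" "N = dval Q b j" using \<open>N \<in> S\<close> by (auto simp: S_def)
      have bB: "b \<in> ostrowski a j" "jump_sum u b \<ge> 0" using b by (auto simp: T_def)
      have ba: "\<And>i. b i \<le> a i" using ostrowski_support[OF bB(1)] by blast
      have "N < Q j" using dv bB b by auto
      then have "N < qd x n" using Q2 by linarith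
      moreover have "(\<Sum>i<j. (-1) ^ (m + i) * real (u ! i) * jump_term (den (take i u)) ((-1) ^ (m + i) * real (b i) / real (u ! i))) = jump_sum u b"
        using True by (simp add: jump_sum_def j_def power_add)
      ultimately show ?thesis using main[OF ba] bB(2) b(2) by force
    qed
    ultimately show ?thesis using T by (intro exI[of _ S]) (auto simp: S_def j_def)
  next
    case False
    then have gd: "\<not> good u" using sel by (simp add: m_def)
    define T where "T = {b \<in> ostrowski a j. jump_sum u b < 0}"
    have T: "T \<subseteq> ostrowski a j" "finite T" using ostrowski_finite[of a j] by (auto simp: T_def)
    have "ostrowski a j = {b \<in> ostrowski a j. jump_sum u b \<ge> 0} \<union> T" by (auto simp: T_def)
    then have "card (ostrowski a j) \<le> card {b \<in> ostrowski a j. jump_sum u b \<ge> 0} + card T" by (metis card_Un_le)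
    moreover have "2 * card {b \<in> ostrowski a j. jump_sum u b \<ge> 0} < card (ostrowski a j)"
      using gd unfolding good_def j_def[symmetric] BSa[symmetric] by simp
    ultimately have cT: "den u \<le> 2 * card T" using cardBS by linarith
    \<comment> \<open>Values of a vector and its complement add up to a constant, so the
      complemented values are distinct as well.\<close>
    define cmp where "cmp = (\<lambda>b i. a i - b i)"
    have cval: "dval Q (cmp b) j + dval Q b j = dval Q a j" if "b \<in> ostrowski a j" for b
    proof -
      have "cmp b i * Q i + b i * Q i = a i * Q i" for i
        using ostrowski_support[OF that] by (simp add: cmp_def add_mult_distrib[symmetric])
      then show ?thesis by (simp add: dval_def sum.distrib[symmetric])
    qed
    define S where "S = (\<lambda>b. dval Q (cmp b) j) ` T"
    have "inj_on (\<lambda>b. dval Q (cmp b) j) T"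
    proof (rule inj_onI)
      fix b b' assume b: "b \<in> T" "b' \<in> T" "dval Q (cmp b) j = dval Q (cmp b') j"
      have "b \<in> ostrowski a j" "b' \<in> ostrowski a j" using b T(1) by auto
      then have "dval Q b j = dval Q b' j" using cval[of b] cval[of b'] b(3) by linarith
      then show "b = b'" using dv b T(1) by (auto dest: inj_onD)
    qed
    then have "card S = card T" unfolding S_def by (rule card_image)
    moreover have "N < qd x n \<and> (\<forall>c\<le>dig x n. birkhoff_S f x q0 (N + c * qd x n) \<ge> ?top c - C1 * real (j + 1) - (\<Sum>i<Suc n. real (dig x i) * V / real (qd x i)))"
      if "N \<in> S" for N
    proof -
      obtain b where b: "b \<in> T" "N = dval Q (cmp b) j" using \<open>N \<in> S\<close> by (auto simp: S_def)
      have bB: "b \<in> ostrowski a j" "jump_sum u b < 0" using b by (auto simp: T_def)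
      have ba: "\<And>i. b i \<le> a i" using ostrowski_support[OF bB(1)] by blast
      have ca: "\<And>i. cmp b i \<le> a i" by (simp add: cmp_def)
      have "N < qd x n" using cval[OF bB(1)] full_lt b(2) by linarith
      moreover have "(\<Sum>i<j. (-1) ^ (m + i) * real (u ! i) * jump_term (den (take i u)) ((-1) ^ (m + i) * real (cmp b i) / real (u ! i))) = - jump_sum u b"
        unfolding jump_sum_def j_def[symmetric] sum_negf[symmetric]
      proof (rule sum.cong[OF refl])
        fix i assume "i \<in> {..<j}"
        then have i: "i < j" by simp
        define s :: real where "s = (-1) ^ i"
        have s: "s = 1 \<or> s = -1" unfolding s_def by (cases "even i") auto
        have sm: "(-1) ^ (m + i) = - s" using False by (simp add: s_def power_add)
        have ui: "real (u ! i) > 0" using au[OF i] dig_pos[OF x, of "m + i"] by (simp add: a_def)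
        have cr: "real (cmp b i) = real (u ! i) - real (b i)" using ba[of i] au[OF i] by (simp add: cmp_def of_nat_diff)
        \<comment> \<open>Complementing a digit and reversing the sign changes the argument by the
          integer \<open>s\<close> only, so the periodic \<open>jump_term\<close> keeps its value
          while the outer sign is reversed.\<close>
        have "- s * real (cmp b i) / real (u ! i) = s * real (b i) / real (u ! i) - s"
          unfolding cr using ui by (simp add: field_simps)
        moreover have "jump_term r (z - s) = jump_term r z" for r z
          using s jump_term_periodic[of r "z - 1"] jump_term_periodic[of r z] by auto
        ultimately have "jump_term (den (take i u)) (- s * real (cmp b i) / real (u ! i)) = jump_term (den (take i u)) (s * real (b i) / real (u ! i))" by simp
        then show "(-1) ^ (m + i) * real (u ! i) * jump_term (den (take i u)) ((-1) ^ (m + i) * real (cmp b i) / real (u ! i)) =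
          - ((-1) ^ i * real (u ! i) * jump_term (den (take i u)) ((-1) ^ i * real (b i) / real (u ! i)))"
          unfolding sm s_def[symmetric] by simp
      qed
      ultimately show ?thesis using main[OF ca] bB(2) b(2) by force
    qed
    ultimately show ?thesis using T cT by (intro exI[of _ S]) (auto simp: S_def j_def)
  qed
qed

end

text \<open>At the integers \<open>bern\<close> has a kink, visible as a first-order term in the
  second difference; away from them the second difference is \<open>- h\<^sup>2\<close>.\<close>

lemma bern_second_difference_0: "0 < h \<Longrightarrow> h < 1 \<Longrightarrow> bern h + bern (- h) - 2 * bern 0 = h * (1 - h)"
proof -
  assume h: "0 < h" "h < 1"
  have 1: "frac h = h" using h by (simp add: frac_eq)
  have 2: "frac (- h) = 1 - h" using h by (simp add: frac_unique_iff)
  show ?thesis unfolding bern_def 1 2 by (simp add: field_simps)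
qed

lemma bern_second_difference:
  assumes "0 < h" "h < frac r" "h < 1 - frac r"
  shows "bern (r + h) + bern (r - h) - 2 * bern r = - h\<^sup>2"
proof -
  have "\<lfloor>r + h\<rfloor> = \<lfloor>r\<rfloor>" "\<lfloor>r - h\<rfloor> = \<lfloor>r\<rfloor>"
    using assms by (auto intro!: floor_unique simp: frac_def)
  then have 1: "frac (r + h) = frac r + h" and 2: "frac (r - h) = frac r - h"
    by (auto simp: frac_def)
  show ?thesis unfolding bern_def 1 2 by (simp add: power2_eq_square field_simps)
qed

context jump_data
begin

text \<open>In the second difference at \<open>p0 - q0\<close> only the jump \<open>p0\<close> sits
  at a kink and contributes to first order in \<open>h\<close>. Were the function zero,
  \<open>L p0\<close> would equal \<open>h\<close> times the sum of all jumps for every small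
  \<open>h\<close>.\<close>

lemma jump_term_nonzero:
  assumes P: "P \<subseteq> {0..<1}" and p0: "p0 \<in> P" "L p0 \<noteq> 0"
  shows "\<exists>z. jump_term 1 z \<noteq> 0"
proof (rule ccontr)
  assume "\<not> (\<exists>z. jump_term 1 z \<noteq> 0)"
  then have zero: "jump_term 1 z = 0" for z by blast
  define \<Lambda> where "\<Lambda> = (\<Sum>p\<in>P. L p)"
  have frac_pos: "frac (p0 - p) > 0" if "p \<in> P - {p0}" for p
  proof -
    have "p0 - p \<notin> \<int>" using P p0(1) that by (intro not_Int_diff) auto
    then show ?thesis by (simp only: frac_gt_0_iff not_False_eq_True)
  qed
  \<comment> \<open>Upper limits for \<open>h\<close>: the entries with \<open>frac\<close> keep
    every other argument of \<open>bern\<close> away from the integers, and the quotient makes the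
    total jump times \<open>h\<close> smaller than \<open>L p0\<close>.\<close>
  define D where "D = insert 1 (insert (\<bar>L p0\<bar> / (\<bar>\<Lambda>\<bar> + 1)) ((\<lambda>p. frac (p0 - p)) ` (P - {p0}) \<union> (\<lambda>p. 1 - frac (p0 - p)) ` (P - {p0})))"
  have D: "finite D" "D \<noteq> {}" using finP by (auto simp: D_def)
  have "\<forall>y\<in>D. y > 0" using frac_pos p0(2) by (auto simp: D_def add_nonneg_pos frac_lt_1 simp del: frac_gt_0_iff)
  then have "Min D > 0" using D by simp
  then obtain h where h: "0 < h" "h < Min D" using dense by blast
  have hD: "h < y" if "y \<in> D" for y using h D that by (meson Min_le less_le_trans)
  have h1: "h < 1" "h < \<bar>L p0\<bar> / (\<bar>\<Lambda>\<bar> + 1)" by (rule hD, simp add: D_def)+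
  have "0 = jump_term 1 (p0 - q0 + h) + jump_term 1 (p0 - q0 - h) - 2 * jump_term 1 (p0 - q0)" by (simp only: zero)
  also have "\<dots> = (\<Sum>p\<in>P. L p * (bern (p0 - p + h) + bern (p0 - p - h) - 2 * bern (p0 - p)))"
    unfolding jump_term_def sum_distrib_left sum.distrib[symmetric] sum_subtractf[symmetric]
    by (intro sum.cong refl) (simp add: algebra_simps)
  also have "\<dots> = L p0 * (bern (p0 - p0 + h) + bern (p0 - p0 - h) - 2 * bern (p0 - p0))
     + (\<Sum>p\<in>P - {p0}. L p * (bern (p0 - p + h) + bern (p0 - p - h) - 2 * bern (p0 - p)))"
    using finP p0(1) by (rule sum.remove)
  also have "(\<Sum>p\<in>P - {p0}. L p * (bern (p0 - p + h) + bern (p0 - p - h) - 2 * bern (p0 - p))) = (\<Sum>p\<in>P - {p0}. L p * (- h\<^sup>2))"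
  proof (rule sum.cong[OF refl])
    fix p assume p: "p \<in> P - {p0}"
    have "h < frac (p0 - p)" "h < 1 - frac (p0 - p)" using p by (auto intro!: hD simp: D_def)
    then show "L p * (bern (p0 - p + h) + bern (p0 - p - h) - 2 * bern (p0 - p)) = L p * (- h\<^sup>2)"
      using bern_second_difference[OF h(1), of "p0 - p"] by simp
  qed
  also have "\<dots> = - h\<^sup>2 * (\<Lambda> - L p0)"
    using sum.remove[OF finP p0(1), of L] by (simp add: \<Lambda>_def sum_distrib_left mult.commute sum_negf)
  also have "bern (p0 - p0 + h) + bern (p0 - p0 - h) - 2 * bern (p0 - p0) = h * (1 - h)"
    using bern_second_difference_0[OF h(1) h1(1)] by simp
  finally have "0 = L p0 * (h * (1 - h)) + - h\<^sup>2 * (\<Lambda> - L p0)" .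
  moreover have "h * (L p0 - h * \<Lambda>) = L p0 * (h * (1 - h)) + - h\<^sup>2 * (\<Lambda> - L p0)"
    by (simp add: algebra_simps power2_eq_square)
  ultimately have "h * (L p0 - h * \<Lambda>) = 0" by simp
  then have "L p0 = h * \<Lambda>" using h by simp
  then have "\<bar>L p0\<bar> = h * \<bar>\<Lambda>\<bar>" using h by (simp add: abs_mult)
  moreover have "h * (\<bar>\<Lambda>\<bar> + 1) < \<bar>L p0\<bar>" using h1(2) by (simp add: pos_less_divide_eq)
  ultimately show False using h by (simp add: algebra_simps)
qed

text \<open>\<epsilon> is the parity sign required of the top position. If the function is positive
  at some \<zeta>, the even parity and \<open>\<beta> = \<zeta>\<close> work; if negative, the odd
  parity and \<open>\<beta> = 1 - \<zeta>\<close>, by periodicity. Lipschitz continuity widens the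
  point to a window.\<close>

lemma sign_window:
  assumes P: "P \<subseteq> {0..<1}" and p0: "p0 \<in> P" "L p0 \<noteq> 0"
  shows "\<exists>\<epsilon> c0 \<beta>1 \<beta>2. (\<epsilon> = 1 \<or> \<epsilon> = -1) \<and> c0 > 0 \<and> 0 < \<beta>1 \<and> \<beta>1 < \<beta>2 \<and> \<beta>2 \<le> 1 \<and>
    (\<forall>\<beta>. \<beta>1 \<le> \<beta> \<and> \<beta> \<le> \<beta>2 \<longrightarrow> \<epsilon> * jump_term 1 (\<epsilon> * \<beta>) \<ge> c0)"
proof -
  obtain z where z: "jump_term 1 z \<noteq> 0" using jump_term_nonzero[OF assms] by blast
  define \<zeta> where "\<zeta> = frac z"
  have GGint: "jump_term 1 (y + of_int k) = jump_term 1 y" for y k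
    by (rule periodic_int) simp
  have G\<zeta>: "jump_term 1 \<zeta> = jump_term 1 z" using GGint[of "frac z" "\<lfloor>z\<rfloor>"] by (simp add: \<zeta>_def frac_def)
  have "\<zeta> \<noteq> 0" using G\<zeta> z by auto
  then have \<zeta>: "0 < \<zeta>" "\<zeta> < 1" using frac_ge_0[of z] frac_lt_1[of z] by (auto simp: \<zeta>_def less_le)
  define \<epsilon> :: real where "\<epsilon> = (if jump_term 1 \<zeta> > 0 then 1 else -1)"
  define \<beta>1 where "\<beta>1 = (if jump_term 1 \<zeta> > 0 then \<zeta> else 1 - \<zeta>)"
  define c0 where "c0 = \<bar>jump_term 1 \<zeta>\<bar> / 2"
  define \<beta>2 where "\<beta>2 = min 1 (\<beta>1 + c0 / (W + 1))"
  have \<epsilon>: "\<epsilon> = 1 \<or> \<epsilon> = -1" by (simp add: \<epsilon>_def)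
  have c0: "c0 > 0" using z G\<zeta> by (simp add: c0_def)
  have \<beta>1: "0 < \<beta>1" "\<beta>1 < 1" using \<zeta> by (auto simp: \<beta>1_def)
  have W1: "W + 1 > 0" using W_nonneg by simp
  have at: "\<epsilon> * jump_term 1 (\<epsilon> * \<beta>1) = 2 * c0"
    using GGint[of \<zeta> "-1"] z G\<zeta> by (auto simp: \<epsilon>_def \<beta>1_def c0_def)
  have "\<epsilon> * jump_term 1 (\<epsilon> * \<beta>) \<ge> c0" if "\<beta>1 \<le> \<beta>" "\<beta> \<le> \<beta>2" for \<beta>
  proof -
    have "\<bar>jump_term 1 (\<epsilon> * \<beta>) - jump_term 1 (\<epsilon> * \<beta>1)\<bar> \<le> W * \<bar>\<epsilon> * \<beta> - \<epsilon> * \<beta>1\<bar>" by (rule jump_term_Lipschitz)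
    also have "\<bar>\<epsilon> * \<beta> - \<epsilon> * \<beta>1\<bar> = \<beta> - \<beta>1" using \<epsilon> that by auto
    also have "W * (\<beta> - \<beta>1) \<le> (W + 1) * (c0 / (W + 1))"
      using that W_nonneg by (intro mult_mono) (auto simp: \<beta>2_def)
    also have "\<dots> = c0" using W1 by simp
    finally show ?thesis using at \<epsilon> by auto
  qed
  moreover have "\<beta>1 < \<beta>2" "\<beta>2 \<le> 1" using \<beta>1 c0 W1 by (auto simp: \<beta>2_def)
  ultimately show ?thesis using \<epsilon> c0 \<beta>1 by blast
qed

end

section \<open>The divergent case\<close>

lemma upper_density_pos:
  assumes \<kappa>: "\<kappa> > 0" and ex: "\<And>M0. \<exists>M\<ge>M0. M \<ge> 1 \<and> real (card {N \<in> S. 1 \<le> N \<and> N \<le> M}) \<ge> \<kappa> * real M"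
  shows "upper_density S > 0"
proof -
  let ?r = "\<lambda>M. ereal (real (card {N \<in> S. 1 \<le> N \<and> N \<le> M}) / real M)"
  have "limsup ?r \<ge> ereal \<kappa>"
  proof (rule ccontr)
    assume "\<not> limsup ?r \<ge> ereal \<kappa>"
    then have "limsup ?r < ereal \<kappa>" by simp
    then have "eventually (\<lambda>M. ?r M < ereal \<kappa>) sequentially" by (rule Limsup_lessD)
    then obtain M0 where M0: "\<And>M. M \<ge> M0 \<Longrightarrow> ?r M < ereal \<kappa>" by (auto simp: eventually_sequentially)
    obtain M where M: "M \<ge> M0" "M \<ge> 1" "real (card {N \<in> S. 1 \<le> N \<and> N \<le> M}) \<ge> \<kappa> * real M" using ex by blast
    then have "real (card {N \<in> S. 1 \<le> N \<and> N \<le> M}) / real M \<ge> \<kappa>" by (simp add: le_divide_eq)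
    then show False using M0[OF M(1)] by simp
  qed
  moreover have "0 < ereal \<kappa>" using \<kappa> by simp
  ultimately show ?thesis unfolding upper_density_def by (rule less_le_trans[rotated])
qed

lemma card_nat_window: assumes "r \<ge> 0" shows "real (card {c::nat. r \<le> real c \<and> real c \<le> s}) \<ge> s - r - 1"
proof (cases "s \<ge> 0")
  case True
  have "{c::nat. r \<le> real c \<and> real c \<le> s} = {nat \<lceil>r\<rceil>..nat \<lfloor>s\<rfloor>}"
    using assms True by (auto simp: nat_le_iff le_nat_iff ceiling_le_iff le_floor_iff)
  then have "card {c::nat. r \<le> real c \<and> real c \<le> s} = Suc (nat \<lfloor>s\<rfloor>) - nat \<lceil>r\<rceil>" by simp
  then show ?thesis using assms True by linarith
next
  case False
  then show ?thesis using assms by (smt (verit) of_nat_0_le_iff)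
qed

text \<open>A decreasing summable sequence is \<open>o(1 / n)\<close>, so the denominators outgrow
  every multiple of \<open>n\<close>. Hence \<phi> itself eventually dominates the linear term,
  which at most doubles the denominator.\<close>

lemma summable_of_summable_plus_linear:
  fixes \<phi> :: "nat \<Rightarrow> real"
  assumes mono: "\<And>i j. i \<le> j \<Longrightarrow> \<phi> i \<le> \<phi> j" and pos: "\<And>i. \<phi> i > 0" and c: "c > 0"
    and s: "summable (\<lambda>i. 1 / (\<phi> i + c * (real i + 1)))"
  shows "summable (\<lambda>i. 1 / \<phi> i)"
proof -
  define a where "a = (\<lambda>i. 1 / (\<phi> i + c * (real i + 1)))"
  have den: "\<phi> i + c * (real i + 1) > 0" for i using pos[of i] c by (intro add_pos_nonneg) auto
  have a: "a i > 0" for i using den[of i] by (simp add: a_def)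
  have anti: "a j \<le> a i" if "i \<le> j" for i j
  proof -
    have "\<phi> i + c * (real i + 1) \<le> \<phi> j + c * (real j + 1)"
      using mono[OF that] that c by (intro add_mono mult_left_mono) auto
    then show ?thesis unfolding a_def using den[of i] den[of j] by (intro divide_left_mono mult_pos_pos) auto
  qed
  \<comment> \<open>The value \<open>1 / (8 c)\<close>, applied to the terms between
    \<open>n / 2\<close> and \<open>n\<close>, yields \<open>\<phi> n + c (n + 1) > 4 c n\<close>,
    enough for \<open>\<phi> n >= c (n + 1)\<close>.\<close>
  obtain n0 where n0: "\<And>m n. m \<ge> n0 \<Longrightarrow> norm (\<Sum>i\<in>{m..<n}. a i) < 1 / (8 * c)"
    using s c unfolding a_def[symmetric] summable_Cauchy by (metis divide_pos_pos mult_pos_pos zero_less_numeral zero_less_one)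
  have big: "\<phi> n \<ge> c * (real n + 1)" if n: "n \<ge> 2 * n0 + 1" for n
  proof -
    have "n \<le> 2 * (n - n div 2)" by presburger
    then have "real n \<le> real (2 * (n - n div 2))" by (simp only: of_nat_le_iff)
    then have "real n / 2 \<le> real (card {n div 2..<n})" by simp
    then have "real n / 2 * a n \<le> real (card {n div 2..<n}) * a n"
      using less_imp_le[OF a[of n]] by (rule mult_right_mono)
    also have "\<dots> = (\<Sum>i\<in>{n div 2..<n}. a n)" by simp
    also have "\<dots> \<le> (\<Sum>i\<in>{n div 2..<n}. a i)" by (intro sum_mono anti) auto
    also have "\<dots> < 1 / (8 * c)"
    proof -
      have "n div 2 \<ge> n0" using n by linarith
      then show ?thesis using n0[of "n div 2" n] unfolding real_norm_def by linarith
    qed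
    finally have "real n / 2 / (\<phi> n + c * (real n + 1)) < 1 / (8 * c)" by (simp add: a_def)
    then have "real n / 2 * (8 * c) < \<phi> n + c * (real n + 1)" using den[of n] c by (simp add: field_simps)
    moreover have "c * real n \<ge> c * 1" using n c by (intro mult_left_mono) auto
    ultimately show ?thesis by (simp add: algebra_simps)
  qed
  show ?thesis
  proof (rule summable_comparison_test'[of "\<lambda>i. 2 * a i" "2 * n0 + 1"])
    show "summable (\<lambda>i. 2 * a i)" using s by (simp add: a_def summable_mult del: times_divide_eq_right)
    fix n assume n: "n \<ge> 2 * n0 + 1"
    have "1 / \<phi> n \<le> 2 / (\<phi> n + c * (real n + 1))"
      using big[OF n] pos[of n] den[of n] by (simp add: field_simps)
    then show "norm (1 / \<phi> n) \<le> 2 * a n" using pos[of n] by (simp add: a_def)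
  qed
qed

text \<open>By monotonicity each term is at most one at a rescaled index, and every rescaled index
  is hit a bounded number \<open>t\<close> of times.\<close>

lemma summable_rescale:
  fixes psi :: "real \<Rightarrow> real"
  assumes mono: "mono_on {0<..} psi" and pos: "\<forall>x>0. psi x > 0" and C: "C > 0"
    and s: "summable (\<lambda>i::nat. 1 / psi (C * (real i + 1)))"
  shows "summable (\<lambda>k::nat. 1 / psi (real k + 1))"
proof -
  define t where "t = nat \<lceil>C\<rceil> + 1"
  have t: "t \<ge> 1" "C \<le> real t" using C unfolding t_def by linarith+
  define u where "u = (\<lambda>k::nat. 1 / psi (C * (real (k - 1) + 1)))"
  have "summable (\<lambda>k. u (Suc k))" using s by (simp add: u_def)
  then have "summable u" by (simp only: summable_Suc_iff)
  moreover have "u k \<ge> 0" for k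
  proof -
    have "C * (real (k - 1) + 1) > 0" using C by (intro mult_pos_pos) auto
    then have "psi (C * (real (k - 1) + 1)) > 0" using pos by blast
    then show ?thesis by (simp add: u_def)
  qed
  ultimately have st: "summable (\<lambda>i. u (i div t))" using t(1) by (intro summable_div) auto
  show ?thesis
  proof (rule summable_comparison_test'[OF st, of t])
    fix k :: nat assume k: "k \<ge> t"
    have kt: "k div t \<ge> 1" using k t by (simp add: less_eq_div_iff_mult_less_eq)
    have "real (t * (k div t)) \<le> real k" by (simp only: of_nat_le_iff times_div_less_eq_dividend)
    moreover have "C * real (k div t) \<le> real t * real (k div t)" using t by (intro mult_right_mono) auto
    moreover have "real (k div t - 1) + 1 = real (k div t)" using kt by (simp add: of_nat_diff)
    ultimately have "C * (real (k div t - 1) + 1) \<le> real k + 1" by (simp only: of_nat_mult)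
    moreover have p: "C * (real (k div t - 1) + 1) > 0" using C by (intro mult_pos_pos) auto
    ultimately have "psi (C * (real (k div t - 1) + 1)) \<le> psi (real k + 1)"
      by (intro mono_onD[OF mono]) auto
    then have "1 / psi (real k + 1) \<le> u (k div t)"
      unfolding u_def using pos p by (intro divide_left_mono mult_pos_pos) auto
    then show "norm (1 / psi (real k + 1)) \<le> u (k div t)" using pos by (simp add: less_imp_le)
  qed
qed

lemma eventually_square_le_power: "\<exists>i0. \<forall>i\<ge>i0. (i + 1)\<^sup>2 \<le> (2::nat) ^ (i div 2)"
proof -
  have "eventually (\<lambda>k::nat. (2 * real k + 2)\<^sup>2 \<le> 2 ^ k) sequentially" by real_asymp
  then obtain k0 where k0: "\<And>k::nat. k \<ge> k0 \<Longrightarrow> (2 * real k + 2)\<^sup>2 \<le> 2 ^ k" by (auto simp: eventually_sequentially)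
  have "(i + 1)\<^sup>2 \<le> (2::nat) ^ (i div 2)" if "i \<ge> 2 * k0" for i
  proof -
    have "real i \<le> 2 * real (i div 2) + 1"
    proof -
      have "i \<le> 2 * (i div 2) + 1" by presburger
      then have "real i \<le> real (2 * (i div 2) + 1)" by (simp only: of_nat_le_iff)
      then show ?thesis by simp
    qed
    then have "(real i + 1)\<^sup>2 \<le> (2 * real (i div 2) + 2)\<^sup>2" by (intro power_mono) auto
    also have "\<dots> \<le> 2 ^ (i div 2)" using that by (intro k0) auto
    finally have "real ((i + 1)\<^sup>2) \<le> real (2 ^ (i div 2))" by (simp add: add.commute)
    then show ?thesis by (simp only: of_nat_le_iff)
  qed
  then show ?thesis by blast
qed

context jump_data
begin

text \<open>Quadratic digits are eventually below the exponentially growing denominators, so all but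
  finitely many terms are at most \<open>V\<close>.\<close>

lemma sum_dig_over_qd:
  assumes x: "x \<in> irr" and h: "eventually (\<lambda>i. real (dig x i) \<le> (real i + 1)\<^sup>2) sequentially"
  shows "\<exists>Cx. \<forall>n. (\<Sum>i<n. real (dig x i) * V / real (qd x i)) \<le> V * real n + Cx"
proof -
  obtain i0 where i0: "\<And>i. i \<ge> i0 \<Longrightarrow> real (dig x i) \<le> (real i + 1)\<^sup>2" using h by (auto simp: eventually_sequentially)
  obtain i1 where i1: "\<And>i. i \<ge> i1 \<Longrightarrow> (i + 1)\<^sup>2 \<le> (2::nat) ^ (i div 2)" using eventually_square_le_power by blast
  define k where "k = max i0 i1"
  let ?t = "\<lambda>i. real (dig x i) * V / real (qd x i)"
  have t0: "?t i \<ge> 0" for i using V_nonneg by simp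
  have t: "?t i \<le> V" if "i \<ge> k" for i
  proof -
    have "(i + 1)\<^sup>2 \<le> qd x i" using i1[of i] qd_ge_power[OF x, of i] that by (simp add: k_def)
    then have "real ((i + 1)\<^sup>2) \<le> real (qd x i)" by (simp only: of_nat_le_iff)
    then have "real (dig x i) \<le> real (qd x i)" using i0[of i] that by (simp add: k_def add.commute)
    then have "real (dig x i) * V \<le> real (qd x i) * V" using V_nonneg by (intro mult_right_mono)
    then show ?thesis using qd_pos[OF x, of i] by (simp add: divide_le_eq mult.commute)
  qed
  have "(\<Sum>i<n. ?t i) \<le> V * real n + (\<Sum>i<min n k. ?t i)" for n
  proof (induction n)
    case (Suc n)
    show ?case
    proof (cases "n < k")
      case True
      then have "min (Suc n) k = Suc (min n k)" "min n k = n" by auto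
      then show ?thesis using Suc V_nonneg by (simp add: algebra_simps)
    next
      case False
      then have "min (Suc n) k = min n k" by auto
      then show ?thesis using Suc t[of n] False by (simp add: algebra_simps)
    qed
  qed simp
  moreover have "(\<Sum>i<min n k. ?t i) \<le> (\<Sum>i<k. ?t i)" for n using t0 by (intro sum_mono2) auto
  ultimately have "(\<Sum>i<n. ?t i) \<le> V * real n + (\<Sum>i<k. ?t i)" for n by (meson add_left_mono order_trans)
  then show ?thesis by blast
qed

text \<open>The deterministic part, for one fixed \<open>x\<close>. Every occurrence of a suitable
  large digit \<open>a\<close> above a denominator \<open>q\<close> yields sums at the indices
  \<open>N + c q\<close>, where \<open>N\<close> comes from \<open>many_large_sums\<close> and
  \<open>c / a\<close> lies in the sign window. They fill a fixed proportion of the integers up to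
  \<open>(a + 1) q\<close>.\<close>

lemma positive_upper_density:
  fixes psi :: "real \<Rightarrow> real" and A :: "nat \<Rightarrow> nat"
  assumes x: "x \<in> irr"
    and mono: "mono_on {0<..} psi"
    and C: "C > 0" "eventually (\<lambda>n. real (qd x n) \<le> exp (C * real n)) sequentially"
    and dig2: "eventually (\<lambda>i. real (dig x i) \<le> (real i + 1)\<^sup>2) sequentially"
    and \<beta>: "c0 > 0" "0 < \<beta>1" "\<beta>1 < \<beta>2" "\<beta>2 \<le> 1" "\<And>\<beta>. \<beta>1 \<le> \<beta> \<and> \<beta> \<le> \<beta>2 \<Longrightarrow> \<epsilon> * jump_term 1 (\<epsilon> * \<beta>) \<ge> c0"
    and A: "\<And>j. real (A j) \<ge> 2 / c0 * (psi ((2 * C + 1) * (real j + 1)) + (C1 + V + 1) * (real j + 1))"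
    and pos: "\<forall>x>0. psi x > 0"
    and freq: "\<And>j0. \<exists>u v g n. length u \<ge> j0 \<and> n = length v + length u + length g \<and> pre x n = v @ u @ g \<and>
      length v \<le> m \<and> den v \<le> Dv \<and> 2 \<le> length g \<and> length g \<le> R \<and> (\<forall>a\<in>set g. a \<le> R) \<and>
      state d v = (1, 0) \<and> state d (v @ u @ g) = (1, 0) \<and>
      (even (length v) \<and> good u \<or> odd (length v) \<and> \<not> good u) \<and> (-1) ^ n = \<epsilon> \<and>
      A (length u) \<le> dig x n \<and> dig x n < 2 * A (length u) \<and> A (length u) \<le> (length u + 1)\<^sup>2"
  shows "upper_density {N. 1 \<le> N \<and> birkhoff_S f x q0 N \<ge> psi (ln (real N))} > 0"
proof -
  \<comment> \<open>At least \<open>den u / 2\<close> values of \<open>N\<close> and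
    \<open>(\<beta>2 - \<beta>1) a / 2\<close> values of \<open>c\<close> are counted against at
    most \<open>2 a\<close> times \<open>(R + 1)^R\<close> times \<open>2 (Dv + 1) den u\<close>;
    this explains \<open>16\<close>.\<close>
  define \<kappa> where "\<kappa> = (\<beta>2 - \<beta>1) / (16 * real (R + 1) ^ R * (real Dv + 1))"
  define S where "S = {N. 1 \<le> N \<and> birkhoff_S f x q0 N \<ge> psi (ln (real N))}"
  obtain Cx where Cx: "\<And>n. (\<Sum>i<n. real (dig x i) * V / real (qd x i)) \<le> V * real n + Cx"
    using sum_dig_over_qd[OF x dig2] by blast
  obtain n1 where n1: "\<And>n. n \<ge> n1 \<Longrightarrow> real (qd x n) \<le> exp (C * real n)" using C(2) by (auto simp: eventually_sequentially)
  have "eventually (\<lambda>j::nat. ln 2 + 2 * ln (real j + 1) \<le> real j + 1) sequentially" by real_asymp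
  then obtain j1 where j1: "\<And>j::nat. j \<ge> j1 \<Longrightarrow> ln 2 + 2 * ln (real j + 1) \<le> real j + 1" by (auto simp: eventually_sequentially)
  have bpos: "\<beta>2 - \<beta>1 > 0" using \<beta> by simp
  show ?thesis
    unfolding S_def[symmetric]
  proof (rule upper_density_pos[of \<kappa>])
    show "\<kappa> > 0" using bpos by (simp add: \<kappa>_def)
    fix M0 :: nat
    \<comment> \<open>Lower limits for the block length: \<open>K1\<close> makes the smooth error of
      the top level at most a quarter of the main term, \<open>K2\<close> absorbs the constants in
      the errors of the other levels, and \<open>K3\<close> makes the window for \<open>c\<close>
      have length at least \<open>2\<close>.\<close>
    define K1 where "K1 = nat \<lceil>4 * V / c0\<rceil>"
    define K2 where "K2 = nat \<lceil>V * real (m + R) + Cx\<rceil>"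
    define K3 where "K3 = nat \<lceil>2 * c0 / (\<beta>2 - \<beta>1)\<rceil>"
    obtain u v g n where len: "length u \<ge> 2 * K1 + K2 + K3 + n1 + j1 + m + R + 2 * M0 + 2" and n: "n = length v + length u + length g"
      and pre: "pre x n = v @ u @ g" and v: "length v \<le> m" "den v \<le> Dv" and g: "2 \<le> length g" "length g \<le> R" "\<forall>a\<in>set g. a \<le> R"
      and st: "state d v = (1, 0)" "state d (v @ u @ g) = (1, 0)"
      and sel: "even (length v) \<and> good u \<or> odd (length v) \<and> \<not> good u" and \<epsilon>: "(-1) ^ n = \<epsilon>"
      and Aa: "A (length u) \<le> dig x n" "dig x n < 2 * A (length u)" "A (length u) \<le> (length u + 1)\<^sup>2"
      using freq[of "2 * K1 + K2 + K3 + n1 + j1 + m + R + 2 * M0 + 2"] by blast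
    define j where "j = length u"
    define a where "a = dig x n"
    define q where "q = qd x n"
    define E where "E = C1 * real (j + 1) + (\<Sum>i<Suc n. real (dig x i) * V / real (qd x i))"
    have a1: "real a \<ge> 1" unfolding a_def using dig_pos[OF x, of n] by simp
    have nj: "j \<le> n" "n \<le> m + j + R" using n v g by (auto simp: j_def)
    have qk: "n div 2 < q" using less_exp[of "n div 2"] qd_ge_power[OF x, of n] unfolding q_def by linarith
    have qpos: "q \<ge> 2" using qk nj len by (simp add: j_def)
    have K: "4 * V / c0 \<le> real K1" "V * real (m + R) + Cx \<le> real K2" "2 * c0 / (\<beta>2 - \<beta>1) \<le> real K3"
      unfolding K1_def K2_def K3_def by linarith+
    obtain T where T: "finite T" "den u \<le> 2 * card T" "\<And>N. N \<in> T \<Longrightarrow> N < q"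
      "\<And>N c. N \<in> T \<Longrightarrow> c \<le> a \<Longrightarrow> birkhoff_S f x q0 (N + c * q) \<ge> \<epsilon> * real a * jump_term 1 (\<epsilon> * real c / real a) - C1 * real (j + 1) - (\<Sum>i<Suc n. real (dig x i) * V / real (qd x i))"
      using many_large_sums[OF x n pre st g(1) sel] unfolding \<epsilon> a_def[symmetric] q_def[symmetric] j_def[symmetric] by blast
    define CC where "CC = {c::nat. \<beta>1 * real a \<le> real c \<and> real c \<le> \<beta>2 * real a}"
    define M where "M = (a + 1) * q"
    have ba: "\<beta>2 * real a \<le> 1 * real a" using \<beta>(4) by (intro mult_right_mono) auto
    have CCle: "c \<le> a" "c \<ge> 1" if "c \<in> CC" for c
    proof -
      have "real c \<le> real a" using that ba by (simp add: CC_def)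
      then show "c \<le> a" by simp
      have "0 < \<beta>1 * real a" using \<beta> a1 by (intro mult_pos_pos) auto
      then have "real c > 0" using that by (simp add: CC_def)
      then show "c \<ge> 1" by simp
    qed
    have CCfin: "finite CC" by (rule finite_subset[of _ "{..a}"]) (use CCle in auto)
    have Ea: "E \<le> C1 * (real j + 1) + V * real n + Cx + c0 / 4 * real a"
    proof -
      have "V / real q \<le> c0 / 4"
      proof -
        have "K1 \<le> n div 2" using len nj by (simp add: j_def)
        then have "real K1 \<le> real q" using qk by simp
        then have "4 * V / c0 \<le> real q" using K(1) by linarith
        then show ?thesis using \<beta>(1) qpos by (simp add: field_simps)
      qed
      then have "real a * (V / real q) \<le> real a * (c0 / 4)" by (intro mult_left_mono) auto
      then have "real a * V / real q \<le> c0 / 4 * real a" by (simp add: mult.commute)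
      moreover have "(\<Sum>i<Suc n. real (dig x i) * V / real (qd x i)) = (\<Sum>i<n. real (dig x i) * V / real (qd x i)) + real a * V / real q"
        by (simp add: a_def q_def)
      moreover have "C1 * real (j + 1) = C1 * (real j + 1)" by simp
      ultimately show ?thesis unfolding E_def using Cx[of n] by linarith
    qed
    have Apsi: "c0 / 2 * real a \<ge> psi ((2 * C + 1) * (real j + 1)) + (C1 + V + 1) * (real j + 1)"
    proof -
      have "2 / c0 * (psi ((2 * C + 1) * (real j + 1)) + (C1 + V + 1) * (real j + 1)) \<le> real a"
        using A[of j] Aa(1) by (simp add: a_def j_def)
      then have "c0 / 2 * (2 / c0 * (psi ((2 * C + 1) * (real j + 1)) + (C1 + V + 1) * (real j + 1))) \<le> c0 / 2 * real a"
        using \<beta>(1) by (intro mult_left_mono) auto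
      then show ?thesis using \<beta>(1) by simp
    qed
    \<comment> \<open>Half of \<open>c0 a\<close> pays for \<open>psi\<close> and the error linear
      in \<open>j\<close>, a quarter for the smooth error of the top level. The summand
      \<open>1\<close> in \<open>C1 + V + 1\<close> covers \<open>K2\<close>.\<close>
    have large: "c0 * real a - E \<ge> psi ((2 * C + 1) * (real j + 1))"
    proof -
      have "V * real n \<le> V * real (m + j + R)" using nj V_nonneg by (intro mult_left_mono) auto
      also have "\<dots> = V * real (m + R) + V * real j" by (simp add: algebra_simps)
      finally have "V * real n + Cx \<le> real K2 + V * real j" using K(2) by linarith
      moreover have "real K2 \<le> real j" using len by (simp add: j_def)
      moreover have "(C1 + V + 1) * (real j + 1) = C1 * (real j + 1) + V * real j + V + real j + 1" by (simp add: algebra_simps)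
      moreover have "c0 / 4 * real a \<ge> 0" using \<beta>(1) by simp
      moreover have "c0 * real a = c0 / 2 * real a + c0 / 4 * real a + c0 / 4 * real a" by simp
      ultimately show ?thesis using Ea Apsi V_nonneg by linarith
    qed
    \<comment> \<open>The digit contributes at most \<open>j + 1\<close> to the logarithm, as it is
      at most quadratic in \<open>j\<close>. The denominator contributes \<open>C n\<close>, and
      \<open>n <= 2 (j + 1)\<close> for long blocks.\<close>
    have lnM: "ln (real M) \<le> (2 * C + 1) * (real j + 1)"
    proof -
      have "a + 1 \<le> 2 * (j + 1)\<^sup>2" using Aa by (simp add: a_def j_def)
      then have "real (a + 1) \<le> real (2 * (j + 1)\<^sup>2)" by (simp only: of_nat_le_iff)
      then have 1: "ln (real (a + 1)) \<le> ln (2 * (real j + 1)\<^sup>2)" by (subst ln_le_cancel_iff) (auto simp: add.commute)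
      have "ln (2 * (real j + 1)\<^sup>2) = ln 2 + 2 * ln (real j + 1)" by (simp add: ln_mult ln_realpow)
      moreover have "ln 2 + 2 * ln (real j + 1) \<le> real j + 1" using len by (intro j1) (simp add: j_def)
      ultimately have 2: "ln (real (a + 1)) \<le> real j + 1" using 1 by linarith
      have "real q \<le> exp (C * real n)" unfolding q_def using len nj by (intro n1) (simp add: j_def)
      then have "ln (real q) \<le> ln (exp (C * real n))" using qpos by (subst ln_le_cancel_iff) auto
      then have "ln (real q) \<le> C * real n" by simp
      also have "\<dots> \<le> C * (2 * (real j + 1))" using nj len C(1) by (intro mult_left_mono) (auto simp: j_def)
      finally have 3: "ln (real q) \<le> C * (2 * (real j + 1))" .
      have "ln (real M) = ln (real (a + 1)) + ln (real q)" unfolding M_def of_nat_mult using qpos by (subst ln_mult) auto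
      then show ?thesis using 2 3 by (simp add: algebra_simps)
    qed
    have inS: "N + c * q \<in> S \<and> 1 \<le> N + c * q \<and> N + c * q \<le> M" if N: "N \<in> T" and c: "c \<in> CC" for N c
    proof -
      have c': "c \<le> a" "c \<ge> 1" using CCle c by auto
      have "c * q \<le> a * q" using c' by (intro mult_le_mono1)
      then have le: "N + c * q \<le> M" using T(3)[OF N] unfolding M_def add_mult_distrib by linarith
      have "1 * q \<le> c * q" using c' by (intro mult_le_mono1)
      then have ge: "2 \<le> N + c * q" using qpos by linarith
      have "\<beta>1 \<le> real c / real a \<and> real c / real a \<le> \<beta>2" using c a1 by (simp add: CC_def field_simps)
      then have "\<epsilon> * jump_term 1 (\<epsilon> * (real c / real a)) \<ge> c0" by (rule \<beta>(5))
      then have "real a * c0 \<le> real a * (\<epsilon> * jump_term 1 (\<epsilon> * (real c / real a)))" by (intro mult_left_mono) auto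
      then have "\<epsilon> * real a * jump_term 1 (\<epsilon> * real c / real a) \<ge> c0 * real a" by (simp add: mult_ac)
      then have "birkhoff_S f x q0 (N + c * q) \<ge> c0 * real a - E" using T(4)[OF N c'(1)] unfolding E_def by linarith
      moreover have "psi (ln (real (N + c * q))) \<le> psi ((2 * C + 1) * (real j + 1))"
      proof (rule mono_onD[OF mono])
        have r2: "2 \<le> real (N + c * q)" using ge by (simp only: of_nat_le_iff[symmetric, where 'a = real] of_nat_numeral)
        have rM: "real (N + c * q) \<le> real M" using le by (simp only: of_nat_le_iff)
        have l: "0 < ln (real (N + c * q))" by (rule ln_gt_zero) (use r2 in linarith)
        have "ln (real (N + c * q)) \<le> ln (real M)" by (subst ln_le_cancel_iff) (use r2 rM in linarith)+
        then show le: "ln (real (N + c * q)) \<le> (2 * C + 1) * (real j + 1)" using lnM by linarith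
        show "ln (real (N + c * q)) \<in> {0<..}" using l by simp
        show "(2 * C + 1) * (real j + 1) \<in> {0<..}" using l le by simp
      qed
      ultimately show ?thesis using large le ge by (simp add: S_def)
    qed
    have "card ((\<lambda>(N, c). N + c * q) ` (T \<times> CC)) = card T * card CC"
    proof (subst card_image)
      show "inj_on (\<lambda>(N, c). N + c * q) (T \<times> CC)"
      proof (rule inj_onI, clarify)
        fix N c N' c' assume *: "N \<in> T" "N' \<in> T" "N + c * q = N' + c' * q"
        have "(N + c * q) div q = c" "(N' + c' * q) div q = c'" using T(3)[OF *(1)] T(3)[OF *(2)] by auto
        then show "N = N' \<and> c = c'" using *(3) by auto
      qed
    qed (simp add: card_cartesian_product)
    moreover have "card ((\<lambda>(N, c). N + c * q) ` (T \<times> CC)) \<le> card {N \<in> S. 1 \<le> N \<and> N \<le> M}"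
      by (rule card_mono) (use inS in auto)
    ultimately have cnt: "card T * card CC \<le> card {N \<in> S. 1 \<le> N \<and> N \<le> M}" by simp
    have CCc: "real (card CC) \<ge> (\<beta>2 - \<beta>1) * real a / 2"
    proof -
      have "real (card CC) \<ge> \<beta>2 * real a - \<beta>1 * real a - 1" unfolding CC_def using \<beta> by (intro card_nat_window) auto
      moreover have "(\<beta>2 - \<beta>1) * real a \<ge> 2"
      proof -
        have "(C1 + V + 1) * (real j + 1) \<ge> 1 * (real j + 1)" using C1_nonneg V_nonneg by (intro mult_right_mono) auto
        then have "(C1 + V + 1) * (real j + 1) \<ge> real j + 1" by (simp only: mult_1)
        moreover have "psi ((2 * C + 1) * (real j + 1)) > 0" using pos C(1) by (auto intro!: mult_pos_pos add_pos_pos)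
        ultimately have "c0 / 2 * real a \<ge> real j" using Apsi by linarith
        moreover have "real j \<ge> real K3" using len by (simp add: j_def)
        ultimately have "2 * c0 / (\<beta>2 - \<beta>1) \<le> c0 / 2 * real a" using K(3) by linarith
        then have "c0 * 4 \<le> c0 * ((\<beta>2 - \<beta>1) * real a)" using bpos by (simp add: field_simps)
        then show ?thesis using \<beta>(1) by simp
      qed
      ultimately show ?thesis by (simp add: algebra_simps)
    qed
    have pv: "positive (v @ u @ g)" using pre_positive[OF x, of n] unfolding pre .
    have "q = den ((v @ u) @ g)" by (simp add: q_def qd_def pre)
    then have "real q \<le> real (R + 1) ^ length g * real (den (v @ u))"
      using den_extend_le[of "v @ u" g R] pv g(3) by simp
    also have "\<dots> \<le> real (R + 1) ^ R * (2 * (real Dv + 1) * real (den u))"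
    proof (intro mult_mono)
      show "real (R + 1) ^ length g \<le> real (R + 1) ^ R" using g by (intro power_increasing) auto
      have "den' v * num u \<le> den v * den u" using den'_le[of v] num_le[of u] pv by (intro mult_le_mono) auto
      then have "den (v @ u) \<le> 2 * (den v * den u)" unfolding den_append by linarith
      also have "\<dots> \<le> 2 * ((Dv + 1) * den u)" using v(2) by (intro mult_le_mono) auto
      finally have "real (den (v @ u)) \<le> real (2 * ((Dv + 1) * den u))" by (simp only: of_nat_le_iff)
      then show "real (den (v @ u)) \<le> 2 * (real Dv + 1) * real (den u)" by (simp add: algebra_simps)
    qed auto
    finally have qle: "real q \<le> real (R + 1) ^ R * (2 * (real Dv + 1) * real (den u))" .
    have "\<kappa> * real M \<le> \<kappa> * (2 * real a * (real (R + 1) ^ R * (2 * (real Dv + 1) * real (den u))))"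
    proof (rule mult_left_mono)
      have "real M = (real a + 1) * real q" by (simp add: M_def algebra_simps)
      also have "\<dots> \<le> (2 * real a) * (real (R + 1) ^ R * (2 * (real Dv + 1) * real (den u)))"
        using a1 qle by (intro mult_mono) auto
      finally show "real M \<le> 2 * real a * (real (R + 1) ^ R * (2 * (real Dv + 1) * real (den u)))" .
      show "0 \<le> \<kappa>" using bpos by (simp add: \<kappa>_def)
    qed
    also have "\<dots> = (real (den u) / 2) * ((\<beta>2 - \<beta>1) * real a / 2)"
    proof -
      have "b / (16 * X * Y) * (2 * c * (X * (2 * Y * e))) = e / 2 * (b * c / 2)" if "X > 0" "Y > 0" for b c e X Y :: real
        using that by (simp add: field_simps)
      moreover have "real (R + 1) ^ R > 0" "real Dv + 1 > 0" by auto
      ultimately show ?thesis unfolding \<kappa>_def by blast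
    qed
    also have "\<dots> \<le> real (card T) * real (card CC)"
    proof (rule mult_mono)
      have "real (den u) \<le> real (2 * card T)" using T(2) by (simp only: of_nat_le_iff)
      then show "real (den u) / 2 \<le> real (card T)" by simp
    qed (use CCc bpos in auto)
    also have "\<dots> \<le> real (card {N \<in> S. 1 \<le> N \<and> N \<le> M})"
      using cnt by (simp only: of_nat_mult[symmetric] of_nat_le_iff)
    finally have "real (card {N \<in> S. 1 \<le> N \<and> N \<le> M}) \<ge> \<kappa> * real M" .
    moreover have "M \<ge> M0"
    proof -
      have "M0 \<le> n div 2" using len nj by (simp add: j_def)
      then have "M0 \<le> q" using qk by simp
      then show ?thesis by (simp add: M_def)
    qed
    moreover have "M \<ge> 1" using qpos by (simp add: M_def)
    ultimately show "\<exists>M\<ge>M0. M \<ge> 1 \<and> real (card {N \<in> S. 1 \<le> N \<and> N \<le> M}) \<ge> \<kappa> * real M" by blast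
  qed
qed

end

text \<open>Very negative sums of \<open>f\<close> are very large sums of \<open>-f\<close>, so the
  second half of the divergent case reduces to the first.\<close>

lemma jump_data_uminus:
  assumes "jump_data f f0 L P Lip V q0 d"
  shows "jump_data (\<lambda>x. - f x) (\<lambda>x. - f0 x) (\<lambda>p. - L p) P Lip V q0 d"
proof -
  interpret jump_data f f0 L P Lip V q0 d by fact
  show ?thesis
  proof
    show "finite P" by (rule finP)
    show "- f z = (\<Sum>p\<in>P. - L p * saw (z - p)) + - f0 z" if "z \<notin> \<rat>" for z
      using f_eq[OF that] by (simp add: sum_negf)
    show "- f0 (x + 1) = - f0 x" for x by (simp add: per0)
    show "\<bar>- f0 x - - f0 y\<bar> \<le> Lip * \<bar>x - y\<bar>" for x y using lip0[of x y] by (simp add: abs_minus_commute)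
    show "\<bar>(\<Sum>j<q. - f0 (x + real j / real q)) - real q * integral {0..1} (\<lambda>x. - f x)\<bar> \<le> V / real q" if "q \<ge> 1" for x q
    proof -
      have "(\<Sum>j<q. - f0 (x + real j / real q)) - real q * integral {0..1} (\<lambda>x. - f x)
        = - ((\<Sum>j<q. f0 (x + real j / real q)) - real q * integral {0..1} f)"
        by (simp add: sum_negf)
      then show ?thesis using Riem[OF that, of x] by (simp only: abs_minus_cancel)
    qed
    show "q0 \<in> \<rat>" by (rule q0)
    show "2 \<le> d" by (rule d(1))
    show "real d * (q0 - p) \<in> \<int>" if "p \<in> P" for p by (rule d(2)[OF that])
  qed
qed

lemma birkhoff_S_uminus: "birkhoff_S (\<lambda>x. - f x) \<alpha> q N = - birkhoff_S f \<alpha> q N"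
  by (simp add: birkhoff_S_def sum_negf)

section \<open>Measure estimates for the events with a large digit\<close>

definition window :: "nat \<Rightarrow> nat list \<Rightarrow> real set" where
  "window A w = {x \<in> cyl w. A \<le> dig x (length w) \<and> dig x (length w) < 2 * A}"

lemma cyl_append_subset: "cyl (v @ u) \<subseteq> cyl v"
proof
  fix x assume "x \<in> cyl (v @ u)"
  then have x: "x \<in> irr" "pre x (length v + length u) = v @ u" by (auto simp: cyl_def)
  have "pre x (length v) = take (length v) (pre x (length v + length u))" by (simp add: take_pre)
  then show "x \<in> cyl v" using x by (simp add: cyl_def)
qed

text \<open>Relative to \<open>cyl u\<close>, each of the two inserted words costs a factor \<rho>,
  placing \<open>u\<close> after \<open>w @ e\<close> costs \<open>1/2\<close> and the measure of
  \<open>cyl w\<close>, and the digit window costs \<open>1 / (6 A)\<close>.\<close>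

lemma union_window_lower:
  assumes A: "A \<ge> 1" and w: "positive w" and ve: "positive (w @ e)" "\<forall>a\<in>set e. a \<le> R" "length e \<le> R"
    and I: "\<And>u. u \<in> I \<Longrightarrow> length u = j \<and> positive u"
    and h: "\<And>u. u \<in> I \<Longrightarrow> positive (h u) \<and> (\<forall>a\<in>set (h u). a \<le> R) \<and> length (h u) \<le> R"
    and \<rho>: "\<rho> = 1 / (2 * real (R + 1) ^ (2 * R))"
  shows "measure lborel (\<Union>u\<in>I. cyl u) \<le> 12 * real A / (\<rho>\<^sup>2 * measure lborel (cyl w)) * measure lborel (\<Union>u\<in>I. window A (w @ e @ u @ h u))"
proof (rule compare_union)
  have \<rho>0: "\<rho> > 0" by (simp add: \<rho>)
  have mw: "measure lborel (cyl w) > 0" using cyl_measure_bounds(3)[OF w] .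
  show "countable I" by (rule countableI_type)
  show "disjoint_family_on cyl I" using I by (auto simp: disjoint_family_on_def cyl_def)
  have pos: "positive (w @ e @ u @ h u)" if "u \<in> I" for u using ve(1) I[OF that] h[OF that] by auto
  show "disjoint_family_on (\<lambda>u. window A (w @ e @ u @ h u)) I"
    unfolding disjoint_family_on_def
  proof (intro ballI impI)
    fix u u' assume u: "u \<in> I" "u' \<in> I" "u \<noteq> u'"
    have 1: "window A (w @ e @ u @ h u) \<subseteq> cyl ((w @ e) @ u)" for u
      using cyl_append_subset[of "(w @ e) @ u" "h u"] by (auto simp: window_def)
    have "cyl ((w @ e) @ u) \<inter> cyl ((w @ e) @ u') = {}" using u I by (auto simp: cyl_def)
    then show "window A (w @ e @ u @ h u) \<inter> window A (w @ e @ u' @ h u') = {}" using 1[of u] 1[of u'] by blast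
  qed
  fix u assume u: "u \<in> I"
  show "cyl u \<in> sets lborel" by (rule cyl_sets)
  show "window A (w @ e @ u @ h u) \<in> sets lborel" unfolding window_def using cyl_dig_window(1)[OF pos[OF u] A] .
  show "cyl u \<subseteq> irr" by (rule cyl_subset)
  show "window A (w @ e @ u @ h u) \<subseteq> irr" using cyl_subset by (auto simp: window_def)
  have pu: "positive ((w @ e) @ u)" "positive u" using ve(1) I[OF u] by auto
  have "\<rho> * measure lborel (cyl w) \<le> measure lborel (cyl (w @ e))"
    unfolding \<rho> by (rule cyl_extend_lower[OF ve])
  then have "1/2 * (\<rho> * measure lborel (cyl w)) * measure lborel (cyl u) \<le> 1/2 * measure lborel (cyl (w @ e)) * measure lborel (cyl u)"
    by (intro mult_right_mono) auto
  also have "\<dots> \<le> measure lborel (cyl ((w @ e) @ u))" using cyl_append_lower[OF ve(1) pu(2)] .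
  finally have 1: "\<rho> / 2 * measure lborel (cyl w) * measure lborel (cyl u) \<le> measure lborel (cyl ((w @ e) @ u))" by simp
  have "\<rho> * measure lborel (cyl ((w @ e) @ u)) \<le> measure lborel (cyl (((w @ e) @ u) @ h u))"
    unfolding \<rho> using h[OF u] pos[OF u] by (intro cyl_extend_lower) auto
  then have 2: "\<rho> * (\<rho> / 2 * measure lborel (cyl w) * measure lborel (cyl u)) \<le> measure lborel (cyl (w @ e @ u @ h u))"
    using mult_left_mono[OF 1 less_imp_le[OF \<rho>0]] by (simp only: append_assoc)
  have "1 / (6 * real A) * measure lborel (cyl (w @ e @ u @ h u)) \<le> measure lborel (window A (w @ e @ u @ h u))"
    unfolding window_def using cyl_dig_window(2)[OF pos[OF u] A] .
  moreover have "1 / (6 * real A) * (\<rho> * (\<rho> / 2 * measure lborel (cyl w) * measure lborel (cyl u))) \<le> 1 / (6 * real A) * measure lborel (cyl (w @ e @ u @ h u))"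
    using 2 by (intro mult_left_mono) auto
  ultimately have 3: "1 / (6 * real A) * (\<rho> * (\<rho> / 2 * measure lborel (cyl w) * measure lborel (cyl u))) \<le> measure lborel (window A (w @ e @ u @ h u))"
    by linarith
  have "measure lborel (cyl u) = 12 * real A / (\<rho>\<^sup>2 * measure lborel (cyl w)) * (1 / (6 * real A) * (\<rho> * (\<rho> / 2 * measure lborel (cyl w) * measure lborel (cyl u))))"
    using \<rho>0 mw A by (simp add: power2_eq_square)
  also have "\<dots> \<le> 12 * real A / (\<rho>\<^sup>2 * measure lborel (cyl w)) * measure lborel (window A (w @ e @ u @ h u))"
    using 3 \<rho>0 mw by (intro mult_left_mono) auto
  finally show "measure lborel (cyl u) \<le> 12 * real A / (\<rho>\<^sup>2 * measure lborel (cyl w)) * measure lborel (window A (w @ e @ u @ h u))" .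
next
  show "0 \<le> 12 * real A / (\<rho>\<^sup>2 * measure lborel (cyl w))" by simp
qed

lemma summable_inverse_square_Suc: "summable (\<lambda>l::nat. inverse (real (Suc l) ^ 2))"
  using inverse_power_summable[of 2, where 'a = real] summable_Suc_iff[of "\<lambda>l. inverse (real l ^ 2)"] by simp

text \<open>The position of the large digit depends on the lengths of the inserted words and is
  known up to a bounded range only, whence the union bound.\<close>

lemma measure_dig_range:
  assumes A: "A \<ge> 1" and J: "finite J" "\<And>i. i \<in> J \<Longrightarrow> length w \<le> i" and F: "F \<subseteq> cyl w \<inter> (\<Union>i\<in>J. {x. dig x i \<ge> A})" "F \<in> sets lborel"
  shows "measure lborel F \<le> real (card J) * (2 / real A) * measure lborel (cyl w)"
proof -
  have s: "cyl w \<inter> {x. dig x i \<ge> A} \<in> sets lborel" for i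
    using depth_sets[OF depth_Int_dig[OF depth_mono[OF depth_cyl[of w], of "max (length w) (Suc i)"], of i "\<lambda>a. a \<ge> A"]] by simp
  have "measure lborel F \<le> measure lborel (\<Union>i\<in>J. cyl w \<inter> {x. dig x i \<ge> A})"
  proof (rule measure_mono_fmeasurable)
    show "F \<subseteq> (\<Union>i\<in>J. cyl w \<inter> {x. dig x i \<ge> A})" using F by auto
    show "(\<Union>i\<in>J. cyl w \<inter> {x. dig x i \<ge> A}) \<in> fmeasurable lborel"
      using J(1) s cyl_subset[of w] by (intro fmeasurable_irr sets.finite_UN) auto
  qed (rule F)
  also have "\<dots> \<le> (\<Sum>i\<in>J. measure lborel (cyl w \<inter> {x. dig x i \<ge> A}))"
    using J(1) s by (rule measure_UNION_le)
  also have "\<dots> \<le> (\<Sum>i\<in>J. 2 / real A * measure lborel (cyl w))"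
    using J(2) by (intro sum_mono depth_dig_ge_later[OF depth_cyl A])
  finally show ?thesis by simp
qed

lemma measure_dig_range_pair:
  assumes A: "A \<ge> 1" "B \<ge> 1" and J: "finite J" "finite K" "\<And>i k. i \<in> J \<Longrightarrow> k \<in> K \<Longrightarrow> length w \<le> i \<and> i < k"
    and F: "F \<subseteq> cyl w \<inter> (\<Union>i\<in>J. {x. dig x i \<ge> A}) \<inter> (\<Union>k\<in>K. {x. dig x k \<ge> B})" "F \<in> sets lborel"
  shows "measure lborel F \<le> real (card J * card K) * (4 / (real A * real B)) * measure lborel (cyl w)"
proof -
  let ?T = "\<lambda>(i, k). cyl w \<inter> {x. dig x i \<ge> A} \<inter> {x. dig x k \<ge> B}"
  have s: "?T p \<in> sets lborel" for p
  proof -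
    obtain i k where p: "p = (i, k)" by (cases p)
    let ?n = "length w + Suc i + Suc k"
    have "depth ?n (cyl w \<inter> {x. dig x i \<ge> A})" by (rule depth_Int_dig[OF depth_mono[OF depth_cyl]]) auto
    then have "depth ?n (cyl w \<inter> {x. dig x i \<ge> A} \<inter> {x. dig x k \<ge> B})" by (rule depth_Int_dig) auto
    then show ?thesis unfolding p by (auto dest: depth_sets)
  qed
  have "measure lborel F \<le> measure lborel (\<Union>p\<in>J \<times> K. ?T p)"
  proof (rule measure_mono_fmeasurable)
    show "F \<subseteq> (\<Union>p\<in>J \<times> K. ?T p)"
    proof
      fix x assume "x \<in> F"
      then have x: "x \<in> cyl w" "x \<in> (\<Union>i\<in>J. {x. dig x i \<ge> A})" "x \<in> (\<Union>k\<in>K. {x. dig x k \<ge> B})" using F(1) by auto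
      then obtain i k where "i \<in> J" "k \<in> K" "dig x i \<ge> A" "dig x k \<ge> B" by auto
      then show "x \<in> (\<Union>p\<in>J \<times> K. ?T p)" using x(1) by (intro UN_I[of "(i, k)"]) auto
    qed
    show "(\<Union>p\<in>J \<times> K. ?T p) \<in> fmeasurable lborel"
      using J(1,2) s cyl_subset[of w] by (intro fmeasurable_irr sets.finite_UN) auto
  qed (rule F)
  also have "\<dots> \<le> (\<Sum>p\<in>J \<times> K. measure lborel (?T p))"
    using J(1,2) s by (intro measure_UNION_le) auto
  also have "\<dots> \<le> (\<Sum>p\<in>J \<times> K. 4 / (real A * real B) * measure lborel (cyl w))"
  proof (rule sum_mono)
    fix p assume p: "p \<in> J \<times> K"
    obtain i k where ik: "p = (i, k)" by (cases p)
    then have "length w \<le> i" "i < k" using J(3)[of i k] p by auto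
    then show "measure lborel (?T p) \<le> 4 / (real A * real B) * measure lborel (cyl w)"
      unfolding ik using depth_dig_ge_pair[OF depth_cyl A] by simp
  qed
  finally show ?thesis by (simp add: card_cartesian_product)
qed

context jump_data
begin

theorem AE_positive_upper_density:
  fixes psi :: "real \<Rightarrow> real"
  assumes mono: "mono_on {0<..} psi" and pos: "\<forall>x>0. psi x > 0"
    and div: "\<not> summable (\<lambda>k::nat. 1 / psi (real k + 1))"
    and P: "P \<subseteq> {0..<1}" "p0 \<in> P" "L p0 \<noteq> 0"
  shows "AE x in lborel. x \<in> {0..<1} \<longrightarrow> upper_density {N. 1 \<le> N \<and> birkhoff_S f x q0 N \<ge> psi (ln (real N))} > 0"
proof -
  obtain \<epsilon> c0 \<beta>1 \<beta>2 where \<epsilon>: "\<epsilon> = 1 \<or> \<epsilon> = (-1::real)" and \<beta>: "c0 > 0" "0 < \<beta>1" "\<beta>1 < \<beta>2" "\<beta>2 \<le> 1"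
    "\<And>\<beta>. \<beta>1 \<le> \<beta> \<and> \<beta> \<le> \<beta>2 \<Longrightarrow> \<epsilon> * jump_term 1 (\<epsilon> * \<beta>) \<ge> c0"
    using sign_window[OF P] by metis
  obtain C where C: "C > 0" "AE x in lborel. x \<in> irr \<longrightarrow> eventually (\<lambda>n. real (den (pre x n)) \<le> exp (C * real n)) sequentially"
    using AE_den_le_exp by blast
  obtain R where "\<forall>w \<pi>. positive w \<longrightarrow> (\<exists>e. positive e \<and> 2 \<le> length e \<and> length e \<le> R \<and> (\<forall>a\<in>set e. a \<le> R) \<and>
    even (length (w @ e)) = \<pi> \<and> state d (w @ e) = (1, 0))"
    using extend_to_trivial_state[OF d(1)] by blast
  then obtain ext where ext: "\<And>w \<pi>. positive w \<Longrightarrow> positive (ext w \<pi>) \<and> 2 \<le> length (ext w \<pi>) \<and> length (ext w \<pi>) \<le> R \<and> (\<forall>a\<in>set (ext w \<pi>). a \<le> R) \<and>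
    even (length (w @ ext w \<pi>)) = \<pi> \<and> state d (w @ ext w \<pi>) = (1, 0)" by metis
  define C4 where "C4 = C1 + V + 1"
  have C4: "C4 \<ge> 1" using C1_nonneg V_nonneg by (simp add: C4_def)
  \<comment> \<open>For sums built on a block of length \<open>j\<close>,
    \<open>(2 C + 1) (j + 1)\<close> bounds \<open>ln N\<close> and \<open>C4 (j + 1)\<close> covers
    the errors of the levels; \<open>2 / c0\<close> converts a required sum into a digit, with half
    of the main term to spare.\<close>
  define \<Psi> where "\<Psi> = (\<lambda>j::nat. 2 / c0 * (psi ((2 * C + 1) * (real j + 1)) + C4 * (real j + 1)))"
  define A where "A = (\<lambda>j. nat \<lceil>\<Psi> j\<rceil>)"
  have psip: "psi ((2 * C + 1) * (real j + 1)) > 0" for j using pos C(1) by (auto intro!: mult_pos_pos add_pos_pos)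
  have psim: "psi ((2 * C + 1) * (real i + 1)) \<le> psi ((2 * C + 1) * (real j + 1))" if "i \<le> j" for i j
    using that C(1) by (intro mono_onD[OF mono]) (auto intro!: mult_pos_pos add_pos_pos)
  have \<Psi>pos: "\<Psi> j > 0" for j unfolding \<Psi>_def using psip[of j] C4 \<beta>(1) by (intro mult_pos_pos add_pos_nonneg) auto
  have \<Psi>mono: "\<Psi> i \<le> \<Psi> j" if "i \<le> j" for i j
    unfolding \<Psi>_def using psim[OF that] C4 \<beta>(1) that by (intro mult_left_mono add_mono) auto
  have A: "real (A j) \<ge> \<Psi> j" "A j \<ge> 1" "real (A j) \<le> \<Psi> j + 1" for j
    using \<Psi>pos[of j] unfolding A_def by linarith+
  \<comment> \<open>The number of positions the large digit of one event may take. Block lengths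
    that are multiples of \<open>s\<close> give disjoint ranges of positions, as the pair estimate
    requires.\<close>
  define s where "s = 2 * R + 1"
  \<comment> \<open>Thresholds above the square of the position are dropped, so that the digits used
    stay polynomial; what is lost is a summable series.\<close>
  define p where "p = (\<lambda>l. if A (s * l) \<le> (s * l + 1)\<^sup>2 then 1 / real (A (s * l)) else 0)"
  have p0: "p l \<ge> 0" for l by (simp add: p_def)
  \<comment> \<open>Summability is carried back step by step: the dropped terms are at most inverse
    squares, rounding \<open>A\<close> costs a constant, monotonicity fills the gaps between
    multiples of \<open>s\<close>, and then the linear term and the rescaling are removed.\<close>
  have pdiv: "\<not> summable p"
  proof
    assume sp: "summable p"
    have "summable (\<lambda>l. 1 / real (A (s * l)))"
    proof (rule summable_comparison_test'[of "\<lambda>l. p l + inverse (real (Suc l) ^ 2)" 0])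
      show "summable (\<lambda>l. p l + inverse (real (Suc l) ^ 2))"
        by (intro summable_add sp summable_inverse_square_Suc)
      fix l :: nat
      show "norm (1 / real (A (s * l))) \<le> p l + inverse (real (Suc l) ^ 2)"
      proof (cases "A (s * l) \<le> (s * l + 1)\<^sup>2")
        case False
        have "Suc l \<le> s * l + 1" by (simp add: s_def)
        then have "(Suc l)\<^sup>2 \<le> (s * l + 1)\<^sup>2" by (rule power_mono) simp
        then have "(Suc l)\<^sup>2 \<le> A (s * l)" using False by linarith
        then have "real ((Suc l)\<^sup>2) \<le> real (A (s * l))" by (simp only: of_nat_le_iff)
        then have "1 / real (A (s * l)) \<le> 1 / real ((Suc l)\<^sup>2)" by (intro divide_left_mono mult_pos_pos) (use A(2)[of "s * l"] in auto)
        then show ?thesis using False by (simp add: p_def divide_inverse)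
      qed (simp add: p_def)
    qed
    then have "summable (\<lambda>l. (1 + c0 / 2) * (1 / real (A (s * l))))" by (rule summable_mult)
    then have "summable (\<lambda>l. 1 / \<Psi> (s * l))"
    proof (rule summable_comparison_test'[of _ 0])
      fix l :: nat
      have "2 / c0 * 1 \<le> \<Psi> (s * l)"
        unfolding \<Psi>_def
      proof (rule mult_left_mono)
        have "1 * 1 \<le> C4 * (real (s * l) + 1)" using C4 by (intro mult_mono) auto
        then show "1 \<le> psi ((2 * C + 1) * (real (s * l) + 1)) + C4 * (real (s * l) + 1)" using psip[of "s * l"] by linarith
      qed (use \<beta> in auto)
      then have "1 \<le> c0 / 2 * \<Psi> (s * l)" using \<beta>(1) by (simp add: field_simps)
      then have "real (A (s * l)) \<le> (1 + c0 / 2) * \<Psi> (s * l)" using A(3)[of "s * l"] by (simp add: algebra_simps)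
      then have "1 / \<Psi> (s * l) \<le> (1 + c0 / 2) * (1 / real (A (s * l)))"
        using \<Psi>pos[of "s * l"] A(2)[of "s * l"] by (simp add: field_simps)
      then show "norm (1 / \<Psi> (s * l)) \<le> (1 + c0 / 2) * (1 / real (A (s * l)))" using \<Psi>pos[of "s * l"] by simp
    qed
    then have "summable (\<lambda>i. 1 / \<Psi> (s * (i div s)))"
      using \<Psi>pos by (intro summable_div[of "\<lambda>l. 1 / \<Psi> (s * l)"]) (auto simp: s_def less_imp_le)
    then have "summable (\<lambda>i. 1 / \<Psi> i)"
    proof (rule summable_comparison_test'[of _ 0])
      fix i :: nat
      have "\<Psi> (s * (i div s)) \<le> \<Psi> i" by (intro \<Psi>mono) simp
      then show "norm (1 / \<Psi> i) \<le> 1 / \<Psi> (s * (i div s))" using \<Psi>pos[of i] \<Psi>pos[of "s * (i div s)"] by (simp add: frac_le)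
    qed
    then have "summable (\<lambda>i. 2 / c0 * (1 / \<Psi> i))" by (rule summable_mult)
    moreover have "2 / c0 * (1 / (2 / c0 * y)) = 1 / y" for y using \<beta>(1) by simp
    ultimately have "summable (\<lambda>i. 1 / (psi ((2 * C + 1) * (real i + 1)) + C4 * (real i + 1)))"
      by (simp only: \<Psi>_def)
    then have "summable (\<lambda>i. 1 / psi ((2 * C + 1) * (real i + 1)))"
      using C4 by (intro summable_of_summable_plus_linear[of "\<lambda>i. psi ((2 * C + 1) * (real i + 1))" C4] psim psip) auto
    then have "summable (\<lambda>k::nat. 1 / psi (real k + 1))"
      using C(1) by (intro summable_rescale[OF mono pos, of "2 * C + 1"]) auto
    then show False using div by blast
  qed
  \<comment> \<open>The prefix is made even or odd according to the block that follows it; the word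
    after the block restores the residues \<open>(1, 0)\<close> and gives the top position the
    parity \<epsilon>.\<close>
  define VV where "VV = (\<lambda>w u. w @ ext w (good u))"
  define hh where "hh = (\<lambda>w u. ext (VV w u @ u) (\<epsilon> = 1))"
  define F where "F = (\<lambda>w j. \<Union>u\<in>{u. length u = j \<and> positive u}. window (A j) (VV w u @ u @ hh w u))"
  define G where "G = (\<lambda>w l. if A (s * l) \<le> (s * l + 1)\<^sup>2 then F w (s * l) else {})"
  have VV: "positive (VV w u)" if "positive w" for w u using ext[OF that] that by (auto simp: VV_def)
  have hh: "positive (hh w u) \<and> 2 \<le> length (hh w u) \<and> length (hh w u) \<le> R \<and> (\<forall>a\<in>set (hh w u). a \<le> R) \<and>
     even (length (VV w u @ u @ hh w u)) = (\<epsilon> = 1) \<and> state d (VV w u @ u @ hh w u) = (1, 0)" if "positive w" "positive u" for w u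
  proof -
    have "positive (VV w u @ u)" using VV[OF that(1)] that by auto
    from ext[OF this, of "\<epsilon> = 1"] show ?thesis by (simp add: hh_def)
  qed
  have F: "F w j \<in> sets lborel" "F w j \<subseteq> cyl w" if w: "positive w" for w j
  proof -
    show "F w j \<in> sets lborel"
      unfolding F_def
    proof (rule sets.countable_UN')
      show "countable {u :: nat list. length u = j \<and> positive u}" by (rule countableI_type)
      show "(\<lambda>u. window (A j) (VV w u @ u @ hh w u)) ` {u. length u = j \<and> positive u} \<subseteq> sets lborel"
      proof (rule image_subsetI)
        fix u assume "u \<in> {u. length u = j \<and> positive u}"
        then have "positive (VV w u @ u @ hh w u)" using VV[OF w] hh[OF w] by auto
        then show "window (A j) (VV w u @ u @ hh w u) \<in> sets lborel"
          unfolding window_def using A(2) by (rule cyl_dig_window(1))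
      qed
    qed
    have "window (A j) (VV w u @ u @ hh w u) \<subseteq> cyl w" for u
      using cyl_append_subset[of w "ext w (good u) @ u @ hh w u"] by (auto simp: window_def VV_def)
    then show "F w j \<subseteq> cyl w" by (auto simp: F_def)
  qed
  have Frange: "F w j \<subseteq> (\<Union>i\<in>{length w + j..length w + j + 2 * R}. {x. dig x i \<ge> A j})" if w: "positive w" for w j
  proof
    fix x assume "x \<in> F w j"
    then obtain u where u: "length u = j" "positive u" "x \<in> window (A j) (VV w u @ u @ hh w u)" by (auto simp: F_def)
    let ?n = "length (VV w u @ u @ hh w u)"
    have "length w + j \<le> ?n" using u by (simp add: VV_def)
    moreover have "?n \<le> length w + j + 2 * R" using u ext[OF w, of "good u"] hh[OF w u(2)] by (simp add: VV_def)
    moreover have "dig x ?n \<ge> A j" using u by (simp add: window_def)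
    ultimately show "x \<in> (\<Union>i\<in>{length w + j..length w + j + 2 * R}. {x. dig x i \<ge> A j})" by (intro UN_I[of ?n]) auto
  qed
  define \<rho> where "\<rho> = 1 / (2 * real (R + 1) ^ (2 * R))"
  have \<rho>: "\<rho> > 0" by (simp add: \<rho>_def)
  have lower: "measure lborel (F w j) \<ge> \<rho>\<^sup>2 / 24 * (1 / real (A j)) * measure lborel (cyl w)" if w: "positive w" for w j
  proof -
    define K where "K = 12 * real (A j) / (\<rho>\<^sup>2 * measure lborel (cyl w))"
    have mw: "measure lborel (cyl w) > 0" using cyl_measure_bounds(3)[OF w] .
    have K: "K > 0" unfolding K_def using mw \<rho> A(2)[of j] by (intro divide_pos_pos mult_pos_pos) auto
    \<comment> \<open>Within one class of blocks the inserted prefix is the same, so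
      \<open>union_window_lower\<close> applies to each class. The two classes cover
      \<open>irr\<close>, which turns the constant \<open>12\<close> into \<open>24\<close>.\<close>
    define I where "I = (\<lambda>b. {u. length u = j \<and> positive u \<and> good u = b})"
    have half: "measure lborel (\<Union>u\<in>I b. cyl u) \<le> K * measure lborel (F w j)" for b
    proof -
      have 1: "measure lborel (\<Union>u\<in>I b. cyl u) \<le> K * measure lborel (\<Union>u\<in>I b. window (A j) (w @ ext w b @ u @ hh w u))"
        unfolding K_def
      proof (rule union_window_lower[OF A(2) w, where R = R and j = j])
        show "positive (w @ ext w b)" using ext[OF w, of b] w by simp
        show "\<forall>a\<in>set (ext w b). a \<le> R" "length (ext w b) \<le> R" using ext[OF w, of b] by blast+
        show "length u = j \<and> positive u" if "u \<in> I b" for u using that by (simp add: I_def)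
        then show "positive (hh w u) \<and> (\<forall>a\<in>set (hh w u). a \<le> R) \<and> length (hh w u) \<le> R" if "u \<in> I b" for u
          using that hh[OF w, of u] by blast
        show "\<rho> = 1 / (2 * real (R + 1) ^ (2 * R))" by (rule \<rho>_def)
      qed
      have "(\<Union>u\<in>I b. window (A j) (w @ ext w b @ u @ hh w u)) \<subseteq> F w j"
        by (auto simp: I_def F_def VV_def)
      then have "K * measure lborel (\<Union>u\<in>I b. window (A j) (w @ ext w b @ u @ hh w u)) \<le> K * measure lborel (F w j)"
      proof (intro mult_left_mono measure_mono_fmeasurable)
        show "F w j \<in> fmeasurable lborel" using F[OF w] cyl_subset[of w] by (intro fmeasurable_irr) auto
        show "(\<Union>u\<in>I b. window (A j) (w @ ext w b @ u @ hh w u)) \<in> sets lborel"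
        proof (rule sets.countable_UN')
          show "countable (I b)" by (rule countableI_type)
          show "(\<lambda>u. window (A j) (w @ ext w b @ u @ hh w u)) ` I b \<subseteq> sets lborel"
          proof (rule image_subsetI)
            fix u assume "u \<in> I b"
            then have "positive (w @ ext w b @ u @ hh w u)" using w ext[OF w] hh[OF w] by (auto simp: I_def)
            then show "window (A j) (w @ ext w b @ u @ hh w u) \<in> sets lborel"
              unfolding window_def using A(2) by (rule cyl_dig_window(1))
          qed
        qed
      qed (use K in auto)
      with 1 show ?thesis by (rule order_trans)
    qed
    have s: "(\<Union>u\<in>I b. cyl u) \<in> sets lborel" for b
    proof (rule sets.countable_UN')
      show "countable (I b)" by (rule countableI_type)
      show "cyl ` I b \<subseteq> sets lborel" using cyl_sets by blast
    qed
    have "irr = (\<Union>u\<in>I True. cyl u) \<union> (\<Union>u\<in>I False. cyl u)"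
    proof (intro equalityI subsetI)
      fix x assume x: "x \<in> irr"
      then have "x \<in> cyl (pre x j)" "pre x j \<in> I (good (pre x j))" using pre_positive[OF x] by (auto simp: cyl_def I_def)
      then show "x \<in> (\<Union>u\<in>I True. cyl u) \<union> (\<Union>u\<in>I False. cyl u)" by (cases "good (pre x j)") auto
    qed (use cyl_subset in auto)
    then have "1 = measure lborel ((\<Union>u\<in>I True. cyl u) \<union> (\<Union>u\<in>I False. cyl u))" using irr_measure(1) by simp
    also have "\<dots> \<le> measure lborel (\<Union>u\<in>I True. cyl u) + measure lborel (\<Union>u\<in>I False. cyl u)"
      by (rule measure_Un_le[OF s s])
    also have "\<dots> \<le> 2 * K * measure lborel (F w j)" using half[of True] half[of False] by linarith
    finally have "1 / (2 * K) \<le> measure lborel (F w j)" using K by (simp add: field_simps)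
    moreover have "1 / (2 * K) = \<rho>\<^sup>2 / 24 * (1 / real (A j)) * measure lborel (cyl w)"
      using mw \<rho> A(2)[of j] by (simp add: K_def)
    ultimately show ?thesis by simp
  qed
  have upper: "measure lborel (F w j) \<le> real s * (2 / real (A j)) * measure lborel (cyl w)" if w: "positive w" for w j
  proof -
    have "measure lborel (F w j) \<le> real (card {length w + j..length w + j + 2 * R}) * (2 / real (A j)) * measure lborel (cyl w)"
      by (rule measure_dig_range[OF A(2)]) (use F[OF w] Frange[OF w, of j] in auto)
    then show ?thesis by (simp add: s_def)
  qed
  have pair: "measure lborel (F w i \<inter> F w j) \<le> real (s * s) * (4 / (real (A i) * real (A j))) * measure lborel (cyl w)"
    if w: "positive w" and ij: "i + 2 * R < j" for w i j
  proof -
    have "measure lborel (F w i \<inter> F w j) \<le> real (card {length w + i..length w + i + 2 * R} * card {length w + j..length w + j + 2 * R}) * (4 / (real (A i) * real (A j))) * measure lborel (cyl w)"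
    proof (rule measure_dig_range_pair[OF A(2) A(2)])
      show "F w i \<inter> F w j \<subseteq> cyl w \<inter> (\<Union>i'\<in>{length w + i..length w + i + 2 * R}. {x. dig x i' \<ge> A i}) \<inter> (\<Union>k\<in>{length w + j..length w + j + 2 * R}. {x. dig x k \<ge> A j})"
        using F(2)[OF w, of i] Frange[OF w, of i] Frange[OF w, of j] by blast
      show "F w i \<inter> F w j \<in> sets lborel" using F(1)[OF w] by blast
    qed (use ij in auto)
    then show ?thesis by (simp add: s_def)
  qed
  \<comment> \<open>Large enough for both the single bound \<open>2 s\<close> and the pair bound
    \<open>4 s\<^sup>2\<close>.\<close>
  define C5 where "C5 = 4 * real (s * s)"
  have s1: "real s \<ge> 1" by (simp add: s_def)
  have C5: "C5 > 0" "2 * real s \<le> C5" using s1 by (auto simp: C5_def)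
  define \<delta> where "\<delta> = (\<rho>\<^sup>2 / 24)\<^sup>2 / (2 * C5)"
  have \<delta>: "\<delta> > 0" using \<rho> C5 by (simp add: \<delta>_def)
  define Lim where "Lim = (\<lambda>w. \<Inter>n. \<Union>l\<in>{n..}. G w l)"
  have Gs: "G w l \<in> sets lborel" "G w l \<subseteq> cyl w" if "positive w" for w l using F[OF that] by (auto simp: G_def)
  have Lims: "Lim w \<in> sets lborel" "Lim w \<subseteq> cyl w" if "positive w" for w
  proof -
    show "Lim w \<in> sets lborel" using Gs(1)[OF that] by (auto simp: Lim_def)
    show "Lim w \<subseteq> cyl w" using Gs(2)[OF that] by (fastforce simp: Lim_def)
  qed
  have LimM: "measure lborel (Lim w) \<ge> \<delta> * measure lborel (cyl w)" if w: "positive w" for w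
    unfolding Lim_def \<delta>_def
  proof (rule Kochen_Stone)
    have mw: "measure lborel (cyl w) > 0" using cyl_measure_bounds(3)[OF w] .
    show "G w l \<in> sets lborel" "G w l \<subseteq> irr" for l using Gs[OF w] cyl_subset[of w] by auto
    show "0 \<le> p l" for l by (rule p0)
    show "\<not> summable p" by (rule pdiv)
    show "0 < \<rho>\<^sup>2 / 24" "0 < C5" "0 < measure lborel (cyl w)" using \<rho> C5 mw by auto
    show "\<rho>\<^sup>2 / 24 * p l * measure lborel (cyl w) \<le> measure lborel (G w l)" for l
      using lower[OF w, of "s * l"] by (simp add: p_def G_def)
    show "measure lborel (G w l) \<le> C5 * p l * measure lborel (cyl w)" for l
    proof (cases "A (s * l) \<le> (s * l + 1)\<^sup>2")
      case True
      have "measure lborel (G w l) \<le> 2 * real s * (1 / real (A (s * l))) * measure lborel (cyl w)"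
        using upper[OF w, of "s * l"] True by (simp add: G_def mult_ac)
      also have "\<dots> \<le> C5 * (1 / real (A (s * l))) * measure lborel (cyl w)"
        using C5 by (intro mult_right_mono) auto
      finally show ?thesis using True by (simp add: p_def)
    qed (simp add: G_def p_def)
    show "measure lborel (G w k \<inter> G w l) \<le> C5 * (p k * p l) * measure lborel (cyl w)" if kl: "k < l" for k l
    proof (cases "A (s * k) \<le> (s * k + 1)\<^sup>2 \<and> A (s * l) \<le> (s * l + 1)\<^sup>2")
      case True
      have "s * (k + 1) \<le> s * l" using kl by (intro mult_le_mono2) simp
      then have "s * k + 2 * R < s * l" by (simp add: s_def)
      from pair[OF w this] show ?thesis using True by (simp add: G_def p_def C5_def mult_ac)
    qed (auto simp: G_def p_def)
  qed
  \<comment> \<open>A point needs only one word \<open>w\<close> to start from. The set meets every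
    cylinder in a proportion at least \<delta>, while the bounds on the prefix may depend on
    \<open>w\<close> and thereby on the point.\<close>
  define LL where "LL = (\<Union>w\<in>{w. positive w}. Lim w)"
  have "AE x in lborel. x \<in> irr \<longrightarrow> x \<in> LL"
  proof (rule full_measure_of_local[OF _ _ \<delta>])
    show LLs: "LL \<in> sets lborel"
      unfolding LL_def
    proof (rule sets.countable_UN')
      show "countable {w :: nat list. positive w}" by (rule countableI_type)
      show "Lim ` {w. positive w} \<subseteq> sets lborel" using Lims(1) by blast
    qed
    show "LL \<subseteq> irr" using Lims(2) cyl_subset by (auto simp: LL_def)
    fix w assume w: "positive w"
    have "\<delta> * measure lborel (cyl w) \<le> measure lborel (Lim w)" by (rule LimM[OF w])
    also have "\<dots> \<le> measure lborel (LL \<inter> cyl w)"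
    proof (rule measure_mono_fmeasurable)
      show "Lim w \<subseteq> LL \<inter> cyl w" using Lims(2)[OF w] w by (auto simp: LL_def)
      show "Lim w \<in> sets lborel" by (rule Lims(1)[OF w])
      show "LL \<inter> cyl w \<in> fmeasurable lborel" using LLs cyl_sets[of w] cyl_subset[of w] by (intro fmeasurable_irr) auto
    qed
    finally show "\<delta> * measure lborel (cyl w) \<le> measure lborel (LL \<inter> cyl w)" .
  qed
  moreover have "AE x in lborel. x \<in> irr \<longrightarrow> eventually (\<lambda>i. real (dig x i) \<le> (real i + 1)\<^sup>2) sequentially"
  proof (rule AE_dig_le)
    show "summable (\<lambda>i::nat. 1 / (real i + 1)\<^sup>2)"
      using summable_inverse_square_Suc by (simp add: divide_inverse add.commute)
  qed (auto intro!: zero_less_power)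
  ultimately have "AE x in lborel. x \<in> irr \<longrightarrow> upper_density {N. 1 \<le> N \<and> birkhoff_S f x q0 N \<ge> psi (ln (real N))} > 0"
    using C(2)
  proof eventually_elim
    case (elim x)
    show ?case
    proof
      assume x: "x \<in> irr"
      obtain w where w: "positive w" "x \<in> Lim w" using elim(1) x by (auto simp: LL_def)
      show "upper_density {N. 1 \<le> N \<and> birkhoff_S f x q0 N \<ge> psi (ln (real N))} > 0"
      proof (rule positive_upper_density[OF x mono C(1) _ _ \<beta> _ pos])
        show "eventually (\<lambda>n. real (qd x n) \<le> exp (C * real n)) sequentially" using elim(3) x by (simp add: qd_def)
        show "eventually (\<lambda>i. real (dig x i) \<le> (real i + 1)\<^sup>2) sequentially" using elim(2) x by blast
        show "2 / c0 * (psi ((2 * C + 1) * (real j + 1)) + (C1 + V + 1) * (real j + 1)) \<le> real (A j)" for j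
          using A(1)[of j] by (simp add: \<Psi>_def C4_def)
        fix j0 :: nat
        obtain l where l: "l \<ge> j0" "x \<in> G w l" using w(2) by (auto simp: Lim_def)
        have Al: "A (s * l) \<le> (s * l + 1)\<^sup>2" "x \<in> F w (s * l)" using l(2) by (auto simp: G_def split: if_splits)
        obtain u where u: "length u = s * l" "positive u" "x \<in> window (A (s * l)) (VV w u @ u @ hh w u)"
          using Al(2) by (auto simp: F_def)
        define n where "n = length (VV w u @ u @ hh w u)"
        have "1 * l \<le> s * l" by (rule mult_le_mono1) (simp add: s_def)
        then have j0: "length u \<ge> j0" using u(1) l(1) by linarith
        have px: "pre x n = VV w u @ u @ hh w u" using u(3) by (simp add: window_def cyl_def n_def)
        have dg: "A (length u) \<le> dig x n" "dig x n < 2 * A (length u)" using u by (auto simp: window_def n_def)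
        have e: "length (VV w u) \<le> length w + R" "state d (VV w u) = (1, 0)" "even (length (VV w u)) = good u"
          using ext[OF w(1), of "good u"] by (auto simp: VV_def)
        have Dv: "den (VV w u) \<le> den (w @ ext w True) + den (w @ ext w False)"
          by (cases "good u") (auto simp: VV_def)
        have sg: "(-1) ^ n = \<epsilon>" using hh[OF w(1) u(2)] \<epsilon> unfolding n_def[symmetric] by (cases "even n") auto
        show "\<exists>u v g n. length u \<ge> j0 \<and> n = length v + length u + length g \<and> pre x n = v @ u @ g \<and>
          length v \<le> length w + R \<and> den v \<le> den (w @ ext w True) + den (w @ ext w False) \<and> 2 \<le> length g \<and> length g \<le> R \<and> (\<forall>a\<in>set g. a \<le> R) \<and>
          state d v = (1, 0) \<and> state d (v @ u @ g) = (1, 0) \<and>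
          (even (length v) \<and> good u \<or> odd (length v) \<and> \<not> good u) \<and> (-1) ^ n = \<epsilon> \<and>
          A (length u) \<le> dig x n \<and> dig x n < 2 * A (length u) \<and> A (length u) \<le> (length u + 1)\<^sup>2"
        proof (rule exI[of _ u], rule exI[of _ "VV w u"], rule exI[of _ "hh w u"], rule exI[of _ n], intro conjI)
          show "n = length (VV w u) + length u + length (hh w u)" by (simp add: n_def)
          show "even (length (VV w u)) \<and> good u \<or> odd (length (VV w u)) \<and> \<not> good u" using e(3) by blast
          show "A (length u) \<le> (length u + 1)\<^sup>2" using Al(1) u(1) by simp
        qed (use j0 px dg e(1,2) Dv sg hh[OF w(1) u(2)] in blast)+
      qed
    qed
  qed
  then show ?thesis by (rule AE_irr)
qed

end

lemma common_denominator:
  assumes "finite S" "S \<subseteq> \<rat>"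
  shows "\<exists>d\<ge>2. \<forall>s\<in>S. real d * s \<in> \<int>"
  using assms
proof (induction S rule: finite_induct)
  case empty
  show ?case by (intro exI[of _ 2]) simp
next
  case (insert r S)
  then obtain d where d: "d \<ge> 2" "\<forall>s\<in>S. real d * s \<in> \<int>" by auto
  have "r \<in> \<rat>" using insert by simp
  then obtain a b where ab: "r = of_int a / of_int b" "b > 0" by (auto elim: Rats_cases')
  define c where "c = d * nat b"
  have b: "real (nat b) = of_int b" using ab by simp
  have "c \<ge> 2"
  proof -
    have "2 * 1 \<le> d * nat b" using d(1) ab(2) by (intro mult_le_mono) auto
    then show ?thesis by (simp add: c_def)
  qed
  moreover have "real c * s \<in> \<int>" if "s \<in> insert r S" for s
  proof (cases "s = r")
    case True
    have "real c * r = of_int (int d * a)" using ab b by (simp add: c_def)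
    then show ?thesis using True by (metis Ints_of_int)
  next
    case False
    then have "real d * s \<in> \<int>" using d(2) that by blast
    then have "real (nat b) * (real d * s) \<in> \<int>" by (rule Ints_mult[OF Ints_of_nat])
    then show ?thesis by (simp only: c_def of_nat_mult mult_ac)
  qed
  ultimately show ?case by blast
qed

theorem theorem1p1:
  fixes psi :: "real \<Rightarrow> real" and f :: "real \<Rightarrow> real" and q :: real
  assumes psi_mono: "mono_on {0<..} psi"
    and psi_pos: "\<forall>x>0. psi x > 0"
    and f_pw: "pw_smooth_rat_disc f"
    and f_int: "f integrable_on {0..1}"
    and q_rat: "q \<in> \<rat>"
  shows "(\<not> summable (\<lambda>k::nat. 1 / psi (real k + 1)) \<longrightarrow>
            (AE \<alpha> in lborel. \<alpha> \<in> {0..<1} \<longrightarrow>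
               upper_density {N. 1 \<le> N \<and> birkhoff_S f \<alpha> q N \<ge> psi (ln (real N))} > 0 \<and>
               upper_density {N. 1 \<le> N \<and> birkhoff_S f \<alpha> q N \<le> - psi (ln (real N))} > 0))
       \<and> (summable (\<lambda>k::nat. 1 / psi (real k + 1)) \<longrightarrow>
            (\<exists>c>0. AE \<alpha> in lborel. \<alpha> \<in> {0..<1} \<longrightarrow>
               finite {N. 1 \<le> N \<and>
                 \<bar>birkhoff_S f \<alpha> q N\<bar> \<ge> psi (ln (real N)) + c * ln (real N) * ln (ln (real N))}))"
proof -
  obtain P L f0 Lip V p0 where D: "finite P" "P \<subseteq> \<rat> \<inter> {0..<1}" "p0 \<in> P" "L p0 \<noteq> 0"
    "\<forall>z. z \<notin> \<rat> \<longrightarrow> f z = (\<Sum>p\<in>P. L p * saw (z - p)) + f0 z"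
    "\<forall>x. f0 (x + 1) = f0 x" "\<forall>x y. \<bar>f0 x - f0 y\<bar> \<le> Lip * \<bar>x - y\<bar>"
    "\<forall>x q. q \<ge> 1 \<longrightarrow> \<bar>(\<Sum>j<q. f0 (x + real j / real q)) - real q * integral {0..1} f\<bar> \<le> V / real q"
    using pw_smooth_decomposition[OF f_pw] by blast
  obtain d where d: "d \<ge> 2" "\<forall>s\<in>(\<lambda>p. q - p) ` P. real d * s \<in> \<int>"
  proof -
    have "(\<lambda>p. q - p) ` P \<subseteq> \<rat>" using D(2) q_rat by (intro image_subsetI Rats_diff) auto
    then show ?thesis using common_denominator[of "(\<lambda>p. q - p) ` P"] D(1) that by blast
  qed
  have jd: "jump_data f f0 L P Lip V q d"
    using D d q_rat by unfold_locales auto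
  have P01: "P \<subseteq> {0..<1}" using D(2) by auto
  have "AE \<alpha> in lborel. \<alpha> \<in> {0..<1} \<longrightarrow>
      upper_density {N. 1 \<le> N \<and> birkhoff_S f \<alpha> q N \<ge> psi (ln (real N))} > 0 \<and>
      upper_density {N. 1 \<le> N \<and> birkhoff_S f \<alpha> q N \<le> - psi (ln (real N))} > 0"
    if div: "\<not> summable (\<lambda>k::nat. 1 / psi (real k + 1))"
  proof -
    have "AE \<alpha> in lborel. \<alpha> \<in> {0..<1} \<longrightarrow> upper_density {N. 1 \<le> N \<and> birkhoff_S f \<alpha> q N \<ge> psi (ln (real N))} > 0"
      by (rule jump_data.AE_positive_upper_density[OF jd psi_mono psi_pos div P01 D(3,4)])
    moreover have "AE \<alpha> in lborel. \<alpha> \<in> {0..<1} \<longrightarrow> upper_density {N. 1 \<le> N \<and> birkhoff_S (\<lambda>x. - f x) \<alpha> q N \<ge> psi (ln (real N))} > 0"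
      by (rule jump_data.AE_positive_upper_density[OF jump_data_uminus[OF jd] psi_mono psi_pos div P01 D(3)]) (use D(4) in simp)
    ultimately show ?thesis
    proof eventually_elim
      case (elim \<alpha>)
      have "psi y \<le> - b \<longleftrightarrow> b \<le> - psi y" for b y by linarith
      then show ?case using elim by (simp add: birkhoff_S_uminus)
    qed
  qed
  moreover have "\<exists>c>0. AE \<alpha> in lborel. \<alpha> \<in> {0..<1} \<longrightarrow>
      finite {N. 1 \<le> N \<and> \<bar>birkhoff_S f \<alpha> q N\<bar> \<ge> psi (ln (real N)) + c * ln (real N) * ln (ln (real N))}"
    if "summable (\<lambda>k::nat. 1 / psi (real k + 1))"
    by (rule jump_data.finitely_many_large[OF jd psi_mono psi_pos that])
  ultimately show ?thesis by blast
qed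

end
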